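(* Let $X$ be an affine toric variety (not necessarily normal) over $\mathbb{K}$ with an effective action of a torus $\mathbb{T}$, let $B=\mathbb{K}[X]$, and let $\delta=\delta_e$ be a maximal $\mathbb{T}$-homogeneous LND of $B$, with kernel $A=\mathrm{Ker}(\delta)$. Let $y_1,\dots,y_k,z_1,\dots,z_m$ be $\mathbb{T}$-homogeneous, irreducible, pairwise non-proportional generators of the algebra $B$ such that $y_1,\dots,y_k$ are generators of the algebra $A$, and let $S_\delta$ be the subgroup of $\mathrm{Aut}(B)_\delta$ consisting of automorphisms that send $\mathbb{T}$-homogeneous elements of $B$ to $\mathbb{T}$-homogeneous elements and permute the set $\{y_1,\dots,y_k\}$. Then: (1) the group $S_\delta$ is isomorphic to a subgroup of the symmetric group $S_k$ on the set $y_1,\dots,y_k$; in particular, $S_\delta$ is finite; (2) $\mathrm{Aut}(B)_\delta=(S_\delta\ltimes\mathbb{T}_\delta)\ltimes\mathcal{U}(\delta)$.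
   Context: $\mathbb{K}$ is an algebraically closed field of characteristic zero. An irreducible variety is toric if it admits a regular action of a torus $\mathbb{T}$ with an open orbit; here the action is effective, so $\dim\mathbb{T}=\dim X=n$. Let $N$ be the lattice of one-parameter subgroups of $\mathbb{T}$, $M=\mathrm{Hom}(N,\mathbb{Z})$ the character lattice, $\langle\cdot,\cdot\rangle\colon M\times N\to\mathbb{Z}$ the pairing, extended to $M_\mathbb{Q}\times N_\mathbb{Q}$, and $\chi^m$ the character corresponding to $m\in M$. Then $B=\bigoplus_{m\in S}\mathbb{K}\chi^m$ for a finitely generated semigroup $S\subseteq M$ generating $M$ as a group, and $\mathbb{T}$ acts by $t\cdot\chi^m=t^m\chi^m$ with $t^m=t_1^{m_1}\cdots t_n^{m_n}$. The associated cone $\sigma\subset N_\mathbb{Q}$ is the pointed rational polyhedral cone of the normalization of $X$, i.e. $\sigma^\vee=\{m\in M_\mathbb{Q}:\langle m,v\rangle\ge0\ \forall v\in\sigma\}$ is the cone generated by $S$. Let $v_1,\dots,v_r$ be the primitive lattice vectors on the extremal rays $\rho_1,\dots,\rho_r$ of $\sigma$. A Demazure root of $\sigma$ corresponding to $\rho_i$ is $e\in M$ with $\langle e,v_i\rangle=-1$ and $\langle e,v_j\rangle\ge0$ for $j\ne i$; it defines $\delta_e(\chi^m)=\langle m,v_i\rangle\chi^{m+e}$. A derivation is locally nilpotent (LND) if each element of $B$ is killed by some power of it. It is $\mathbb{T}$-homogeneous if it sends elements homogeneous for the $M$-grading to homogeneous elements. Every nonzero homogeneous LND of $B$ has the form $c\,\delta_e$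 for some Demazure root $e$ of $\sigma$ and $c\in\mathbb{K}^\times$ (in the non-normal case not every Demazure root need give an LND of $B$); since proportional LNDs have the same stabilizer one takes $c=1$. Two LNDs are equivalent ($\sim$) if their kernels coincide. A nonzero LND is maximal if every nonzero LND of $B$ commuting with it is equivalent to it. $\mathrm{Aut}(B)_\delta=\{\varphi\in\mathrm{Aut}(B):\varphi\delta=\delta\varphi\}$. $\mathcal{U}(\delta)=\{\exp(\partial):\partial\text{ an LND of }B,\ \partial\sim\delta\text{ or }\partial=0\}$, an abelian subgroup of $\mathrm{Aut}(B)$. $\mathbb{T}_\delta=\{t\in\mathbb{T}:t^e=1\}=\mathbb{T}\cap\mathrm{Aut}(B)_\delta$, an $(n-1)$-dimensional subtorus of $\mathbb{T}$.
   Formalization: Part (2) is proved only when y_1,…,y_k are characters for a common base point of the open orbit (y_i = t^{m_i}χ^{m_i} for one t in the torus); for arbitrary independent rescalings of the homogeneous generators (2) can fail. Part (1) is proved without this condition. *)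

theory Defs
  imports
    "HOL-Analysis.Finite_Cartesian_Product"
    "HOL-Library.Poly_Mapping"
    "HOL-Computational_Algebra.Polynomial"
    "HOL-Algebra.Coset"
    "HOL-Algebra.Bij"
    "HOL-Algebra.Ring_Divisibility"
begin

text \<open>
  The lattices \<open>M\<close> and \<open>N\<close> are both identified with \<open>int ^ 'n\<close>, with
  the standard pairing.  The group algebra of \<open>M\<close> (Laurent polynomials) is
  \<open>(int ^ 'n) \<Rightarrow>\<^sub>0 'k\<close> with the convolution product, and \<open>\<chi>\<^sup>m\<close> is
  \<open>Poly_Mapping.single m 1\<close>.
\<close>

type_synonym ('n, 'k) laurent = "(int ^ 'n) \<Rightarrow>\<^sub>0 'k"

abbreviation const :: "'k::zero \<Rightarrow> ('n::finite, 'k) laurent"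
  where "const c \<equiv> Poly_Mapping.single 0 c"

abbreviation chi :: "int ^ 'n \<Rightarrow> ('n::finite, 'k::zero_neq_one) laurent"
  where "chi m \<equiv> Poly_Mapping.single m 1"

definition lin_ext ::
    "(int ^ 'n \<Rightarrow> ('n, 'k) laurent) \<Rightarrow> ('n::finite, 'k::comm_ring_1) laurent \<Rightarrow> ('n, 'k) laurent"
  where "lin_ext h f = (\<Sum>m\<in>Poly_Mapping.keys f. const (Poly_Mapping.lookup f m) * h m)"


subsection \<open>Cones\<close>

definition pairing :: "'a::comm_ring_1 ^ 'n \<Rightarrow> 'a ^ 'n \<Rightarrow> 'a::comm_ring_1"
  where "pairing m v = (\<Sum>i\<in>UNIV. m $ i * v $ i)"

definition rat_vec :: "int ^ 'n \<Rightarrow> rat ^ 'n"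
  where "rat_vec m = (\<chi> i. of_int (m $ i))"

definition cone_gen :: "(rat ^ 'n) set \<Rightarrow> (rat ^ 'n) set"
  where "cone_gen G =
    {(\<Sum>g\<in>F. c g *s g) | F c. finite F \<and> F \<subseteq> G \<and> (\<forall>g\<in>F. 0 \<le> c g)}"

definition dual_cone :: "(rat ^ 'n) set \<Rightarrow> (rat ^ 'n) set"
  where "dual_cone \<sigma> = {m. \<forall>v\<in>\<sigma>. 0 \<le> pairing m v}"

definition pointed_polyhedral_cone :: "(rat ^ 'n) set \<Rightarrow> bool"
  where "pointed_polyhedral_cone \<sigma> \<longleftrightarrow>
    (\<exists>G. finite G \<and> \<sigma> = cone_gen G) \<and> \<sigma> \<inter> uminus ` \<sigma> = {0}"

definition associated_cone :: "(int ^ 'n) set \<Rightarrow> (rat ^ 'n) set \<Rightarrow> bool"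
  where "associated_cone S \<sigma> \<longleftrightarrow>
    pointed_polyhedral_cone \<sigma> \<and> dual_cone \<sigma> = cone_gen (rat_vec ` S)"

definition extremal_ray :: "(rat ^ 'n) set \<Rightarrow> (rat ^ 'n) set \<Rightarrow> bool"
  where "extremal_ray \<sigma> \<rho> \<longleftrightarrow>
    (\<exists>v. v \<noteq> 0 \<and> \<rho> = cone_gen {v}) \<and> \<rho> \<subseteq> \<sigma> \<and>
    (\<forall>a\<in>\<sigma>. \<forall>b\<in>\<sigma>. a + b \<in> \<rho> \<longrightarrow> a \<in> \<rho> \<and> b \<in> \<rho>)"

definition primitive_vec :: "int ^ 'n \<Rightarrow> bool"
  where "primitive_vec v \<longleftrightarrow> Gcd {v $ i | i. True} = 1"

definition ray_generator :: "(rat ^ 'n) set \<Rightarrow> int ^ 'n \<Rightarrow> bool"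
  where "ray_generator \<sigma> v \<longleftrightarrow> primitive_vec v \<and> extremal_ray \<sigma> (cone_gen {rat_vec v})"

definition demazure_root :: "(rat ^ 'n) set \<Rightarrow> int ^ 'n \<Rightarrow> int ^ 'n \<Rightarrow> bool"
  where "demazure_root \<sigma> v e \<longleftrightarrow>
    ray_generator \<sigma> v \<and> pairing e v = -1 \<and>
    (\<forall>w. ray_generator \<sigma> w \<and> w \<noteq> v \<longrightarrow> 0 \<le> pairing e w)"


subsection \<open>The algebra and its torus action\<close>

text \<open>``Semigroup'' means submonoid, since the coordinate algebra is unital.\<close>

definition affine_semigroup :: "(int ^ 'n) set \<Rightarrow> bool"
  where "affine_semigroup S \<longleftrightarrow>
    (\<exists>G. finite G \<and> S = (\<lambda>H. 0 \<in> H \<and> (\<forall>a\<in>H. \<forall>b\<in>H. a + b \<in> H)) hull G)"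

definition generates_lattice :: "(int ^ 'n) set \<Rightarrow> bool"
  where "generates_lattice S \<longleftrightarrow>
    (\<lambda>H. 0 \<in> H \<and> (\<forall>a\<in>H. \<forall>b\<in>H. a - b \<in> H)) hull S = UNIV"

definition semigroup_algebra :: "(int ^ 'n) set \<Rightarrow> ('n::finite, 'k::comm_ring_1) laurent set"
  where "semigroup_algebra S = {f. Poly_Mapping.keys f \<subseteq> S}"

definition homogeneous :: "('n::finite, 'k::zero) laurent \<Rightarrow> bool"
  where "homogeneous f \<longleftrightarrow> (\<exists>m c. f = Poly_Mapping.single m c)"

definition alg_gen :: "('n::finite, 'k::comm_ring_1) laurent set \<Rightarrow> ('n, 'k) laurent set"
  where "alg_gen G =
    (\<lambda>H. range const \<subseteq> H \<and> (\<forall>a\<in>H. \<forall>b\<in>H. a + b \<in> H \<and> a * b \<in> H)) hull G"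

definition ring_of :: "('n::finite, 'k::comm_ring_1) laurent set \<Rightarrow> ('n, 'k) laurent ring"
  where "ring_of B = \<lparr>carrier = B, mult = (*), one = 1, zero = 0, add = (+)\<rparr>"

definition proportional :: "('n::finite, 'k::comm_ring_1) laurent \<Rightarrow> ('n, 'k) laurent \<Rightarrow> bool"
  where "proportional f g \<longleftrightarrow> (\<exists>c. c \<noteq> 0 \<and> f = const c * g)"

definition torus :: "('k::field ^ 'n) set"
  where "torus = {t. \<forall>i. t $ i \<noteq> 0}"

definition torus_pow :: "'k::field ^ 'n \<Rightarrow> int ^ 'n \<Rightarrow> 'k"
  where "torus_pow t m = (\<Prod>i\<in>UNIV. t $ i powi m $ i)"

text \<open>
  Automorphisms are extensional functions on the carrier, as in \<^const>\<open>BijGroup\<close>.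
\<close>

definition torus_act ::
    "('n::finite, 'k::field) laurent set \<Rightarrow> 'k ^ 'n \<Rightarrow> ('n, 'k) laurent \<Rightarrow> ('n, 'k) laurent"
  where "torus_act B t = restrict (lin_ext (\<lambda>m. const (torus_pow t m) * chi m)) B"

definition linear_on ::
    "('n::finite, 'k::comm_ring_1) laurent set \<Rightarrow> (('n, 'k) laurent \<Rightarrow> ('n, 'k) laurent) \<Rightarrow> bool"
  where "linear_on B d \<longleftrightarrow>
    (\<forall>a\<in>B. \<forall>b\<in>B. d (a + b) = d a + d b) \<and> (\<forall>c. \<forall>a\<in>B. d (const c * a) = const c * d a)"

definition Aut ::
    "('n::finite, 'k::comm_ring_1) laurent set \<Rightarrow> (('n, 'k) laurent \<Rightarrow> ('n, 'k) laurent) set"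
  where "Aut B =
    {\<phi> \<in> Bij B. linear_on B \<phi> \<and> \<phi> 1 = 1 \<and> (\<forall>a\<in>B. \<forall>b\<in>B. \<phi> (a * b) = \<phi> a * \<phi> b)}"


subsection \<open>Locally nilpotent derivations\<close>

text \<open>
  A derivation of \<open>B\<close> is represented by a function on the ambient type, of which only the values
  on \<open>B\<close> are relevant.
\<close>

definition lnd ::
    "('n::finite, 'k::comm_ring_1) laurent set \<Rightarrow> (('n, 'k) laurent \<Rightarrow> ('n, 'k) laurent) \<Rightarrow> bool"
  where "lnd B d \<longleftrightarrow>
    d ` B \<subseteq> B \<and> linear_on B d \<and> (\<forall>a\<in>B. \<forall>b\<in>B. d (a * b) = d a * b + a * d b) \<and>
    (\<forall>b\<in>B. \<exists>k. (d ^^ k) b = 0)"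

definition nonzero_on ::
    "('n::finite, 'k::comm_ring_1) laurent set \<Rightarrow> (('n, 'k) laurent \<Rightarrow> ('n, 'k) laurent) \<Rightarrow> bool"
  where "nonzero_on B d \<longleftrightarrow> (\<exists>b\<in>B. d b \<noteq> 0)"

definition commute_on ::
    "('n::finite, 'k) laurent set \<Rightarrow> (('n, 'k::zero) laurent \<Rightarrow> ('n, 'k) laurent) \<Rightarrow>
     (('n, 'k) laurent \<Rightarrow> ('n, 'k) laurent) \<Rightarrow> bool"
  where "commute_on B f g \<longleftrightarrow> (\<forall>b\<in>B. f (g b) = g (f b))"

definition ker_on ::
    "('n::finite, 'k::comm_ring_1) laurent set \<Rightarrow> (('n, 'k) laurent \<Rightarrow> ('n, 'k) laurent) \<Rightarrow>
     ('n, 'k) laurent set"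
  where "ker_on B d = {b \<in> B. d b = 0}"

definition maximal_lnd ::
    "('n::finite, 'k::comm_ring_1) laurent set \<Rightarrow> (('n, 'k) laurent \<Rightarrow> ('n, 'k) laurent) \<Rightarrow> bool"
  where "maximal_lnd B d \<longleftrightarrow>
    lnd B d \<and> nonzero_on B d \<and>
    (\<forall>d'. lnd B d' \<and> nonzero_on B d' \<and> commute_on B d' d \<longrightarrow> ker_on B d' = ker_on B d)"

definition homogeneous_map ::
    "('n::finite, 'k::zero) laurent set \<Rightarrow> (('n, 'k) laurent \<Rightarrow> ('n, 'k) laurent) \<Rightarrow> bool"
  where "homogeneous_map B f \<longleftrightarrow> (\<forall>b\<in>B. homogeneous b \<longrightarrow> homogeneous (f b))"

definition demazure_der ::
    "int ^ 'n \<Rightarrow> int ^ 'n \<Rightarrow> ('n::finite, 'k::comm_ring_1) laurent \<Rightarrow> ('n, 'k) laurent"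
  where "demazure_der v e = lin_ext (\<lambda>m. const (of_int (pairing m v)) * chi (m + e))"

text \<open>The index set of the sum is finite whenever \<open>d\<close> is an LND of \<open>B\<close>.\<close>

definition exp_der ::
    "('n::finite, 'k::field_char_0) laurent set \<Rightarrow> (('n, 'k) laurent \<Rightarrow> ('n, 'k) laurent) \<Rightarrow>
     ('n, 'k) laurent \<Rightarrow> ('n, 'k) laurent"
  where "exp_der B d =
    restrict (\<lambda>b. \<Sum>i | (d ^^ i) b \<noteq> 0. const (1 / fact i) * (d ^^ i) b) B"


subsection \<open>Subgroups of the automorphism group\<close>

definition Aut_stab ::
    "('n::finite, 'k::comm_ring_1) laurent set \<Rightarrow> (('n, 'k) laurent \<Rightarrow> ('n, 'k) laurent) \<Rightarrow>
     (('n, 'k) laurent \<Rightarrow> ('n, 'k) laurent) set"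
  where "Aut_stab B d = {\<phi> \<in> Aut B. commute_on B \<phi> d}"

definition U_group ::
    "('n::finite, 'k::field_char_0) laurent set \<Rightarrow> (('n, 'k) laurent \<Rightarrow> ('n, 'k) laurent) \<Rightarrow>
     (('n, 'k) laurent \<Rightarrow> ('n, 'k) laurent) set"
  where "U_group B d =
    {exp_der B d' | d'. lnd B d' \<and> (ker_on B d' = ker_on B d \<or> \<not> nonzero_on B d')}"

definition T_group ::
    "('n::finite, 'k::field) laurent set \<Rightarrow> int ^ 'n \<Rightarrow> (('n, 'k) laurent \<Rightarrow> ('n, 'k) laurent) set"
  where "T_group B e = {torus_act B t | t. t \<in> torus \<and> torus_pow t e = 1}"

definition S_group ::
    "('n::finite, 'k::comm_ring_1) laurent set \<Rightarrow> (('n, 'k) laurent \<Rightarrow> ('n, 'k) laurent) \<Rightarrow>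
     ('n, 'k) laurent set \<Rightarrow> (('n, 'k) laurent \<Rightarrow> ('n, 'k) laurent) set"
  where "S_group B d Y = {\<phi> \<in> Aut_stab B d. homogeneous_map B \<phi> \<and> \<phi> ` Y = Y}"

definition sub_aut ::
    "('n::finite, 'k::comm_ring_1) laurent set \<Rightarrow> (('n, 'k) laurent \<Rightarrow> ('n, 'k) laurent) set \<Rightarrow>
     (('n, 'k) laurent \<Rightarrow> ('n, 'k) laurent) monoid"
  where "sub_aut B H = (BijGroup B)\<lparr>carrier := H\<rparr>"

text \<open>\<open>G = H \<ltimes> N\<close> as an internal semidirect product with normal factor \<open>N\<close>.\<close>

definition semidirect :: "('g, 'x) monoid_scheme \<Rightarrow> 'g set \<Rightarrow> 'g set \<Rightarrow> bool"
  where "semidirect G H N \<longleftrightarrow>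
    subgroup H G \<and> N \<lhd> G \<and> H \<inter> N = {\<one>\<^bsub>G\<^esub>} \<and> H <#>\<^bsub>G\<^esub> N = carrier G"

text \<open>
  The functions \<open>\<chi>\<^sup>m\<close> on \<open>X\<close> depend on the choice of a base point of the open orbit; another base
  point replaces every \<open>\<chi>\<^sup>m\<close> by \<open>t\<^sup>m \<chi>\<^sup>m\<close> for one \<open>t\<close> in the torus.  The predicate says
  that the members of \<open>Y\<close> are characters with respect to a common base point, equivalently that
  they all take the value 1 at some point of the open orbit.  It excludes arbitrary independent
  rescalings of algebraically dependent generators: those can destroy the symmetries of \<open>Y\<close> as a
  set and make the group permuting \<open>Y\<close> too small for the semidirect decomposition.
\<close>

definition characters_at_base_point :: "('n::finite, 'k::field) laurent set \<Rightarrow> bool"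
  where "characters_at_base_point Y \<longleftrightarrow>
    (\<exists>t\<in>torus. \<forall>y\<in>Y. \<exists>m. y = const (torus_pow t m) * chi m)"

end

theory Submission
  imports Defs
begin

text \<open>
  Put \<open>x = \<chi>\<^bsup>-e\<^esup>\<close>, let \<open>R\<close> be the span of the characters orthogonal to \<open>v\<close>, and call
  \<open>\<langle>m, v\<rangle>\<close> the height of \<open>\<chi>\<^sup>m\<close>.  Because \<open>\<langle>e, v\<rangle> = -1\<close>, the Laurent polynomials of nonnegative
  height form the polynomial ring \<open>R[x]\<close>; it contains \<open>B\<close>, the derivation \<open>\<delta>\<close> is the
  derivative with respect to \<open>x\<close>, and \<open>A\<close> is the span of the characters in \<open>B\<close> of height 0.

  The heart of the matter is that every \<open>\<phi>\<close> in the stabilizer of \<open>\<delta>\<close> maps characters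
  in \<open>A\<close> to multiples of characters.  Conjugate by \<open>\<phi>\<close> the vector field of a one-parameter
  subgroup of \<open>\<T>\<^sub>\<delta>\<close>.  The result is a locally finite derivation commuting with \<open>\<delta>\<close>.
  If it were not diagonal on \<open>A\<close>, a component of extremal weight would be a locally nilpotent
  derivation that commutes with \<open>\<delta>\<close> but does not vanish on \<open>A\<close>, against
  maximality (\<open>locally_finite_commuting_diagonal\<close>).  Hence \<open>\<phi>\<close> carries eigenvectors of the
  torus in \<open>A\<close> to eigenvectors (\<open>stabilizer_monomial_on_kernel\<close>).

  Since \<open>\<phi>\<close> commutes with the derivative with respect to \<open>x\<close>, it acts on \<open>R[x]\<close> by a monomial
  map of \<open>R\<close> together with a substitution \<open>x \<mapsto> x + h\<close>, where \<open>h \<in> R\<close>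
  (\<open>stabilizer_on_characters\<close>).  The part of \<open>\<phi> \<chi>\<^sup>m\<close> of greatest height is a homogeneous
  automorphism \<open>\<psi>\<close> that commutes with \<open>\<delta>\<close> and agrees with \<open>\<phi>\<close> on \<open>A\<close>, so
  \<open>\<psi>\<^bsup>-1\<^esup> \<phi>\<close> fixes \<open>A\<close> pointwise (\<open>stabilizer_decomposition\<close>).  The automorphisms
  in the stabilizer that fix \<open>A\<close> are the substitutions \<open>x \<mapsto> x + h\<close>; by Taylor's formula
  these are the exponentials of the derivations \<open>h \<delta>\<close>, and every locally nilpotent derivation
  equivalent to \<open>\<delta>\<close> has this form.  So \<open>\<U>(\<delta>)\<close> is the pointwise stabilizer of \<open>A\<close>
  (\<open>U_group_eq_kernel_fixing\<close>); in particular it is normal, and the stabilizer is its semidirect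
  product with the group of homogeneous elements.

  A homogeneous element \<open>\<psi>\<close> of the stabilizer acts by \<open>\<chi>\<^sup>m \<mapsto> c m \<chi>\<^bsup>\<tau> m\<^esup>\<close> with
  \<open>\<tau>\<close> additive and \<open>c\<close> multiplicative.  The exponents of the generators of \<open>A\<close> are the
  indecomposable elements of the monoid of exponents of \<open>A\<close>, and \<open>\<tau>\<close> permutes them
  (\<open>E_preserved\<close>).  If the generators take the value 1 at a common point of the open orbit, an
  element of \<open>\<T>\<^sub>\<delta>\<close> corrects the scalars so that \<open>\<psi>\<close> permutes the generators
  themselves (\<open>homogeneous_stab_decomposition\<close>).  Finally an element of \<open>S\<^sub>\<delta>\<close> is
  determined by its action on the generators of \<open>A\<close>, because a homogeneous element of the
  stabilizer that fixes \<open>A\<close> is the identity (\<open>homogeneous_stab_fixing_kernel\<close>).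
\<close>

section \<open>Linear maps given on characters\<close>

abbreviation single :: "'a \<Rightarrow> 'b::zero \<Rightarrow> 'a \<Rightarrow>\<^sub>0 'b" where "single \<equiv> Poly_Mapping.single"
abbreviation lookup :: "('a \<Rightarrow>\<^sub>0 'b::zero) \<Rightarrow> 'a \<Rightarrow> 'b" where "lookup \<equiv> Poly_Mapping.lookup"
abbreviation keys :: "('a \<Rightarrow>\<^sub>0 'b::zero) \<Rightarrow> 'a set" where "keys \<equiv> Poly_Mapping.keys"

lemma lookup_const_mult [simp]:
  "lookup (const c * f) p = c * lookup f p"
  for f :: "('n::finite, 'k::comm_ring_1) laurent"
  by (simp add: lookup_mult lookup_single when_mult)

lemma lookup_chi_mult [simp]:
  "lookup (chi a * f) p = lookup f (p - a)"
  for f :: "('n::finite, 'k::comm_ring_1) laurent"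
proof -
  have "lookup (chi a * f) p
      = (\<Sum>q. lookup f q when p = a + q)"
    by (simp add: lookup_mult lookup_single when_mult)
  also have "\<dots> = (\<Sum>q. lookup f q when q = p - a)"
    by (rule arg_cong[where f = Sum_any], rule ext) (auto simp: when_def algebra_simps)
  finally show ?thesis by simp
qed

lemma chi_add: "chi (a + b) = chi a * (chi b :: ('n::finite, 'k::comm_ring_1) laurent)"
  by (simp add: mult_single)

lemma const_mult_chi: "const c * (chi m :: ('n::finite, 'k::comm_ring_1) laurent) = single m c"
  by (simp add: mult_single)

lemma lookup_single_mult:
  "lookup (single a c * f) p = c * lookup f (p - a)"
  for f :: "('n::finite, 'k::comm_ring_1) laurent"
  by (subst const_mult_chi[symmetric]) (simp only: mult.assoc lookup_const_mult lookup_chi_mult)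

lemma const_mult: "const (c * c') = const c * (const c' :: ('n::finite, 'k::comm_ring_1) laurent)"
  by (simp add: mult_single)

lemma const_add: "const (c + c') = const c + (const c' :: ('n::finite, 'k::comm_ring_1) laurent)"
  by (simp add: single_add)

lemma chi_power: "chi a ^ k = (chi (of_nat k *s a) :: ('n::finite, 'k::comm_ring_1) laurent)"
proof (induction k)
  case 0
  have "(0::int) *s a = 0" by (simp add: vec_eq_iff)
  then show ?case by simp
next
  case (Suc k)
  have "of_nat (Suc k) *s a = a + of_nat k *s a" by (simp add: vec_eq_iff algebra_simps)
  then show ?case using Suc by (simp add: chi_add)
qed

lemma chi_neq_0 [simp]: "chi a \<noteq> (0 :: ('n::finite, 'k::comm_ring_1) laurent)"
  by (metis lookup_single_eq lookup_zero zero_neq_one)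

lemma chi_mult_cancel: "chi a * f = chi a * g \<longleftrightarrow> f = g"
  for f g :: "('n::finite, 'k::comm_ring_1) laurent"
proof
  assume "chi a * f = chi a * g"
  then have "chi (- a) * (chi a * f) = chi (- a) * (chi a * g)" by simp
  then show "f = g" by (simp add: mult.assoc[symmetric] mult_single)
qed simp

lemma mem_semigroup_algebra_iff:
  "f \<in> semigroup_algebra S \<longleftrightarrow> (\<forall>p. lookup f p \<noteq> 0 \<longrightarrow> p \<in> S)"
  by (auto simp: semigroup_algebra_def in_keys_iff)

lemma semigroup_algebra_zero [simp]: "0 \<in> semigroup_algebra S"
  by (simp add: semigroup_algebra_def)

lemma semigroup_algebra_add:
  "f \<in> semigroup_algebra S \<Longrightarrow> g \<in> semigroup_algebra S \<Longrightarrow> f + g \<in> semigroup_algebra S"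
  using keys_add[of f g] by (auto simp: semigroup_algebra_def)

lemma semigroup_algebra_const_mult:
  "f \<in> semigroup_algebra S \<Longrightarrow> const c * f \<in> semigroup_algebra S"
  unfolding mem_semigroup_algebra_iff lookup_const_mult by (metis mult_zero_right)

lemma semigroup_algebra_sum:
  "(\<And>i. i \<in> I \<Longrightarrow> f i \<in> semigroup_algebra S) \<Longrightarrow> sum f I \<in> semigroup_algebra S"
  by (induction I rule: infinite_finite_induct) (auto intro: semigroup_algebra_add)

lemma single_in_semigroup_algebra:
  "m \<in> S \<Longrightarrow> single m c \<in> semigroup_algebra S"
  by (simp add: semigroup_algebra_def)

lemma chi_in_semigroup_algebra [simp]:
  "chi m \<in> (semigroup_algebra S :: ('n::finite, 'k::comm_ring_1) laurent set) \<longleftrightarrow> m \<in> S"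
  by (simp add: semigroup_algebra_def)

lemma semigroup_algebra_mult:
  assumes "\<And>a b. a \<in> S \<Longrightarrow> b \<in> S \<Longrightarrow> a + b \<in> S"
    and "f \<in> semigroup_algebra S" "g \<in> semigroup_algebra S"
  shows "f * g \<in> semigroup_algebra S"
  using keys_mult[of f g] assms unfolding semigroup_algebra_def by blast

lemma laurent_expansion:
  "f = (\<Sum>m\<in>keys f. single m (lookup f m))"
  by (rule poly_mapping_eqI)
     (auto simp: lookup_sum lookup_single when_def in_keys_iff sum.delta)

lemma semigroup_algebra_induct [consumes 1, case_names zero monomial add]:
  assumes "f \<in> semigroup_algebra S"
    and "P 0"
    and "\<And>m c. m \<in> S \<Longrightarrow> P (single m c)"
    and "\<And>f g. f \<in> semigroup_algebra S \<Longrightarrow> g \<in> semigroup_algebra S \<Longrightarrow> P f \<Longrightarrow> P g \<Longrightarrow> P (f + g)"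
  shows "P f"
proof -
  let ?t = "\<lambda>m. single m (lookup f m)"
  have "P (\<Sum>m\<in>F. ?t m) \<and> (\<Sum>m\<in>F. ?t m) \<in> semigroup_algebra S"
    if "finite F" "F \<subseteq> keys f" for F
    using that
  proof (induction F rule: finite_induct)
    case empty
    then show ?case using assms(2) by simp
  next
    case (insert m F)
    moreover have "m \<in> S" using insert.prems assms(1) by (auto simp: semigroup_algebra_def)
    ultimately show ?case
      by (auto intro!: assms(3,4) semigroup_algebra_add single_in_semigroup_algebra)
  qed
  from this[of "keys f"] show ?thesis
    using laurent_expansion[of f] by simp
qed

lemma lin_ext_superset:
  assumes "finite F" "keys f \<subseteq> F"
  shows "lin_ext h f = (\<Sum>m\<in>F. const (lookup f m) * h m)"
  unfolding lin_ext_def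
  by (rule sum.mono_neutral_left) (use assms in \<open>auto simp: in_keys_iff\<close>)

lemma lin_ext_zero [simp]: "lin_ext h 0 = 0"
  by (simp add: lin_ext_def)

lemma lin_ext_add: "lin_ext h (f + g) = lin_ext h f + lin_ext h g"
proof -
  let ?F = "keys f \<union> keys g"
  have "lin_ext h (f + g) = (\<Sum>m\<in>?F. const (lookup (f + g) m) * h m)"
    by (rule lin_ext_superset) (use keys_add[of f g] in auto)
  also have "\<dots> = lin_ext h f + lin_ext h g"
    by (subst (1 2) lin_ext_superset[where F = ?F])
       (auto simp: lookup_add const_add algebra_simps sum.distrib)
  finally show ?thesis .
qed

lemma lin_ext_single [simp]: "lin_ext h (single m c) = const c * h m"
  by (subst lin_ext_superset[where F = "{m}"]) auto

lemma lin_ext_const_mult: "lin_ext h (const c * f) = const c * lin_ext h f"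
proof -
  have "lin_ext h (const c * f) = (\<Sum>m\<in>keys f. const (lookup (const c * f) m) * h m)"
    by (rule lin_ext_superset) (auto simp: in_keys_iff)
  then show ?thesis
    by (simp add: lin_ext_def sum_distrib_left const_mult mult.assoc del: single_zero)
qed

lemma linear_on_lin_ext: "linear_on B (lin_ext h)"
  by (simp add: linear_on_def lin_ext_add lin_ext_const_mult)

lemma lin_ext_in_semigroup_algebra:
  assumes "f \<in> semigroup_algebra S" "\<And>m. m \<in> S \<Longrightarrow> h m \<in> semigroup_algebra S'"
  shows "lin_ext h f \<in> semigroup_algebra S'"
  unfolding lin_ext_def
proof (rule semigroup_algebra_sum)
  fix m assume "m \<in> keys f"
  then have "m \<in> S" using assms(1) by (auto simp: semigroup_algebra_def)
  then show "const (lookup f m) * h m \<in> semigroup_algebra S'"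
    by (intro semigroup_algebra_const_mult assms(2))
qed

lemma linear_on_eq_lin_ext:
  assumes "linear_on (semigroup_algebra S) \<phi>" "f \<in> semigroup_algebra S"
  shows "\<phi> f = lin_ext (\<lambda>m. \<phi> (chi m)) f"
  using assms(2)
proof (induction rule: semigroup_algebra_induct)
  case zero
  have "\<phi> (const 0 * 0) = const 0 * \<phi> 0"
    using assms(1) unfolding linear_on_def by (meson semigroup_algebra_zero)
  then show ?case by simp
next
  case (monomial m c)
  have "\<phi> (const c * chi m) = const c * \<phi> (chi m)"
    using assms(1) monomial unfolding linear_on_def by simp
  then show ?case by (simp add: const_mult_chi)
next
  case (add f g)
  then show ?case using assms(1) by (simp add: linear_on_def lin_ext_add)
qed

lemma linear_on_eqI:
  assumes "linear_on (semigroup_algebra S) \<phi>" "linear_on (semigroup_algebra S) \<psi>"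
    and "\<And>m. m \<in> S \<Longrightarrow> \<phi> (chi m) = \<psi> (chi m)" and "f \<in> semigroup_algebra S"
  shows "\<phi> f = \<psi> f"
proof -
  have "lin_ext (\<lambda>m. \<phi> (chi m)) f = lin_ext (\<lambda>m. \<psi> (chi m)) f"
    unfolding lin_ext_def
    by (rule sum.cong) (use assms(3,4) in \<open>auto simp: semigroup_algebra_def\<close>)
  then show ?thesis using assms linear_on_eq_lin_ext by metis
qed

lemma lin_ext_mult:
  assumes h: "\<And>a b. a \<in> S \<Longrightarrow> b \<in> S \<Longrightarrow> h (a + b) = h a * h b"
    and f: "f \<in> semigroup_algebra S" and g: "g \<in> semigroup_algebra S"
  shows "lin_ext h (f * g) = lin_ext h f * lin_ext h g"
  using f
proof (induction rule: semigroup_algebra_induct)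
  case zero
  then show ?case by simp
next
  case (monomial m c)
  from g show ?case
  proof (induction rule: semigroup_algebra_induct)
    case zero
    then show ?case by simp
  next
    case (monomial m' c')
    then have "lin_ext h (single m c * single m' c')
        = const (c * c') * (h m * h m')"
      using \<open>m \<in> S\<close> by (simp add: mult_single h)
    then show ?case unfolding const_mult by (simp add: mult_ac)
  next
    case (add f g)
    then show ?case by (simp add: distrib_left lin_ext_add)
  qed
next
  case (add f g)
  then show ?case by (simp add: distrib_right lin_ext_add)
qed

section \<open>The pairing and vertices of finite sets of weights\<close>

lemma pairing_add_left: "pairing (a + b) c = pairing a c + pairing b c"
  by (simp add: pairing_def sum.distrib algebra_simps)

lemma pairing_diff_left: "pairing (a - b) c = pairing a c - pairing b c"
  by (simp add: pairing_def sum_subtractf algebra_simps)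

lemma pairing_minus_left: "pairing (- a) c = - pairing a c"
  by (simp add: pairing_def sum_negf)

lemma pairing_smult_left: "pairing (k *s a) c = k * pairing a c"
  by (simp add: pairing_def sum_distrib_left algebra_simps)

lemma pairing_zero_left [simp]: "pairing 0 c = 0"
  by (simp add: pairing_def)

lemma pairing_commute: "pairing a b = pairing b a"
  by (simp add: pairing_def mult.commute)

lemmas pairing_left = pairing_add_left pairing_diff_left pairing_minus_left pairing_smult_left

lemma pairing_add_right: "pairing c (a + b) = pairing c a + pairing c b"
  by (metis pairing_add_left pairing_commute)

lemma pairing_diff_right: "pairing c (a - b) = pairing c a - pairing c b"
  by (metis pairing_diff_left pairing_commute)

lemma pairing_smult_right: "pairing c (k *s a) = k * pairing c a"
  by (metis pairing_smult_left pairing_commute)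

lemma pairing_self_pos:
  fixes d :: "int ^ 'n::finite"
  assumes "d \<noteq> 0"
  shows "0 < pairing d d"
proof -
  obtain i where "d $ i \<noteq> 0" using assms by (auto simp: vec_eq_iff)
  then have "0 < d $ i * d $ i" by (auto simp: zero_less_mult_iff linorder_neq_iff)
  also have "\<dots> \<le> pairing d d"
    unfolding pairing_def by (rule member_le_sum) auto
  finally show ?thesis .
qed

text \<open>
  A longest vector of a finite set is a vertex of its convex hull, and the functional that it
  defines exposes it.  All extremal weights below are found in this way.
\<close>

lemma pairing_longest_strict:
  fixes d d' :: "int ^ 'n::finite"
  assumes "pairing d' d' \<le> pairing d d" "d' \<noteq> d"
  shows "pairing d' d < pairing d d"
proof -
  have "0 < pairing (d - d') (d - d')" using assms(2) by (intro pairing_self_pos) auto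
  also have "\<dots> = pairing d d + pairing d' d' - 2 * pairing d' d"
    using pairing_commute[of d d'] by (simp add: pairing_diff_left pairing_diff_right)
  finally show ?thesis using assms(1) by simp
qed

text \<open>
  Choose exponents \<open>a\<close> of \<open>f\<close> and \<open>b\<close> of \<open>g\<close> for which \<open>a + b\<close> is longest.  Pairing with
  \<open>a + b\<close> then has its strict maximum at \<open>a\<close> on the exponents of \<open>f\<close> and at \<open>b\<close> on those of
  \<open>g\<close>, so the term \<open>\<chi>\<^bsup>a + b\<^esup>\<close> of the product arises only once.
\<close>

lemma laurent_mult_nonzero:
  fixes f g :: "('n::finite, 'k::idom) laurent"
  assumes "f \<noteq> 0" "g \<noteq> 0"
  shows "f * g \<noteq> 0"
proof -
  let ?K = "keys f \<times> keys g"
  let ?N = "\<lambda>(a, b). pairing (a + b) (a + b) :: int"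
  have "finite ?K" "?K \<noteq> {}" using assms by auto
  then have "Max (?N ` ?K) \<in> ?N ` ?K" by (intro Max_in) auto
  then obtain ab where ab: "ab \<in> ?K" "?N ab = Max (?N ` ?K)" by force
  have ab_max: "?N x \<le> ?N ab" if "x \<in> ?K" for x
    unfolding ab(2) using that \<open>finite ?K\<close> by (intro Max_ge) auto
  obtain a b where eq: "ab = (a, b)" by force
  have a: "a \<in> keys f" and b: "b \<in> keys g" using ab eq by auto
  have max: "pairing (p + q) (p + q) \<le> pairing (a + b) (a + b)"
    if "p \<in> keys f" "q \<in> keys g" for p q
    using ab_max[of "(p, q)"] that eq by simp
  have left: "pairing p (a + b) < pairing a (a + b)" if "p \<in> keys f" "p \<noteq> a" for p
    using pairing_longest_strict[OF max[OF that(1) b]] that(2)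
    by (simp add: pairing_add_left)
  have right: "pairing q (a + b) < pairing b (a + b)" if "q \<in> keys g" "q \<noteq> b" for q
    using pairing_longest_strict[OF max[OF a that(1)]] that(2)
    by (simp add: pairing_add_left)
  have uniq: "p = a" if "p \<in> keys f" "q \<in> keys g" "p + q = a + b" for p q
  proof (rule ccontr)
    assume "p \<noteq> a"
    have "pairing q (a + b) \<le> pairing b (a + b)" using right[OF that(2)] by (cases "q = b") auto
    then have "pairing (p + q) (a + b) < pairing (a + b) (a + b)"
      using left[OF that(1) \<open>p \<noteq> a\<close>] by (simp add: pairing_add_left)
    then show False using that(3) by simp
  qed
  have "f * g = (\<Sum>p\<in>keys f. single p (lookup f p) * g)"
    by (subst laurent_expansion[of f]) (simp add: sum_distrib_right)
  then have "lookup (f * g) (a + b)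
      = (\<Sum>p\<in>keys f. lookup f p * lookup g (a + b - p))"
    by (simp only: lookup_sum lookup_single_mult)
  also have "\<dots> = (\<Sum>p\<in>{a}. lookup f p * lookup g (a + b - p))"
  proof (rule sum.mono_neutral_right)
    show "\<forall>p\<in>keys f - {a}. lookup f p * lookup g (a + b - p) = 0"
    proof
      fix p assume p: "p \<in> keys f - {a}"
      have "a + b - p \<notin> keys g" using uniq[of p "a + b - p"] p by auto
      then show "lookup f p * lookup g (a + b - p) = 0"
        by (simp add: in_keys_iff)
    qed
  qed (use a in auto)
  also have "\<dots> \<noteq> 0" using a b by (simp add: in_keys_iff)
  finally show ?thesis by auto
qed

section \<open>Derivations of a semigroup algebra\<close>

definition derivation_on ::
    "('n::finite, 'k::comm_ring_1) laurent set \<Rightarrow> (('n, 'k) laurent \<Rightarrow> ('n, 'k) laurent) \<Rightarrow> bool"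
  where "derivation_on B D \<longleftrightarrow>
    D ` B \<subseteq> B \<and> linear_on B D \<and> (\<forall>a\<in>B. \<forall>b\<in>B. D (a * b) = D a * b + a * D b)"

lemma lnd_iff: "lnd B D \<longleftrightarrow> derivation_on B D \<and> (\<forall>b\<in>B. \<exists>k. (D ^^ k) b = 0)"
  by (auto simp: lnd_def derivation_on_def)

lemma linear_on_zero: "linear_on B D \<Longrightarrow> 0 \<in> B \<Longrightarrow> D 0 = 0"
  unfolding linear_on_def by (metis mult_zero_left single_zero)

lemma linear_on_funpow:
  assumes "linear_on B D" "D ` B \<subseteq> B"
  shows "linear_on B (D ^^ k) \<and> (D ^^ k) ` B \<subseteq> B"
proof (induction k)
  case 0
  then show ?case by (simp add: linear_on_def)
next
  case (Suc k)
  then show ?case using assms by (auto simp: linear_on_def image_subset_iff)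
qed

lemma funpow_zero_mono:
  fixes D :: "'a::zero \<Rightarrow> 'a"
  assumes "(D ^^ k) b = 0" "D 0 = 0" "k \<le> l"
  shows "(D ^^ l) b = 0"
  using assms(3)
proof (induction l rule: dec_induct)
  case base
  then show ?case using assms by simp
next
  case (step n)
  then show ?case using assms by simp
qed

lemma lnd_if_nilpotent_on_characters:
  assumes D: "derivation_on (semigroup_algebra S) D"
    and nil: "\<And>m. m \<in> S \<Longrightarrow> \<exists>k. (D ^^ k) (chi m) = 0"
  shows "lnd (semigroup_algebra S) D"
proof -
  let ?B = "semigroup_algebra S"
  have lin: "linear_on ?B (D ^^ k)" and im: "D ` ?B \<subseteq> ?B" for k
    using linear_on_funpow[of ?B D k] D by (auto simp: derivation_on_def)
  have zero: "D 0 = 0" using linear_on_zero[OF lin[of 1]] by simp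
  have "\<exists>k. (D ^^ k) f = 0" if "f \<in> ?B" for f
    using that
  proof (induction rule: semigroup_algebra_induct)
    case zero
    have "(D ^^ 0) 0 = 0" by simp
    then show ?case by blast
  next
    case (monomial m c)
    then obtain k where k: "(D ^^ k) (chi m) = 0" using nil by blast
    have "(D ^^ k) (const c * chi m) = const c * (D ^^ k) (chi m)"
      using lin[of k] monomial by (simp add: linear_on_def)
    then show ?case using k by (auto simp: const_mult_chi)
  next
    case (add f g)
    then obtain k l where "(D ^^ k) f = 0" "(D ^^ l) g = 0" by blast
    then have "(D ^^ (max k l)) f = 0" "(D ^^ (max k l)) g = 0"
      using funpow_zero_mono[where D = D, OF _ zero] by auto
    then have "(D ^^ (max k l)) (f + g) = 0"
      using lin[of "max k l"] add by (simp add: linear_on_def)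
    then show ?case by blast
  qed
  then show ?thesis using D by (simp add: lnd_iff)
qed

lemma lin_ext_Leibniz:
  assumes g: "\<And>a b. a \<in> S \<Longrightarrow> b \<in> S \<Longrightarrow> h (a + b) = h a * chi b + chi a * h b"
    and f1: "f1 \<in> semigroup_algebra S" and f2: "f2 \<in> semigroup_algebra S"
  shows "lin_ext h (f1 * f2) = lin_ext h f1 * f2 + f1 * lin_ext h f2"
  using f1
proof (induction rule: semigroup_algebra_induct)
  case zero
  then show ?case by simp
next
  case (monomial m c)
  from f2 show ?case
  proof (induction rule: semigroup_algebra_induct)
    case zero
    then show ?case by simp
  next
    case (monomial m' c')
    have "lin_ext h (single m c * single m' c')
        = (const c * const c') * (h m * chi m' + chi m * h m')"
      using \<open>m \<in> S\<close> monomial by (simp add: mult_single g)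
    then show ?case
      unfolding const_mult_chi[of c m, symmetric] const_mult_chi[of c' m', symmetric]
      by (simp add: lin_ext_const_mult lin_ext_single algebra_simps)
  next
    case (add f g)
    then show ?case by (simp add: distrib_left lin_ext_add)
  qed
next
  case (add f g)
  then show ?case by (simp add: distrib_right lin_ext_add)
qed

lemma lookup_lin_ext_twist:
  "lookup (lin_ext (\<lambda>m. chi m * g m) f) q
    = (\<Sum>p\<in>keys f. lookup f p * lookup (g p) (q - p))"
  by (simp add: lin_ext_def lookup_sum)

text \<open>
  Decompose \<open>D\<close> into components of weight \<open>q\<close>, sending \<open>\<chi>\<^sup>p\<close> to a multiple of
  \<open>\<chi>\<^bsup>p + q\<^esup>\<close>.  If a linear functional has its strict maximum over the weights at
  \<open>d\<close>, the exponent \<open>m + k d\<close> is reached after \<open>k\<close> steps only by using the component of weight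
  \<open>d\<close> each time, so nothing cancels there.  Local finiteness and nilpotency of \<open>D\<close> therefore
  pass to that component.
\<close>

lemma leading_coefficient_iterate:
  fixes l :: "int ^ 'n::finite \<Rightarrow> int" and g :: "int ^ 'n \<Rightarrow> ('n, 'k::comm_ring_1) laurent"
  assumes l_add: "\<And>a b. l (a + b) = l a + l b"
    and D: "\<And>f. f \<in> semigroup_algebra M \<Longrightarrow> D f = lin_ext (\<lambda>m. chi m * g m) f"
    and stable: "\<And>f. f \<in> semigroup_algebra M \<Longrightarrow> D f \<in> semigroup_algebra M"
    and top: "\<And>p q. p \<in> M \<Longrightarrow> q \<in> keys (g p) \<Longrightarrow> q \<noteq> d \<Longrightarrow> l q < l d"
    and m: "m \<in> M"
  shows "lookup ((D ^^ k) (chi m)) (m + int k *s d)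
      = (\<Prod>i<k. lookup (g (m + int i *s d)) d)"
proof -
  let ?p = "\<lambda>k. m + int k *s d"
  have p_Suc: "?p (Suc k) = ?p k + d" for k
    by (simp add: vec_eq_iff algebra_simps)
  have "(D ^^ k) (chi m) \<in> semigroup_algebra M \<and>
      (\<forall>q\<in>keys ((D ^^ k) (chi m)). q = ?p k \<or> l q < l (?p k)) \<and>
      lookup ((D ^^ k) (chi m)) (?p k)
        = (\<Prod>i<k. lookup (g (?p i)) d)"
  proof (induction k)
    case 0
    have "?p 0 = m" by (simp add: vec_eq_iff)
    then show ?case using m by simp
  next
    case (Suc k)
    let ?F = "(D ^^ k) (chi m)"
    have FM: "?F \<in> semigroup_algebra M" using Suc by blast
    have DF: "lookup ((D ^^ Suc k) (chi m)) q
       = (\<Sum>p\<in>keys ?F. lookup ?F p * lookup (g p) (q - p))" for q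
      using D[OF FM] by (simp add: lookup_lin_ext_twist)
    have keysM: "p \<in> M" if "p \<in> keys ?F" for p
      using FM that by (auto simp: semigroup_algebra_def)
    have small: "q = ?p (Suc k) \<or> l q < l (?p (Suc k))"
      if q: "q \<in> keys ((D ^^ Suc k) (chi m))" for q
    proof -
      have "\<exists>p\<in>keys ?F. lookup (g p) (q - p) \<noteq> 0"
        using q unfolding in_keys_iff DF by (metis (no_types, lifting) mult_zero_right sum.neutral)
      then obtain p where p: "p \<in> keys ?F" "q - p \<in> keys (g p)"
        by (auto simp: in_keys_iff)
      have 1: "p = ?p k \<or> l p < l (?p k)" using Suc p(1) by blast
      have 2: "q - p = d \<or> l (q - p) < l d" using top[OF keysM[OF p(1)] p(2)] by blast
      have 3: "q = p + (q - p)" by simp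
      have "l q = l p + l (q - p)" using l_add[of p "q - p"] by simp
      then show ?thesis
        using 1 2 3 l_add[of "?p k" d] unfolding p_Suc by (smt (verit, best))
    qed
    have "lookup ((D ^^ Suc k) (chi m)) (?p (Suc k))
       = (\<Sum>p\<in>{?p k}. lookup ?F p * lookup (g p) (?p (Suc k) - p))"
      unfolding DF
    proof (rule sum.mono_neutral_cong)
      fix p assume p: "p \<in> keys ?F - {?p k}"
      then have "l p < l (?p k)" using Suc by blast
      moreover have "l (?p (Suc k)) = l p + l (?p (Suc k) - p)" using l_add[of p "?p (Suc k) - p"] by simp
      moreover have "l (?p (Suc k)) = l (?p k) + l d" unfolding p_Suc by (rule l_add)
      ultimately have gt: "l d < l (?p (Suc k) - p)" by linarith
      have "?p (Suc k) - p \<notin> keys (g p)"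
        using top[of p "?p (Suc k) - p"] keysM[of p] p gt by force
      then show "lookup ?F p * lookup (g p) (?p (Suc k) - p) = 0"
        by (simp add: in_keys_iff)
    qed (auto simp: in_keys_iff)
    also have "\<dots> = (\<Prod>i<Suc k. lookup (g (?p i)) d)"
      using Suc unfolding p_Suc by simp
    finally show ?case using small stable[OF FM] by simp
  qed
  then show ?thesis by blast
qed

text \<open>
  The value at \<open>a - b\<close> has to be \<open>F a - F b\<close>; additivity on \<open>S\<close> makes this independent of the
  presentation.
\<close>

lemma additive_extension:
  fixes F :: "'m::ab_group_add \<Rightarrow> 'a::ab_group_add"
  assumes gen: "\<And>m. \<exists>a\<in>S. \<exists>b\<in>S. m = a - b"
    and closed: "\<And>a b. a \<in> S \<Longrightarrow> b \<in> S \<Longrightarrow> a + b \<in> S"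
    and F: "\<And>a b. a \<in> S \<Longrightarrow> b \<in> S \<Longrightarrow> F (a + b) = F a + F b"
  obtains G where "\<And>x y. G (x + y) = G x + G y" "\<And>m. m \<in> S \<Longrightarrow> G m = F m"
proof -
  obtain \<alpha> \<beta> where ab: "\<And>m. \<alpha> m \<in> S" "\<And>m. \<beta> m \<in> S" "\<And>m. m = \<alpha> m - \<beta> m"
    using gen by metis
  define G where "G m = F (\<alpha> m) - F (\<beta> m)" for m
  have G: "G (a - b) = F a - F b" if "a \<in> S" "b \<in> S" for a b
  proof -
    let ?m = "a - b"
    have "a + \<beta> ?m = \<alpha> ?m + b" using ab(3)[of ?m] by (simp add: algebra_simps)
    then have "F a + F (\<beta> ?m) = F (\<alpha> ?m) + F b" using F[OF that(1) ab(2)] F[OF ab(1) that(2)] by metis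
    then show ?thesis unfolding G_def by (simp add: algebra_simps)
  qed
  have "G (x + y) = G x + G y" for x y
  proof -
    have "x + y = (\<alpha> x + \<alpha> y) - (\<beta> x + \<beta> y)"
      using ab(3)[of x] ab(3)[of y] by (simp add: algebra_simps)
    then have "G (x + y) = F (\<alpha> x + \<alpha> y) - F (\<beta> x + \<beta> y)"
      using G[of "\<alpha> x + \<alpha> y" "\<beta> x + \<beta> y"] closed ab(1,2) by simp
    then show ?thesis unfolding G_def by (simp add: F ab(1,2))
  qed
  moreover have "G m = F m" if "m \<in> S" for m
    using G[of "m + m" m] F[of m m] that closed by simp
  ultimately show ?thesis using that by blast
qed

lemma additive_zero: "(\<And>x y. G (x + y) = G x + G y) \<Longrightarrow> G (0 :: 'm::ab_group_add) = (0 :: 'a::ab_group_add)"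
proof -
  assume "\<And>x y. G (x + y) = G x + G y"
  from this[of 0 0] show ?thesis by simp
qed

lemma additive_smult:
  fixes G :: "int ^ 'n::finite \<Rightarrow> 'a::comm_ring_1"
  assumes "\<And>x y. G (x + y) = G x + G y"
  shows "G (k *s x) = of_int k * G x"
proof (induction k rule: int_induct[where k = 0])
  case base
  have "(0 :: int) *s x = 0" by (simp add: vec_eq_iff)
  then show ?case using additive_zero[of G, OF assms] by simp
next
  case (step1 i)
  have "(i + 1) *s x = i *s x + x" by (simp add: vec_eq_iff algebra_simps)
  then show ?case using step1 assms by (simp add: algebra_simps)
next
  case (step2 i)
  have "i *s x = (i - 1) *s x + x" by (simp add: vec_eq_iff algebra_simps)
  then have "G (i *s x) = G ((i - 1) *s x) + G x" using assms by metis
  then show ?case using step2 by (simp add: algebra_simps)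
qed

lemma additive_sum:
  fixes G :: "'m::ab_group_add \<Rightarrow> 'a::ab_group_add"
  assumes "\<And>x y. G (x + y) = G x + G y"
  shows "G (sum f I) = (\<Sum>i\<in>I. G (f i))"
  by (induction I rule: infinite_finite_induct) (auto simp: assms additive_zero[of G, OF assms])

lemma axis_expansion: "(m :: int ^ 'n::finite) = (\<Sum>i\<in>UNIV. m $ i *s axis i 1)"
  by (simp add: vec_eq_iff axis_def if_distrib[of "(*) _"] cong: if_cong)

text \<open>
  The values at the standard basis vectors determine \<open>g\<close>.
\<close>

lemma additive_keys_finite:
  fixes g :: "int ^ 'n::finite \<Rightarrow> ('n, 'k::comm_ring_1) laurent"
  assumes add: "\<And>x y. g (x + y) = g x + g y"
  shows "finite (\<Union>m. keys (g m))"
proof (rule finite_subset)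
  show "(\<Union>m. keys (g m)) \<subseteq> (\<Union>i. keys (g (axis i 1)))"
  proof
    fix q assume "q \<in> (\<Union>m. keys (g m))"
    then obtain m where q: "lookup (g m) q \<noteq> 0" by (auto simp: in_keys_iff)
    have "g m = (\<Sum>i\<in>UNIV. of_int (m $ i) * g (axis i 1))"
      by (subst axis_expansion[of m]) (simp add: additive_sum[of g, OF add] additive_smult[of g, OF add])
    then have "lookup (g m) q
        = (\<Sum>i\<in>UNIV. of_int (m $ i) * lookup (g (axis i 1)) q)"
      by (simp only: lookup_sum single_of_int[symmetric] lookup_const_mult)
    then have "\<exists>i. lookup (g (axis i 1)) q \<noteq> 0"
      using q by (metis (no_types, lifting) mult_zero_right sum.neutral)
    then show "q \<in> (\<Union>i. keys (g (axis i 1)))" by (auto simp: in_keys_iff)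
  qed
qed auto

text \<open>
  By the Leibniz rule the logarithmic derivative \<open>\<chi>\<^bsup>-m\<^esup> D \<chi>\<^sup>m\<close> is additive in \<open>m\<close>, hence
  extends from \<open>S\<close> to the whole lattice.
\<close>

lemma derivation_on_characters:
  fixes D :: "('n::finite, 'k::comm_ring_1) laurent \<Rightarrow> ('n, 'k) laurent"
  assumes gen: "\<And>m. \<exists>a\<in>S. \<exists>b\<in>S. m = a - b"
    and closed: "\<And>a b. a \<in> S \<Longrightarrow> b \<in> S \<Longrightarrow> a + b \<in> S"
    and D: "derivation_on (semigroup_algebra S) D"
  obtains g where "\<And>x y. g (x + y) = g x + g y" "\<And>m. m \<in> S \<Longrightarrow> D (chi m) = chi m * g m"
proof -
  have "chi (- (a + b)) * D (chi (a + b)) = chi (- a) * D (chi a) + chi (- b) * D (chi b)"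
    if "a \<in> S" "b \<in> S" for a b
  proof -
    have "D (chi a * chi b) = D (chi a) * chi b + chi a * D (chi b)"
      using D that unfolding derivation_on_def by (metis chi_in_semigroup_algebra)
    then have "chi (- (a + b)) * D (chi (a + b))
        = (chi (- (a + b)) * chi b) * D (chi a) + (chi (- (a + b)) * chi a) * D (chi b)"
      unfolding chi_add by (simp add: algebra_simps)
    then show ?thesis by (simp add: mult_single)
  qed
  from additive_extension[OF gen closed, of "\<lambda>m. chi (- m) * D (chi m)", OF _ _ this]
  obtain g where g: "\<And>x y. g (x + y) = g x + g y"
      "\<And>m. m \<in> S \<Longrightarrow> g m = chi (- m) * D (chi m)"
    by blast
  have "D (chi m) = chi m * g m" if "m \<in> S" for m
    unfolding g(2)[OF that] mult.assoc[symmetric] by (simp add: mult_single)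
  then show ?thesis using that g(1) by blast
qed

(* Scalars stay visible as constant Laurent polynomials. *)
declare single_of_int [simp del] single_of_nat [simp del]

lemma single_eq_0_iff [simp]: "single a c = 0 \<longleftrightarrow> c = 0"
  by (metis lookup_single_eq lookup_zero single_zero)

section \<open>The derivation of a root and its kernel\<close>

locale demazure_lnd =
  fixes S :: "(int ^ 'n::finite) set"
    and v e :: "int ^ 'n"
    and B :: "('n, 'k::field_char_0) laurent set"
    and \<delta> :: "('n, 'k) laurent \<Rightarrow> ('n, 'k) laurent"
  assumes zero_mem: "0 \<in> S"
    and add_mem: "\<And>a b. a \<in> S \<Longrightarrow> b \<in> S \<Longrightarrow> a + b \<in> S"
    and differences: "\<And>m. \<exists>a\<in>S. \<exists>b\<in>S. m = a - b"
    and v_nonneg: "\<And>m. m \<in> S \<Longrightarrow> 0 \<le> pairing m v"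
    and e_v: "pairing e v = -1"
    and shift_mem: "\<And>m. m \<in> S \<Longrightarrow> 0 < pairing m v \<Longrightarrow> m + e \<in> S"
    and B_def: "B = semigroup_algebra S"
    and \<delta>_def: "\<delta> = demazure_der v e"
begin

definition S0 :: "(int ^ 'n) set" where "S0 = {m \<in> S. pairing m v = 0}"

lemma S0_subset: "m \<in> S0 \<Longrightarrow> m \<in> S" by (simp add: S0_def)

lemma shift_iterate:
  assumes "m \<in> S" "int j \<le> pairing m v"
  shows "m + int j *s e \<in> S"
  using assms(2)
proof (induction j)
  case 0
  have "m + int 0 *s e = m" by (simp add: vec_eq_iff)
  then show ?case using assms by simp
next
  case (Suc j)
  have "m + int (Suc j) *s e = (m + int j *s e) + e"
    by (simp add: vec_eq_iff algebra_simps)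
  moreover have "0 < pairing (m + int j *s e) v"
    using Suc.prems by (simp add: pairing_left e_v)
  moreover have "m + int j *s e \<in> S" using Suc by simp
  ultimately show ?case using shift_mem by metis
qed

text \<open>
  The projection of the lattice to the hyperplane orthogonal to \<open>v\<close> along \<open>e\<close>.  For \<open>m\<close> of height
  \<open>d \<ge> 0\<close> it is the exponent of \<open>\<delta>\<^sup>d \<chi>\<^sup>m\<close>.
\<close>

definition base :: "int ^ 'n \<Rightarrow> int ^ 'n" where "base m = m + pairing m v *s e"

lemma base_add: "base (a + b) = base a + base b"
  by (simp add: base_def pairing_left vec_eq_iff algebra_simps)

lemma pairing_base [simp]: "pairing (base m) v = 0"
  by (simp add: base_def pairing_left e_v)

lemma base_zero [simp]: "base 0 = 0"
  by (simp add: base_def vec_eq_iff)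

lemma base_shift: "base (m + e) = base m"
  by (simp add: base_def pairing_left e_v vec_eq_iff algebra_simps)

lemma base_in_S0: "m \<in> S \<Longrightarrow> base m \<in> S0"
  using shift_iterate[of m "nat (pairing m v)"] v_nonneg[of m]
  by (simp add: S0_def base_def pairing_left e_v)

lemma base_S0: "m \<in> S0 \<Longrightarrow> base m = m"
  by (simp add: S0_def base_def vec_eq_iff)

lemma base_eq_orthogonal: "pairing m v = 0 \<Longrightarrow> base m = m"
  by (simp add: base_def vec_eq_iff)

text \<open>
  The lattice element \<open>-e\<close> of height 1 is a difference \<open>a - b\<close> of elements of \<open>S\<close>, so \<open>a\<close> has
  positive height; repeated application of \<open>\<delta>\<close> lowers it to 1.
\<close>

lemma ex_height_one: "\<exists>s\<in>S. pairing s v = 1"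
proof -
  obtain a b where ab: "a \<in> S" "b \<in> S" "- e = a - b" using differences by blast
  have "pairing a v - pairing b v = 1"
    using arg_cong[OF ab(3), of "\<lambda>x. pairing x v"] by (simp add: pairing_left e_v)
  then have "1 \<le> pairing a v" using v_nonneg[OF ab(2)] by simp
  then show ?thesis
    using shift_iterate[OF ab(1), of "nat (pairing a v - 1)"]
    by (intro bexI[of _ "a + int (nat (pairing a v - 1)) *s e"]) (auto simp: pairing_left e_v)
qed

text \<open>
  The projection \<open>base\<close> is additive and maps \<open>S\<close> to \<open>S0\<close>, so it turns a presentation of \<open>m\<close> as a
  difference in \<open>S\<close> into one in \<open>S0\<close>.
\<close>

lemma S0_differences:
  assumes "pairing m v = 0"
  shows "\<exists>a\<in>S0. \<exists>b\<in>S0. m = a - b"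
proof -
  obtain a b where ab: "a \<in> S" "b \<in> S" "m = a - b" using differences by blast
  have "base m = base a - base b"
    using base_add[of "a - b" b] unfolding ab(3) by simp
  then show ?thesis using base_eq_orthogonal[OF assms] base_in_S0 ab by metis
qed

lemma \<delta>_chi: "\<delta> (chi m) = single (m + e) (of_int (pairing m v))"
  by (simp add: \<delta>_def demazure_der_def mult_single)

lemma \<delta>_linear:
  "\<delta> (f + g) = \<delta> f + \<delta> g" "\<delta> (const c * f) = const c * \<delta> f" "\<delta> 0 = 0"
  by (simp_all add: \<delta>_def demazure_der_def lin_ext_add lin_ext_const_mult)

lemma \<delta>_single: "\<delta> (single m c) = single (m + e) (c * of_int (pairing m v))"
  by (simp add: \<delta>_def demazure_der_def mult_single)

lemma mem_UNIV_algebra: "f \<in> semigroup_algebra UNIV" by (simp add: semigroup_algebra_def)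

lemma \<delta>_mult: "\<delta> (f * g) = \<delta> f * g + f * \<delta> g"
  unfolding \<delta>_def demazure_der_def
  by (rule lin_ext_Leibniz[where S = UNIV])
     (auto simp: mem_UNIV_algebra mult_single single_add[symmetric] pairing_left algebra_simps)

lemma lookup_\<delta>:
  "lookup (\<delta> f) q = of_int (pairing (q - e) v) * lookup f (q - e)"
  using mem_UNIV_algebra[of f]
proof (induction rule: semigroup_algebra_induct)
  case (monomial m c)
  then show ?case by (auto simp: \<delta>_single lookup_single when_def algebra_simps)
qed (auto simp: \<delta>_linear lookup_add algebra_simps)

lemma \<delta>_in_B: "f \<in> B \<Longrightarrow> \<delta> f \<in> B"
  unfolding B_def mem_semigroup_algebra_iff lookup_\<delta>
proof (intro allI impI)
  fix p assume f: "\<forall>p. lookup f p \<noteq> 0 \<longrightarrow> p \<in> S"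
    and p: "of_int (pairing (p - e) v) * lookup f (p - e) \<noteq> 0"
  then have "p - e \<in> S" "pairing (p - e) v \<noteq> 0" by auto
  then show "p \<in> S" using shift_mem[of "p - e"] v_nonneg[of "p - e"] by simp
qed

lemma lin_ext_commute_\<delta>:
  assumes "\<And>m. m \<in> S \<Longrightarrow> lin_ext h (\<delta> (chi m)) = \<delta> (lin_ext h (chi m))" and b: "b \<in> B"
  shows "lin_ext h (\<delta> b) = \<delta> (lin_ext h b)"
  by (rule linear_on_eqI[where S = S and \<phi> = "\<lambda>b. lin_ext h (\<delta> b)" and \<psi> = "\<lambda>b. \<delta> (lin_ext h b)"])
     (use assms in \<open>simp_all add: linear_on_def lin_ext_add lin_ext_const_mult \<delta>_linear B_def\<close>)

lemma \<delta>_eq_0_iff: "\<delta> f = 0 \<longleftrightarrow> f \<in> semigroup_algebra {p. pairing p v = 0}"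
proof
  assume "\<delta> f = 0"
  then have "of_int (pairing (p + e - e) v) * lookup f (p + e - e) = 0" for p
    using lookup_\<delta>[of f "p + e"] by simp
  then show "f \<in> semigroup_algebra {p. pairing p v = 0}"
    by (auto simp: mem_semigroup_algebra_iff)
next
  assume "f \<in> semigroup_algebra {p. pairing p v = 0}"
  then show "\<delta> f = 0"
    by (intro poly_mapping_eqI) (auto simp: lookup_\<delta> mem_semigroup_algebra_iff)
qed

lemma ker_\<delta>: "ker_on B \<delta> = semigroup_algebra S0"
  by (auto simp: ker_on_def \<delta>_eq_0_iff B_def mem_semigroup_algebra_iff S0_def)

lemma chi_S0_in_ker: "m \<in> S0 \<Longrightarrow> chi m \<in> ker_on B \<delta>"
  by (simp add: ker_\<delta>)

text \<open>
  For \<open>m \<in> S\<close> this compares coefficients in \<open>D (\<delta> \<chi>\<^sup>m) = \<delta> (D \<chi>\<^sup>m)\<close>.  Both sides are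
  additive in \<open>m\<close>, so the identity persists on the lattice and may be evaluated at \<open>m = e\<close>, where
  it says that a component of weight \<open>d\<close> orthogonal to \<open>v\<close> kills \<open>\<chi>\<^sup>e\<close>.
\<close>

lemma commuting_derivation_components:
  assumes add: "\<And>x y. g (x + y) = g x + g y"
    and D: "\<And>m. m \<in> S \<Longrightarrow> D (chi m) = chi m * g m"
    and lin: "linear_on B D" and comm: "commute_on B D \<delta>"
  shows "of_int (pairing d v) * lookup (g m) d
    = of_int (pairing m v) * lookup (g e) d"
proof -
  let ?L = "\<lambda>m. of_int (pairing d v) * lookup (g m) d - of_int (pairing m v) * lookup (g e) d"
  have *: "?L m = 0" if m: "m \<in> S" for m
  proof -
    have "chi m \<in> B" using m by (simp add: B_def)
    have "D (\<delta> (chi m)) = const (of_int (pairing m v)) * (chi (m + e) * g (m + e))"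
    proof (cases "pairing m v = 0")
      case True
      then show ?thesis using linear_on_zero[OF lin] by (simp add: \<delta>_chi B_def)
    next
      case False
      then have me: "m + e \<in> S" using shift_mem v_nonneg m by (metis order_le_less)
      have "\<delta> (chi m) = const (of_int (pairing m v)) * chi (m + e)"
        by (simp only: \<delta>_chi const_mult_chi)
      then show ?thesis using lin me D[OF me] unfolding linear_on_def
        by (simp add: B_def)
    qed
    moreover have "D (\<delta> (chi m)) = \<delta> (chi m * g m)"
      using comm \<open>chi m \<in> B\<close> D[OF m] by (simp add: commute_on_def)
    ultimately have "lookup (\<delta> (chi m * g m)) (m + e + d)
        = of_int (pairing m v) * lookup (g (m + e)) d"
      by (metis (no_types, lifting) lookup_const_mult lookup_chi_mult add_diff_cancel_left')
    moreover have "m + e + d - e = m + d" by simp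
    ultimately have "of_int (pairing (m + d) v) * lookup (g m) d
        = of_int (pairing m v) * lookup (g m + g e) d"
      by (simp add: lookup_\<delta> add)
    then show ?thesis by (simp add: pairing_left lookup_add algebra_simps)
  qed
  obtain a b where ab: "a \<in> S" "b \<in> S" "m = a - b" using differences by blast
  have "g a = g m + g b" using add[of m b] ab by simp
  moreover have "pairing a v = pairing m v + pairing b v" using ab by (simp add: pairing_left)
  ultimately have "?L a = ?L m + ?L b" by (simp add: lookup_add algebra_simps)
  then show ?thesis using *[OF ab(1)] *[OF ab(2)] by simp
qed

lemma homogeneous_derivation_iterate:
  "(lin_ext (\<lambda>m. single (m + d) (f m)) ^^ k) (chi m)
     = single (m + int k *s d) (\<Prod>i<k. f (m + int i *s d) :: 'k)"
proof (induction k)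
  case 0
  have "m + int 0 *s d = m" by (simp add: vec_eq_iff)
  then show ?case by simp
next
  case (Suc k)
  have "m + int (Suc k) *s d = m + int k *s d + d"
    by (simp add: vec_eq_iff algebra_simps)
  then show ?case using Suc by (simp add: mult_single add.assoc)
qed

end

section \<open>Maximality forces diagonal action on the kernel\<close>

locale maximal_demazure_lnd = demazure_lnd S v e B \<delta>
  for S :: "(int ^ 'n::finite) set" and v e :: "int ^ 'n"
    and B :: "('n, 'k::field_char_0) laurent set" and \<delta> :: "('n, 'k) laurent \<Rightarrow> ('n, 'k) laurent" +
  assumes maximal: "maximal_lnd B \<delta>"
begin

text \<open>
  Suppose that \<open>D\<close> has a component of weight different from 0 on the kernel of \<open>\<delta>\<close>, and let \<open>d\<close> be
  a longest such weight.  The component \<open>P\<close> of weight \<open>d\<close> is a derivation of \<open>B\<close> commuting with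
  \<open>\<delta>\<close>.  Since \<open>d\<close> is a vertex, the term of \<open>D\<^sup>k \<chi>\<^sup>m\<close> at \<open>m + k d\<close> comes from
  \<open>P\<^sup>k\<close> alone; these exponents leave every finite set, so local finiteness of \<open>D\<close>
  makes \<open>P\<close> locally nilpotent.  But \<open>P\<close> does not vanish on the kernel of \<open>\<delta>\<close>, which contradicts
  maximality.
\<close>

lemma locally_finite_commuting_diagonal:
  assumes D: "derivation_on B D" and comm: "commute_on B D \<delta>"
    and fin: "\<And>m. m \<in> S \<Longrightarrow> \<exists>K. finite K \<and> (\<forall>k. keys ((D ^^ k) (chi m)) \<subseteq> K)"
    and m: "m \<in> S0"
  shows "\<exists>c. D (chi m) = single m c"
proof -
  have DB: "derivation_on (semigroup_algebra S) D" using D by (simp add: B_def)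
  obtain g where g_add: "\<And>x y. g (x + y) = g x + g y"
      and g: "\<And>m. m \<in> S \<Longrightarrow> D (chi m) = chi m * g m"
    using derivation_on_characters[OF differences add_mem DB] by blast
  have lin: "linear_on B D" using D by (simp add: derivation_on_def)
  note comp = commuting_derivation_components[OF g_add g lin comm]
  define \<Delta> where "\<Delta> = (\<Union>m\<in>S0. keys (g m))"
  have "finite \<Delta>" unfolding \<Delta>_def
    by (rule finite_subset[OF _ additive_keys_finite[of g, OF g_add]]) auto
  have \<Delta>_v: "pairing d v = 0" if "d \<in> \<Delta>" for d
  proof -
    from that obtain m where "m \<in> S0" "lookup (g m) d \<noteq> 0"
      by (auto simp: \<Delta>_def in_keys_iff)
    then show ?thesis using comp[of d m] by (simp add: S0_def)
  qed
  have "\<Delta> \<subseteq> {0}"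
  proof (rule ccontr)
    assume "\<not> \<Delta> \<subseteq> {0}"
    then obtain d1 where d1: "d1 \<in> \<Delta>" "d1 \<noteq> 0" by auto
    let ?N = "\<lambda>d. pairing d d :: int"
    have "Max (?N ` \<Delta>) \<in> ?N ` \<Delta>" using \<open>finite \<Delta>\<close> d1 by (intro Max_in) auto
    then obtain d where d: "d \<in> \<Delta>" "?N d = Max (?N ` \<Delta>)" by force
    have d_max: "?N d' \<le> ?N d" if "d' \<in> \<Delta>" for d'
      unfolding d(2) using that \<open>finite \<Delta>\<close> by (intro Max_ge) auto
    have "d \<noteq> 0" using d_max[OF d1(1)] pairing_self_pos[OF d1(2)] by auto
    have d_v: "pairing d v = 0" by (rule \<Delta>_v[OF d(1)])
    define f where "f m = lookup (g m) d" for m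
    have f_add: "f (x + y) = f x + f y" for x y by (simp add: f_def g_add lookup_add)
    have f_e: "f e = 0" using comp[of d e] by (simp add: d_v e_v f_def)
    \<comment> \<open>As \<open>f\<close> kills \<open>e\<close>, nilpotency need only be checked on characters of the kernel.\<close>
    have f_base: "f (base m + x) = f (m + x)" for m x
      unfolding base_def by (simp add: f_add additive_smult[of f, OF f_add] f_e)
    have S0_algebra: "semigroup_algebra S0 \<subseteq> B"
      using S0_subset by (auto simp: B_def semigroup_algebra_def)
    have chi_S0: "chi m \<in> B" if "m \<in> S0" for m using that S0_algebra by auto
    have stable: "D h \<in> semigroup_algebra S0" if "h \<in> semigroup_algebra S0" for h
    proof -
      have "h \<in> B" "\<delta> h = 0" using that by (auto simp: ker_\<delta>[symmetric] ker_on_def)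
      then have "\<delta> (D h) = D 0" using comm unfolding commute_on_def by metis
      also have "\<dots> = 0" by (rule linear_on_zero[OF lin]) (simp add: B_def)
      finally show ?thesis using \<open>h \<in> B\<close> D
        by (auto simp: ker_\<delta>[symmetric] ker_on_def derivation_on_def)
    qed
    have vanish: "\<exists>k. (\<Prod>i<k. f (m + int i *s d)) = 0" if m: "m \<in> S0" for m
    proof -
      obtain K where K: "finite K" "\<And>k. keys ((D ^^ k) (chi m)) \<subseteq> K"
        using fin[OF S0_subset[OF m]] by blast
      have "inj (\<lambda>k. m + int k *s d)"
        using \<open>d \<noteq> 0\<close> by (auto simp: inj_def vec_eq_iff)
      then have "\<not> range (\<lambda>k. m + int k *s d) \<subseteq> K"
        using K(1) finite_subset finite_imageD infinite_UNIV_nat by metis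
      then obtain k where "m + int k *s d \<notin> K" by auto
      then have "lookup ((D ^^ k) (chi m)) (m + int k *s d) = 0"
        using K(2)[of k] by (auto simp: in_keys_iff)
      moreover have "lookup ((D ^^ k) (chi m)) (m + int k *s d)
          = (\<Prod>i<k. lookup (g (m + int i *s d)) d)"
      proof (rule leading_coefficient_iterate[where M = S0 and l = "\<lambda>x. pairing x d"])
        fix h :: "('n, 'k) laurent" assume h: "h \<in> semigroup_algebra S0"
        show "D h = lin_ext (\<lambda>m. chi m * g m) h"
        proof (rule linear_on_eqI[OF _ linear_on_lin_ext _ h])
          show "linear_on (semigroup_algebra S0) D"
            using lin S0_algebra unfolding linear_on_def by blast
        qed (use g S0_subset in simp)
      next
        fix p q assume "p \<in> S0" "q \<in> keys (g p)" "q \<noteq> d"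
        moreover from this have "q \<in> \<Delta>" by (auto simp: \<Delta>_def)
        ultimately show "pairing q d < pairing d d" using pairing_longest_strict d_max by blast
      qed (use stable m in \<open>auto simp: pairing_left\<close>)
      ultimately show ?thesis unfolding f_def by metis
    qed
    let ?P = "lin_ext (\<lambda>m. single (m + d) (f m))"
    have P_in: "m + d \<in> S" if "m \<in> S" "f m \<noteq> 0" for m
    proof -
      have "lookup (D (chi m)) (m + d) \<noteq> 0"
        using that by (simp add: g f_def)
      moreover have "D (chi m) \<in> B" using D that(1) by (auto simp: derivation_on_def B_def)
      ultimately show ?thesis by (auto simp: B_def mem_semigroup_algebra_iff)
    qed
    have "derivation_on B ?P" unfolding derivation_on_def
    proof (intro conjI ballI)
      show "?P ` B \<subseteq> B" unfolding B_def
        by (auto intro!: lin_ext_in_semigroup_algebra)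
           (metis P_in single_in_semigroup_algebra semigroup_algebra_zero single_zero)
      show "linear_on B ?P" by (rule linear_on_lin_ext)
      fix a b assume "a \<in> B" "b \<in> B"
      then show "?P (a * b) = ?P a * b + a * ?P b"
        unfolding B_def
        by (intro lin_ext_Leibniz) (auto simp: f_add mult_single single_add[symmetric] algebra_simps)
    qed
    moreover have "\<exists>k. (?P ^^ k) (chi m) = 0" if "m \<in> S" for m
    proof -
      obtain k where "(\<Prod>i<k. f (m + int i *s d)) = 0"
        using vanish[OF base_in_S0[OF \<open>m \<in> S\<close>]] unfolding f_base by blast
      then have "(?P ^^ k) (chi m) = 0"
        by (simp only: homogeneous_derivation_iterate single_zero)
      then show ?thesis by blast
    qed
    ultimately have lnd: "lnd B ?P" unfolding B_def by (intro lnd_if_nilpotent_on_characters)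
    have "commute_on B ?P \<delta>" unfolding commute_on_def
    proof
      fix b assume b: "b \<in> B"
      show "?P (\<delta> b) = \<delta> (?P b)"
      proof (rule lin_ext_commute_\<delta>[OF _ b])
        fix m assume "m \<in> S"
        show "?P (\<delta> (chi m)) = \<delta> (?P (chi m))"
          by (simp add: \<delta>_chi \<delta>_single mult_single f_add f_e pairing_left d_v algebra_simps)
      qed
    qed
    moreover obtain m0 where m0: "m0 \<in> S0" "f m0 \<noteq> 0"
      using d(1) by (auto simp: \<Delta>_def in_keys_iff f_def)
    have P_m0: "?P (chi m0) \<noteq> 0" using m0(2) by (simp add: mult_single)
    then have "nonzero_on B ?P" unfolding nonzero_on_def using chi_S0[OF m0(1)] by blast
    ultimately have "ker_on B ?P = ker_on B \<delta>"
      using maximal lnd unfolding maximal_lnd_def by blast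
    then show False using chi_S0_in_ker[OF m0(1)] P_m0 unfolding ker_on_def by blast
  qed
  then have "keys (g m) \<subseteq> {0}" using m by (auto simp: \<Delta>_def)
  then have "g m = single 0 (lookup (g m) 0)"
    by (intro poly_mapping_eqI) (auto simp: lookup_single when_def in_keys_iff)
  then show ?thesis using g[OF S0_subset[OF m]] by (metis mult_single add.right_neutral mult_1)
qed

end

section \<open>Automorphisms and the stabilizer of the derivation\<close>

lemma BijGroup_mult:
  "f \<in> Bij X \<Longrightarrow> g \<in> Bij X \<Longrightarrow> f \<otimes>\<^bsub>BijGroup X\<^esub> g = compose X f g"
  by (simp add: BijGroup_def)

lemma BijGroup_one: "\<one>\<^bsub>BijGroup X\<^esub> = (\<lambda>x\<in>X. x)"
  by (simp add: BijGroup_def)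

lemma carrier_BijGroup: "carrier (BijGroup X) = Bij X"
  by (simp add: BijGroup_def)

lemma Bij_inverse:
  assumes "f \<in> Bij X"
  shows "inv\<^bsub>BijGroup X\<^esub> f \<in> Bij X"
    and "x \<in> X \<Longrightarrow> f ((inv\<^bsub>BijGroup X\<^esub> f) x) = x"
    and "x \<in> X \<Longrightarrow> (inv\<^bsub>BijGroup X\<^esub> f) (f x) = x"
    and "x \<in> X \<Longrightarrow> (inv\<^bsub>BijGroup X\<^esub> f) x \<in> X"
proof -
  have bij: "bij_betw f X X" using assms by (simp add: Bij_def)
  show "inv\<^bsub>BijGroup X\<^esub> f \<in> Bij X"
    using assms by (simp add: inv_BijGroup restrict_inv_into_Bij del: restrict_apply)
  show "f ((inv\<^bsub>BijGroup X\<^esub> f) x) = x" if "x \<in> X"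
    using assms bij that by (simp add: inv_BijGroup bij_betw_inv_into_right)
  show "(inv\<^bsub>BijGroup X\<^esub> f) (f x) = x" if "x \<in> X"
    using assms bij that by (simp add: inv_BijGroup bij_betw_inv_into_left bij_betwE)
  show "(inv\<^bsub>BijGroup X\<^esub> f) x \<in> X" if "x \<in> X"
    using assms that by (simp add: inv_BijGroup Bij_inv_into_mem)
qed

lemma Bij_eqI:
  assumes "f \<in> Bij X" "g \<in> Bij X" "\<And>x. x \<in> X \<Longrightarrow> f x = g x"
  shows "f = g"
  using assms by (meson Bij_imp_extensional extensionalityI)

lemma Bij_subgroupI:
  assumes "H \<subseteq> Bij X" "(\<lambda>x\<in>X. x) \<in> H"
    and "\<And>f g. f \<in> H \<Longrightarrow> g \<in> H \<Longrightarrow> compose X f g \<in> H"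
    and "\<And>f. f \<in> H \<Longrightarrow> inv\<^bsub>BijGroup X\<^esub> f \<in> H"
  shows "subgroup H (BijGroup X)"
proof (rule subgroup.intro)
  show "f \<otimes>\<^bsub>BijGroup X\<^esub> g \<in> H" if "f \<in> H" "g \<in> H" for f g
    using assms that by (metis BijGroup_mult subsetD)
qed (use assms in \<open>auto simp: carrier_BijGroup BijGroup_one\<close>)

lemma semidirectI:
  assumes G: "group G" and K: "subgroup K G" and H: "subgroup H G" and N: "subgroup N G"
    and HK: "H \<subseteq> K" and NK: "N \<subseteq> K"
    and conj: "\<And>k n. k \<in> K \<Longrightarrow> n \<in> N \<Longrightarrow> k \<otimes>\<^bsub>G\<^esub> n \<otimes>\<^bsub>G\<^esub> inv\<^bsub>G\<^esub> k \<in> N"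
    and triv: "H \<inter> N \<subseteq> {\<one>\<^bsub>G\<^esub>}"
    and decomp: "\<And>k. k \<in> K \<Longrightarrow> \<exists>h\<in>H. \<exists>n\<in>N. k = h \<otimes>\<^bsub>G\<^esub> n"
  shows "semidirect (G\<lparr>carrier := K\<rparr>) H N"
proof -
  interpret G: group G by (rule G)
  have gK: "group (G\<lparr>carrier := K\<rparr>)" by (rule subgroup.subgroup_is_group[OF K G])
  have "subgroup H (G\<lparr>carrier := K\<rparr>)" "subgroup N (G\<lparr>carrier := K\<rparr>)"
    using G.subgroup_incl H N K HK NK by blast+
  moreover from this have "N \<lhd> G\<lparr>carrier := K\<rparr>"
    unfolding group.normal_inv_iff[OF gK] using conj G.m_inv_consistent[OF K] by simp
  moreover have "H \<inter> N = {\<one>\<^bsub>G\<^esub>}"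
    using triv subgroup.one_closed[OF H] subgroup.one_closed[OF N] by blast
  moreover have "H <#>\<^bsub>G\<lparr>carrier := K\<rparr>\<^esub> N = K"
  proof
    show "H <#>\<^bsub>G\<lparr>carrier := K\<rparr>\<^esub> N \<subseteq> K"
      using HK NK subgroup.m_closed[OF K] by (auto simp: set_mult_def)
    show "K \<subseteq> H <#>\<^bsub>G\<lparr>carrier := K\<rparr>\<^esub> N"
    proof
      fix k assume "k \<in> K"
      then obtain h n where "h \<in> H" "n \<in> N" "k = h \<otimes>\<^bsub>G\<^esub> n" using decomp by blast
      then show "k \<in> H <#>\<^bsub>G\<lparr>carrier := K\<rparr>\<^esub> N" by (auto simp: set_mult_def)
    qed
  qed
  ultimately show ?thesis by (simp add: semidirect_def)
qed

lemma AutD: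
  assumes "\<phi> \<in> Aut B"
  shows "\<phi> \<in> Bij B" "linear_on B \<phi>" "\<phi> 1 = 1"
    and "a \<in> B \<Longrightarrow> b \<in> B \<Longrightarrow> \<phi> (a * b) = \<phi> a * \<phi> b" "a \<in> B \<Longrightarrow> \<phi> a \<in> B"
  using assms Bij_imp_funcset by (auto simp: Aut_def)

lemma semigroup_algebra_one: "0 \<in> S \<Longrightarrow> 1 \<in> semigroup_algebra S"
  by (simp add: semigroup_algebra_def)

lemma Aut_subgroup:
  fixes S :: "(int ^ 'n::finite) set"
  assumes S: "0 \<in> S" "\<And>a b. a \<in> S \<Longrightarrow> b \<in> S \<Longrightarrow> a + b \<in> S"
  shows "subgroup (Aut (semigroup_algebra S :: ('n, 'k::comm_ring_1) laurent set))
    (BijGroup (semigroup_algebra S))"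
proof (rule Bij_subgroupI)
  let ?B = "semigroup_algebra S :: ('n, 'k) laurent set"
  note B = semigroup_algebra_add[where S = S] semigroup_algebra_const_mult[where S = S]
    semigroup_algebra_mult[OF S(2)] semigroup_algebra_one[OF S(1)]
  show "Aut ?B \<subseteq> Bij ?B" by (auto simp: Aut_def)
  show "(\<lambda>x\<in>?B. x) \<in> Aut ?B" by (auto simp: Aut_def id_Bij linear_on_def B)
  show "compose ?B f g \<in> Aut ?B" if "f \<in> Aut ?B" "g \<in> Aut ?B" for f g
  proof -
    note fg = AutD[OF that(1)] AutD[OF that(2)]
    show ?thesis
      using fg by (auto simp: Aut_def compose_Bij linear_on_def compose_eq B)
  qed
  show "inv\<^bsub>BijGroup ?B\<^esub> f \<in> Aut ?B" if "f \<in> Aut ?B" for f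
  proof -
    note f = AutD[OF that]
    note i = Bij_inverse[OF f(1)]
    have eqI: "(inv\<^bsub>BijGroup ?B\<^esub> f) x = y" if "f y = x" "y \<in> ?B" for x y
      using i(3)[OF that(2)] that(1) by simp
    show ?thesis unfolding Aut_def linear_on_def
    proof (intro CollectI conjI ballI allI)
      fix a b c assume a: "a \<in> ?B" and b: "b \<in> ?B"
      show "(inv\<^bsub>BijGroup ?B\<^esub> f) (a + b) = (inv\<^bsub>BijGroup ?B\<^esub> f) a + (inv\<^bsub>BijGroup ?B\<^esub> f) b"
        by (rule eqI) (use a b f(2) i(2,4) in \<open>simp_all add: linear_on_def B\<close>)
      show "(inv\<^bsub>BijGroup ?B\<^esub> f) (a * b) = (inv\<^bsub>BijGroup ?B\<^esub> f) a * (inv\<^bsub>BijGroup ?B\<^esub> f) b"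
        by (rule eqI) (use a b f(4) i(2,4) in \<open>simp_all add: linear_on_def B\<close>)
    next
      fix a c assume a: "a \<in> ?B"
      show "(inv\<^bsub>BijGroup ?B\<^esub> f) (const c * a) = const c * (inv\<^bsub>BijGroup ?B\<^esub> f) a"
        by (rule eqI) (use a f(2) i(2,4) in \<open>simp_all add: linear_on_def B\<close>)
    next
      show "(inv\<^bsub>BijGroup ?B\<^esub> f) 1 = 1" by (rule eqI) (use f(3) in \<open>simp_all add: B\<close>)
    qed (rule i(1))
  qed
qed

lemma Aut_power:
  assumes "\<phi> \<in> Aut B" "a \<in> B" "\<And>k. a ^ k \<in> B"
  shows "\<phi> (a ^ k) = \<phi> a ^ k"
  by (induction k) (use AutD[OF assms(1)] assms(2,3) in auto)

lemma Aut_of_multiplicative: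
  assumes S: "0 \<in> S" "\<And>a b. a \<in> S \<Longrightarrow> b \<in> S \<Longrightarrow> a + b \<in> S"
    and h: "\<And>a b. a \<in> S \<Longrightarrow> b \<in> S \<Longrightarrow> h (a + b) = h a * h b" "h 0 = 1"
    and hS: "\<And>m. m \<in> S \<Longrightarrow> h m \<in> semigroup_algebra S"
    and kS: "\<And>m. m \<in> S \<Longrightarrow> k m \<in> semigroup_algebra S"
    and hk: "\<And>m. m \<in> S \<Longrightarrow> lin_ext h (k m) = chi m" "\<And>m. m \<in> S \<Longrightarrow> lin_ext k (h m) = chi m"
  shows "restrict (lin_ext h) (semigroup_algebra S) \<in> Aut (semigroup_algebra S)"
proof -
  let ?B = "semigroup_algebra S"
  have id: "lin_ext (\<lambda>m. chi m) b = b" if "b \<in> ?B" for b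
    using linear_on_eq_lin_ext[of S "\<lambda>x. x" b] that by (simp add: linear_on_def)
  have hk': "lin_ext h (lin_ext k b) = b" "lin_ext k (lin_ext h b) = b" if "b \<in> ?B" for b
  proof -
    show "lin_ext h (lin_ext k b) = b"
      by (rule linear_on_eqI[where S = S and \<phi> = "\<lambda>b. lin_ext h (lin_ext k b)" and \<psi> = "\<lambda>b. b"])
         (use that hk in \<open>auto simp: linear_on_def lin_ext_add lin_ext_const_mult\<close>)
    show "lin_ext k (lin_ext h b) = b"
      by (rule linear_on_eqI[where S = S and \<phi> = "\<lambda>b. lin_ext k (lin_ext h b)" and \<psi> = "\<lambda>b. b"])
         (use that hk in \<open>auto simp: linear_on_def lin_ext_add lin_ext_const_mult\<close>)
  qed
  have "bij_betw (lin_ext h) ?B ?B"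
    by (rule bij_betw_byWitness[where f' = "lin_ext k"])
       (use hk' lin_ext_in_semigroup_algebra[OF _ hS] lin_ext_in_semigroup_algebra[OF _ kS] in \<open>simp_all add: image_subset_iff\<close>)
  then have "restrict (lin_ext h) ?B \<in> Bij ?B" by (simp add: Bij_def)
  moreover have "lin_ext h 1 = 1"
    using lin_ext_single[of h 0 1] h(2) by simp
  ultimately show ?thesis
    by (auto simp: Aut_def linear_on_def lin_ext_add lin_ext_const_mult semigroup_algebra_one[OF S(1)]
        semigroup_algebra_add semigroup_algebra_const_mult semigroup_algebra_mult[OF S(2)]
        lin_ext_mult[of S h, OF h(1)])
qed

lemma keys_linear_image:
  fixes \<phi> :: "('a::finite, 'b::comm_ring_1) laurent \<Rightarrow> ('a, 'b) laurent"
  assumes "linear_on (semigroup_algebra S) \<phi>" "f \<in> semigroup_algebra S" "keys f \<subseteq> K"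
  shows "keys (\<phi> f) \<subseteq> (\<Union>p\<in>K. keys (\<phi> (chi p)))"
proof -
  have "keys (\<phi> f)
      \<subseteq> (\<Union>p\<in>keys f. keys (const (lookup f p) * \<phi> (chi p)))"
    unfolding linear_on_eq_lin_ext[OF assms(1,2)] lin_ext_def by (rule keys_sum)
  also have "\<dots> \<subseteq> (\<Union>p\<in>K. keys (\<phi> (chi p)))"
  proof -
    have "keys (const c * h) \<subseteq> keys h" for c :: 'b and h :: "('a, 'b) laurent"
      unfolding in_keys_iff subset_iff lookup_const_mult by (metis mult_zero_right)
    then show ?thesis using assms(3) by blast
  qed
  finally show ?thesis .
qed

context demazure_lnd
begin

lemma B_closed: "0 \<in> B" "1 \<in> B" "f \<in> B \<Longrightarrow> g \<in> B \<Longrightarrow> f + g \<in> B" "f \<in> B \<Longrightarrow> const c * f \<in> B"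
    "f \<in> B \<Longrightarrow> g \<in> B \<Longrightarrow> f * g \<in> B" "f \<in> B \<Longrightarrow> f ^ k \<in> B"
    "single m c \<in> B \<longleftrightarrow> c = 0 \<or> m \<in> S"
proof -
  show mult: "f * g \<in> B" if "f \<in> B" "g \<in> B" for f g
    using that add_mem semigroup_algebra_mult unfolding B_def by blast
  show one: "1 \<in> B" using zero_mem by (simp add: B_def semigroup_algebra_one)
  show "f \<in> B \<Longrightarrow> f ^ k \<in> B" by (induction k) (auto simp: one mult)
  show "f \<in> B \<Longrightarrow> g \<in> B \<Longrightarrow> f + g \<in> B" "f \<in> B \<Longrightarrow> const c * f \<in> B"
    unfolding B_def by (rule semigroup_algebra_add semigroup_algebra_const_mult; assumption)+
qed (auto simp: B_def semigroup_algebra_def)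

lemma chi_in_B [simp]: "chi m \<in> B \<longleftrightarrow> m \<in> S"
  by (simp add: B_def)

lemma AutD_const: "\<phi> \<in> Aut B \<Longrightarrow> b \<in> B \<Longrightarrow> \<phi> (const c * b) = const c * \<phi> b"
  using AutD(2) unfolding linear_on_def by blast

lemma AutD_single: "\<phi> \<in> Aut B \<Longrightarrow> m \<in> S \<Longrightarrow> \<phi> (single m c) = const c * \<phi> (chi m)"
  using AutD_const[of \<phi> "chi m" c] by (simp add: const_mult_chi)

lemma AutD_add: "\<phi> \<in> Aut B \<Longrightarrow> a \<in> B \<Longrightarrow> b \<in> B \<Longrightarrow> \<phi> (a + b) = \<phi> a + \<phi> b"
  using AutD(2) unfolding linear_on_def by blast

lemma AutD_chi_add: "\<phi> \<in> Aut B \<Longrightarrow> a \<in> S \<Longrightarrow> b \<in> S \<Longrightarrow> \<phi> (chi (a + b)) = \<phi> (chi a) * \<phi> (chi b)"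
  unfolding chi_add by (rule AutD(4)) auto

lemma AutD_zero: "\<phi> \<in> Aut B \<Longrightarrow> \<phi> 0 = 0"
  using linear_on_zero[OF AutD(2)] B_closed(1) by blast

lemma Aut_inject: "\<phi> \<in> Aut B \<Longrightarrow> a \<in> B \<Longrightarrow> b \<in> B \<Longrightarrow> \<phi> a = \<phi> b \<Longrightarrow> a = b"
  using AutD(1)[of \<phi> B] unfolding Bij_def bij_betw_def inj_on_def by blast

lemma Aut_chi_neq_0: "\<phi> \<in> Aut B \<Longrightarrow> m \<in> S \<Longrightarrow> \<phi> (chi m) \<noteq> 0"
  using Aut_inject[of \<phi> "chi m" 0] B_closed(1) AutD_zero by auto

lemma Aut_eqI:
  assumes "\<phi> \<in> Aut B" "\<psi> \<in> Aut B" "\<And>m. m \<in> S \<Longrightarrow> \<phi> (chi m) = \<psi> (chi m)"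
  shows "\<phi> = \<psi>"
proof (rule Bij_eqI[OF AutD(1)[OF assms(1)] AutD(1)[OF assms(2)]])
  fix x assume "x \<in> B"
  then show "\<phi> x = \<psi> x"
    using linear_on_eqI[of S \<phi> \<psi>] AutD(2) assms unfolding B_def by blast
qed

lemma Aut_subgroup_B: "subgroup (Aut B) (BijGroup B)"
  unfolding B_def by (rule Aut_subgroup[OF zero_mem add_mem])

lemmas Aut_inv = subgroup.m_inv_closed[OF Aut_subgroup_B]

lemma Aut_compose: "\<phi> \<in> Aut B \<Longrightarrow> \<psi> \<in> Aut B \<Longrightarrow> compose B \<phi> \<psi> \<in> Aut B"
  using subgroup.m_closed[OF Aut_subgroup_B, of \<phi> \<psi>] BijGroup_mult[of \<phi> B \<psi>] AutD(1) by metis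

lemma Aut_stabD:
  assumes "\<phi> \<in> Aut_stab B \<delta>"
  shows "\<phi> \<in> Aut B" and "b \<in> B \<Longrightarrow> \<phi> (\<delta> b) = \<delta> (\<phi> b)"
  using assms by (auto simp: Aut_stab_def commute_on_def)

lemma Aut_stab_subgroup: "subgroup (Aut_stab B \<delta>) (BijGroup B)"
proof (rule Bij_subgroupI)
  show "Aut_stab B \<delta> \<subseteq> Bij B" using AutD(1) Aut_stabD(1) by blast
  have "(\<lambda>x\<in>B. x) \<in> Aut B" using subgroup.one_closed[OF Aut_subgroup_B] by (simp add: BijGroup_one)
  then show "(\<lambda>x\<in>B. x) \<in> Aut_stab B \<delta>" by (simp add: Aut_stab_def commute_on_def \<delta>_in_B)
  show "compose B f g \<in> Aut_stab B \<delta>" if "f \<in> Aut_stab B \<delta>" "g \<in> Aut_stab B \<delta>" for f g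
  proof -
    note fg = Aut_stabD[OF that(1)] Aut_stabD[OF that(2)]
    show ?thesis
      using Aut_compose[OF fg(1,3)] fg(2,4) AutD(5)[OF fg(3)]
      by (simp add: Aut_stab_def commute_on_def compose_eq \<delta>_in_B)
  qed
  show "inv\<^bsub>BijGroup B\<^esub> f \<in> Aut_stab B \<delta>" if "f \<in> Aut_stab B \<delta>" for f
  proof -
    note f = Aut_stabD[OF that]
    note i = Bij_inverse[OF AutD(1)[OF f(1)]]
    have "(inv\<^bsub>BijGroup B\<^esub> f) (\<delta> b) = \<delta> ((inv\<^bsub>BijGroup B\<^esub> f) b)" if "b \<in> B" for b
    proof -
      have "f (\<delta> ((inv\<^bsub>BijGroup B\<^esub> f) b)) = \<delta> b" using f(2) i(2,4) that by simp
      then show ?thesis using i(3)[of "\<delta> ((inv\<^bsub>BijGroup B\<^esub> f) b)"] i(4) that \<delta>_in_B by metis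
    qed
    then show ?thesis using Aut_inv[OF f(1)] by (simp add: Aut_stab_def commute_on_def)
  qed
qed

lemmas Aut_stab_mult = subgroup.m_closed[OF Aut_stab_subgroup]
lemmas Aut_stab_inv = subgroup.m_inv_closed[OF Aut_stab_subgroup]

lemma Aut_stab_ker:
  assumes "\<phi> \<in> Aut_stab B \<delta>" "a \<in> ker_on B \<delta>"
  shows "\<phi> a \<in> ker_on B \<delta>"
proof -
  note \<phi> = Aut_stabD[OF assms(1)]
  have a: "a \<in> B" "\<delta> a = 0" using assms(2) by (auto simp: ker_on_def)
  have "\<delta> (\<phi> a) = \<phi> 0" using \<phi>(2)[OF a(1)] a(2) by simp
  then show ?thesis using AutD_zero[OF \<phi>(1)] AutD(5)[OF \<phi>(1) a(1)] by (simp add: ker_on_def)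
qed

text \<open>
  The complement of \<open>\<U>(\<delta>)\<close> in the stabilizer.  It is the product of \<open>S\<^sub>\<delta>\<close> and
  \<open>\<T>\<^sub>\<delta>\<close> if the generators of \<open>A\<close> are characters at a common base point.
\<close>

definition homogeneous_stab :: "(('n, 'k) laurent \<Rightarrow> ('n, 'k) laurent) set"
  where "homogeneous_stab = {\<phi> \<in> Aut_stab B \<delta>. homogeneous_map B \<phi>}"

lemma homogeneous_stabD:
  assumes "\<phi> \<in> homogeneous_stab"
  shows "\<phi> \<in> Aut_stab B \<delta>" "\<phi> \<in> Aut B" 
    and "m \<in> S \<Longrightarrow> \<exists>p\<in>S. \<exists>c. c \<noteq> 0 \<and> \<phi> (chi m) = single p c"
proof -
  show 1: "\<phi> \<in> Aut_stab B \<delta>" using assms by (simp add: homogeneous_stab_def)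
  show 2: "\<phi> \<in> Aut B" by (rule Aut_stabD(1)[OF 1])
  show "\<exists>p\<in>S. \<exists>c. c \<noteq> 0 \<and> \<phi> (chi m) = single p c" if "m \<in> S"
  proof -
    have "homogeneous (chi m)" by (auto simp: homogeneous_def)
    moreover have "homogeneous_map B \<phi>" using assms by (simp add: homogeneous_stab_def)
    ultimately have "homogeneous (\<phi> (chi m))"
      using that chi_in_B unfolding homogeneous_map_def by blast
    then obtain p c where pc: "\<phi> (chi m) = single p c"
      unfolding homogeneous_def by blast
    moreover have "c \<noteq> 0" using Aut_chi_neq_0[OF 2 that] pc by auto
    moreover have "\<phi> (chi m) \<in> B" using AutD(5)[OF 2] that by simp
    ultimately show ?thesis by (auto simp: B_closed)
  qed
qed

lemma homogeneous_mapI: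
  assumes "\<phi> \<in> Aut B" "\<And>m. m \<in> S \<Longrightarrow> homogeneous (\<phi> (chi m))"
  shows "homogeneous_map B \<phi>"
  unfolding homogeneous_map_def
proof (intro ballI impI)
  fix b assume b: "b \<in> B" "homogeneous b"
  then obtain m c where mc: "b = single m c" by (auto simp: homogeneous_def)
  show "homogeneous (\<phi> b)"
  proof (cases "c = 0")
    case True
    then show ?thesis using AutD_zero[OF assms(1)] mc by (auto simp: homogeneous_def)
  next
    case False
    then have m: "m \<in> S" using b mc B_closed by simp
    then obtain p c' where "\<phi> (chi m) = single p c'"
      using assms(2) unfolding homogeneous_def by blast
    then show ?thesis using AutD_single[OF assms(1) m, of c] mc by (auto simp: homogeneous_def mult_single)
  qed
qed

lemma homogeneous_stab_subgroup: "subgroup homogeneous_stab (BijGroup B)"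
proof (rule Bij_subgroupI)
  show "homogeneous_stab \<subseteq> Bij B" using AutD(1) homogeneous_stabD(2) by blast
  show "(\<lambda>x\<in>B. x) \<in> homogeneous_stab"
    using subgroup.one_closed[OF Aut_stab_subgroup]
    by (auto simp: homogeneous_stab_def BijGroup_one homogeneous_map_def)
  show "compose B f g \<in> homogeneous_stab" if "f \<in> homogeneous_stab" "g \<in> homogeneous_stab" for f g
  proof -
    have "f \<in> Bij B" "g \<in> Bij B" using that homogeneous_stabD(2) AutD(1) by blast+
    then have "compose B f g \<in> Aut_stab B \<delta>"
      using Aut_stab_mult that homogeneous_stabD(1) BijGroup_mult by metis
    moreover have "homogeneous_map B (compose B f g)"
      using that AutD(5)[OF homogeneous_stabD(2)[OF that(2)]]
      unfolding homogeneous_stab_def homogeneous_map_def by (simp add: compose_eq)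
    ultimately show ?thesis by (simp add: homogeneous_stab_def)
  qed
  show "inv\<^bsub>BijGroup B\<^esub> f \<in> homogeneous_stab" if f: "f \<in> homogeneous_stab" for f
  proof -
    note fA = homogeneous_stabD(2)[OF f]
    note i = Bij_inverse[OF AutD(1)[OF fA]]
    let ?i = "inv\<^bsub>BijGroup B\<^esub> f"
    have iA: "?i \<in> Aut B" by (rule Aut_inv[OF fA])
    have "homogeneous (?i (chi m))" if m: "m \<in> S" for m
    proof -
      let ?F = "?i (chi m)"
      have FB: "?F \<in> B" and fF: "f ?F = chi m" using i m by auto
      obtain \<tau> c where \<tau>: "\<And>p. p \<in> S \<Longrightarrow> \<tau> p \<in> S \<and> c p \<noteq> 0 \<and> f (chi p) = single (\<tau> p) (c p)"
        using homogeneous_stabD(3)[OF f] by metis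
      have keysS: "p \<in> S" if "p \<in> keys ?F" for p
        using FB that by (auto simp: B_def semigroup_algebra_def)
      \<comment> \<open>Distinct characters have images with distinct exponents, so the terms of \<open>?F\<close> cannot
        cancel under \<open>f\<close>: only one of them can be present.\<close>
      have \<tau>_inj: "p = q" if "p \<in> S" "q \<in> S" "\<tau> p = \<tau> q" for p q
      proof -
        have "f (single p (c q)) = f (single q (c p))"
          unfolding AutD_single[OF fA that(1), of "c q"] AutD_single[OF fA that(2), of "c p"]
            conjunct2[OF conjunct2[OF \<tau>[OF that(1)]]] conjunct2[OF conjunct2[OF \<tau>[OF that(2)]]] that(3)
          by (simp add: mult_single mult.commute)
        then have "single p (c q) = single q (c p)"
          using Aut_inject[OF fA] B_closed(7) that by blast
        then have "lookup (single q (c p)) p = c q"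
          by (metis lookup_single_eq)
        moreover have "c q \<noteq> 0" using \<tau>[OF that(2)] by blast
        ultimately show ?thesis by (metis lookup_single_not_eq)
      qed
      have "f ?F = (\<Sum>p\<in>keys ?F. const (lookup ?F p) * f (chi p))"
        using linear_on_eq_lin_ext[of S f ?F] AutD(2)[OF fA] FB unfolding B_def lin_ext_def by simp
      then have F: "chi m = (\<Sum>p\<in>keys ?F. single (\<tau> p) (lookup ?F p * c p))"
        using fF \<tau> keysS by (simp add: mult_single)
      have eq: "\<tau> q = m" if q: "q \<in> keys ?F" for q
      proof -
        have "lookup (chi m) (\<tau> q)
            = (\<Sum>p\<in>keys ?F. (lookup ?F p * c p when \<tau> p = \<tau> q))"
          by (subst F) (simp add: lookup_sum lookup_single)
        also have "\<dots> = (\<Sum>p\<in>keys ?F. if p = q then lookup ?F p * c p else 0)"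
          by (rule sum.cong) (use \<tau>_inj keysS q in \<open>auto simp: when_def\<close>)
        also have "\<dots> = lookup ?F q * c q" using q by simp
        also have "\<dots> \<noteq> 0" using q \<tau>[OF keysS[OF q]] by (simp add: in_keys_iff)
        finally show ?thesis by (auto simp: lookup_single when_def split: if_splits)
      qed
      have "p = q" if "p \<in> keys ?F" "q \<in> keys ?F" for p q
        using \<tau>_inj[OF keysS[OF that(1)] keysS[OF that(2)]] eq[OF that(1)] eq[OF that(2)] by simp
      then obtain q where q: "keys ?F \<subseteq> {q}" by blast
      then have "?F = single q (lookup ?F q)"
        by (intro poly_mapping_eqI) (auto simp: lookup_single when_def in_keys_iff)
      then show ?thesis unfolding homogeneous_def by blast
    qed
    then have "homogeneous_map B ?i" by (rule homogeneous_mapI[OF iA])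
    then show ?thesis using Aut_stab_inv[OF homogeneous_stabD(1)[OF f]]
      by (simp add: homogeneous_stab_def)
  qed
qed

lemmas homogeneous_stab_mult = subgroup.m_closed[OF homogeneous_stab_subgroup]
lemmas homogeneous_stab_inv = subgroup.m_inv_closed[OF homogeneous_stab_subgroup]

text \<open>
  Induction on the height of \<open>m\<close>.  The monomial \<open>\<phi> \<chi>\<^sup>m\<close> and \<open>\<chi>\<^sup>m\<close> have the same image
  under \<open>\<delta>\<close>, and a monomial not killed by \<open>\<delta>\<close> is determined by its image.
\<close>

lemma homogeneous_stab_fixing_kernel:
  assumes f: "\<phi> \<in> homogeneous_stab" and fix_ker: "\<And>m. m \<in> S0 \<Longrightarrow> \<phi> (chi m) = chi m"
  shows "\<phi> = (\<lambda>b\<in>B. b)"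
proof (rule Aut_eqI[OF homogeneous_stabD(2)[OF f]])
  show "(\<lambda>b\<in>B. b) \<in> Aut B" using subgroup.one_closed[OF Aut_subgroup_B] by (simp add: BijGroup_one)
  note stab = Aut_stabD[OF homogeneous_stabD(1)[OF f]]
  have "m \<in> S \<Longrightarrow> pairing m v = int d \<Longrightarrow> \<phi> (chi m) = chi m" for d m
  proof (induction d arbitrary: m)
    case 0
    then show ?case using fix_ker by (simp add: S0_def)
  next
    case (Suc d)
    obtain p c where pc: "c \<noteq> 0" "\<phi> (chi m) = single p c"
      using homogeneous_stabD(3)[OF f Suc.prems(1)] by blast
    have me: "m + e \<in> S" "pairing (m + e) v = int d"
      using shift_mem Suc.prems by (auto simp: pairing_left e_v)
    have "\<phi> (\<delta> (chi m)) = \<delta> (\<phi> (chi m))" using stab(2) Suc.prems by simp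
    then have "single (m + e) (of_int (pairing m v))
        = single (p + e) (c * of_int (pairing p v))"
      unfolding \<delta>_chi AutD_single[OF stab(1) me(1), of "of_int (pairing m v)"] pc(2) Suc.IH[OF me]
      by (simp add: \<delta>_single mult_single)
    moreover have nz: "(of_int (pairing m v) :: 'k) \<noteq> 0" using Suc.prems(2) by (simp del: of_nat_Suc)
    ultimately have "p + e = m + e" "of_int (pairing m v) = c * of_int (pairing p v)"
      by (metis lookup_single_eq lookup_single_not_eq)+
    then have "p = m" "c = 1" using nz by auto
    then show ?case using pc by simp
  qed
  then show "\<phi> (chi m) = (\<lambda>b\<in>B. b) (chi m)" if "m \<in> S" for m
  proof -
    obtain d where "pairing m v = int d" using v_nonneg[OF \<open>m \<in> S\<close>] by (metis nonneg_int_cases)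
    then show ?thesis using \<open>\<And>m d. m \<in> S \<Longrightarrow> pairing m v = int d \<Longrightarrow> \<phi> (chi m) = chi m\<close> that by simp
  qed
qed

end

section \<open>Translations along the root\<close>

context demazure_lnd
begin

abbreviation V0 :: "(int ^ 'n) set" where "V0 \<equiv> {p. pairing p v = 0}"

text \<open>
  The coefficient ring \<open>R\<close> of the polynomial ring on which \<open>\<delta>\<close> is a derivative.
\<close>

abbreviation KV0 :: "('n, 'k) laurent set" where "KV0 \<equiv> semigroup_algebra V0"

abbreviation low :: "int \<Rightarrow> ('n, 'k) laurent set"
  where "low k \<equiv> semigroup_algebra {p. pairing p v \<le> k}"

text \<open>
  The image of \<open>\<chi>\<^sup>m = \<chi>\<^bsup>base m\<^esup> x\<^sup>d\<close>, where \<open>x = \<chi>\<^bsup>-e\<^esup>\<close> and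
  \<open>d = \<langle>m, v\<rangle> \<ge> 0\<close>, under the substitution \<open>x \<mapsto> x + h\<close> that fixes the characters orthogonal
  to \<open>v\<close>.
\<close>

definition translate :: "('n, 'k) laurent \<Rightarrow> int ^ 'n \<Rightarrow> ('n, 'k) laurent"
  where "translate h m = chi (base m) * (chi (- e) + h) ^ nat (pairing m v)"

lemma translate_add:
  "0 \<le> pairing a v \<Longrightarrow> 0 \<le> pairing b v \<Longrightarrow> translate h (a + b) = translate h a * translate h b"
  by (simp add: translate_def base_add chi_add pairing_add_left nat_add_distrib power_add mult_ac
      del: mult_single)

lemma translate_zero [simp]: "translate h 0 = 1"
  by (simp add: translate_def)

lemma translate_orthogonal: "pairing m v = 0 \<Longrightarrow> translate h m = chi m"
  by (simp add: translate_def base_eq_orthogonal)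

lemma low_mult: "f \<in> low i \<Longrightarrow> g \<in> low j \<Longrightarrow> f * g \<in> low (i + j)"
  using keys_mult[of f g] by (fastforce simp: semigroup_algebra_def pairing_add_left)

lemma low_mono: "f \<in> low i \<Longrightarrow> i \<le> j \<Longrightarrow> f \<in> low j"
  by (force simp: semigroup_algebra_def)

lemma V0_low: "h \<in> KV0 \<Longrightarrow> h \<in> low 0"
  by (auto simp: semigroup_algebra_def)

text \<open>
  The binomial expansion of \<open>(x + h)\<^sup>d\<close>, of which only the parts of height \<open>d\<close> and
  \<open>d - 1\<close> are kept.  The first yields the homogeneous part of an automorphism, the second the
  derivation \<open>h \<delta>\<close>.
\<close>

lemma translated_power_expansion:
  assumes h: "h \<in> KV0"
  shows "\<exists>R\<in>low (int d - 2). (chi (- e) + h) ^ d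
    = chi (- int d *s e) + const (of_nat d) * (h * chi ((1 - int d) *s e)) + R"
proof (induction d)
  case 0
  have "- int 0 *s e = 0" by (simp add: vec_eq_iff)
  then show ?case by (intro bexI[of _ 0]) auto
next
  case (Suc d)
  let ?T = "chi (- int d *s e) :: ('n, 'k) laurent"
  let ?U = "chi ((1 - int d) *s e) :: ('n, 'k) laurent"
  let ?c = "const (of_nat d) :: ('n, 'k) laurent"
  obtain R where R: "R \<in> low (int d - 2)" "(chi (- e) + h) ^ d = ?T + ?c * (h * ?U) + R"
    using Suc by blast
  have "- e + - int d *s e = - int (Suc d) *s e" "- e + (1 - int d) *s e = - int d *s e"
    by (auto simp: vec_eq_iff algebra_simps)
  then have T: "chi (- e) * ?T = chi (- int (Suc d) *s e)" and U: "chi (- e) * ?U = ?T"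
    by (simp_all only: chi_add[symmetric])
  have T': "chi ((1 - int (Suc d)) *s e) = ?T" by simp
  have c: "const (of_nat (Suc d)) = ?c + 1" by (simp add: single_add add.commute)
  let ?R = "chi (- e) * R + h * R + ?c * (h * (h * ?U))"
  have "(chi (- e) + h) ^ Suc d = (chi (- e) + h) * (?T + ?c * (h * ?U) + R)"
    using R(2) by simp
  also have "\<dots> = chi (- e) * ?T + ?c * (h * (chi (- e) * ?U)) + h * ?T + ?R"
    by (simp add: algebra_simps del: mult_single)
  also have "\<dots> = chi (- int (Suc d) *s e)
      + const (of_nat (Suc d)) * (h * chi ((1 - int (Suc d)) *s e)) + ?R"
    unfolding T U T' c by (simp add: algebra_simps del: mult_single)
  finally have eq: "(chi (- e) + h) ^ Suc d = chi (- int (Suc d) *s e)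
      + const (of_nat (Suc d)) * (h * chi ((1 - int (Suc d)) *s e)) + ?R" .
  have "chi (- e) * R \<in> low (int (Suc d) - 2)"
    by (rule low_mono[OF low_mult[OF _ R(1), of _ 1]]) (simp_all add: pairing_left e_v)
  moreover have "h * R \<in> low (int (Suc d) - 2)"
    by (rule low_mono[OF low_mult[OF V0_low[OF h] R(1)]]) simp
  moreover have "h * (h * ?U) \<in> low (int (Suc d) - 2)"
    by (rule low_mono[OF low_mult[OF V0_low[OF h] low_mult[OF V0_low[OF h], of _ "int d - 1"]]])
       (simp_all add: pairing_left e_v)
  ultimately have "?R \<in> low (int (Suc d) - 2)"
    by (intro semigroup_algebra_add semigroup_algebra_const_mult)
  then show ?case using eq by blast
qed

lemma translate_expansion:
  assumes h: "h \<in> KV0" and m: "0 \<le> pairing m v"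
  obtains R where "R \<in> low (pairing m v - 2)"
    "translate h m = chi m + h * \<delta> (chi m) + R"
proof -
  let ?d = "nat (pairing m v)"
  obtain R where R: "R \<in> low (int ?d - 2)" "(chi (- e) + h) ^ ?d
    = chi (- int ?d *s e) + const (of_nat ?d) * (h * chi ((1 - int ?d) *s e)) + R"
    using translated_power_expansion[OF h] by blast
  have 1: "base m + - int ?d *s e = m" and 2: "base m + (1 - int ?d) *s e = m + e"
    using m by (auto simp: base_def vec_eq_iff algebra_simps)
  have "translate h m = chi (base m) * chi (- int ?d *s e)
     + h * (const (of_nat ?d) * (chi (base m) * chi ((1 - int ?d) *s e))) + chi (base m) * R"
    unfolding translate_def R(2) by (simp add: algebra_simps del: mult_single)
  also have "\<dots> = chi m + h * \<delta> (chi m) + chi (base m) * R"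
    unfolding chi_add[symmetric] 1 2 using m by (simp add: \<delta>_chi const_mult_chi of_nat_nat del: mult_single)
  finally have "translate h m = chi m + h * \<delta> (chi m) + chi (base m) * R" .
  moreover have "chi (base m) * R \<in> low (0 + (int ?d - 2))"
    by (rule low_mult[OF _ R(1)]) simp
  ultimately show ?thesis using that m by simp
qed

lemma \<delta>_power:
  assumes "\<delta> y = 1"
  shows "\<delta> (y ^ d) = const (of_nat d) * y ^ (d - 1)"
proof (induction d)
  case 0
  have "\<delta> 1 = \<delta> (chi 0)" by simp
  then show ?case by (simp add: \<delta>_chi del: single_one)
next
  case (Suc d)
  have "\<delta> (y ^ Suc d) = y ^ d + const (of_nat d) * (y * y ^ (d - 1))"
    using Suc assms by (simp add: \<delta>_mult algebra_simps)
  also have "const (of_nat d) * (y * y ^ (d - 1)) = const (of_nat d) * y ^ d"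
    by (cases d) auto
  also have "y ^ d + const (of_nat d) * y ^ d = const (of_nat (Suc d)) * y ^ d"
    by (simp add: const_add algebra_simps)
  finally show ?case by simp
qed

lemma \<delta>_translate:
  assumes h: "h \<in> KV0" and m: "0 \<le> pairing m v"
  shows "\<delta> (translate h m) = const (of_int (pairing m v)) * translate h (m + e)"
proof -
  have "\<delta> (chi (- e) + h) = 1"
    using h by (simp add: \<delta>_linear \<delta>_chi \<delta>_eq_0_iff pairing_left e_v)
  then have "\<delta> (translate h m)
      = chi (base m) * (const (of_nat (nat (pairing m v))) * (chi (- e) + h) ^ (nat (pairing m v) - 1))"
    by (simp add: translate_def \<delta>_mult \<delta>_power \<delta>_chi del: mult_single)
  moreover have "nat (pairing m v) - 1 = nat (pairing (m + e) v)"
    using m by (simp add: pairing_left e_v)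
  ultimately show ?thesis
    using m by (simp add: translate_def base_shift of_nat_nat mult_ac del: mult_single)
qed

lemma lin_ext_translate_mult:
  assumes "f \<in> semigroup_algebra {p. 0 \<le> pairing p v}" "g \<in> semigroup_algebra {p. 0 \<le> pairing p v}"
  shows "lin_ext (translate h) (f * g) = lin_ext (translate h) f * lin_ext (translate h) g"
  by (rule lin_ext_mult[OF _ assms]) (auto simp: translate_add)

lemma lin_ext_translate_orthogonal:
  assumes "f \<in> KV0"
  shows "lin_ext (translate h) f = f"
  using linear_on_eqI[of V0 "lin_ext (translate h)" "\<lambda>f. f", OF linear_on_lin_ext _ _ assms]
  by (simp add: translate_orthogonal linear_on_def)

text \<open>
  The substitutions \<open>x \<mapsto> x + h\<close> and \<open>x \<mapsto> x - h\<close> are inverse to each other.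
\<close>

lemma lin_ext_translate_translate:
  assumes h: "h \<in> KV0" and m: "0 \<le> pairing m v"
  shows "lin_ext (translate h) (translate (- h) m) = chi m"
proof -
  let ?P = "semigroup_algebra {p. 0 \<le> pairing p v} :: ('n, 'k) laurent set"
  define y where "y = chi (- e) + - h"
  have hP: "- h \<in> KV0" using h by (simp add: semigroup_algebra_def)
  then have "- h \<in> ?P" by (auto simp: semigroup_algebra_def)
  moreover have "chi (- e) \<in> ?P" by (simp add: pairing_left e_v)
  ultimately have y: "y \<in> ?P" unfolding y_def by (intro semigroup_algebra_add)
  have y_pow: "y ^ k \<in> ?P" for k
    by (induction k) (auto intro!: semigroup_algebra_mult y semigroup_algebra_one simp: pairing_left)
  have "base (- e) = 0" by (simp add: base_def pairing_left e_v vec_eq_iff)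
  then have "translate h (- e) = chi (- e) + h"
    by (simp add: translate_def pairing_left e_v)
  then have Fy: "lin_ext (translate h) y = chi (- e)"
    unfolding y_def lin_ext_add lin_ext_translate_orthogonal[OF hP] by simp
  have "lin_ext (translate h) (y ^ k) = chi (- e) ^ k" for k
  proof (induction k)
    case 0
    have "lin_ext (translate h) (chi 0) = 1" unfolding lin_ext_single by simp
    then show ?case by simp
  next
    case (Suc k)
    then show ?case by (simp add: lin_ext_translate_mult y y_pow Fy)
  qed
  moreover have "lin_ext (translate h) (chi (base m)) = chi (base m)"
    by (rule lin_ext_translate_orthogonal) simp
  moreover have "(chi (base m) :: ('n, 'k) laurent) \<in> ?P" by simp
  moreover have "translate (- h) m = chi (base m) * y ^ nat (pairing m v)"
    by (simp add: translate_def y_def)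
  ultimately have "lin_ext (translate h) (translate (- h) m) = chi (base m) * chi (- e) ^ nat (pairing m v)"
    by (simp only: lin_ext_translate_mult y_pow)
  also have "\<dots> = chi m"
  proof -
    have "base m + of_nat (nat (pairing m v)) *s - e = m"
      using m by (simp add: base_def vec_eq_iff)
    then show ?thesis by (simp only: chi_power chi_add[symmetric])
  qed
  finally show ?thesis .
qed

section \<open>Exponentials of the multiples of the root derivation\<close>

text \<open>
  These are the \<open>h\<close> for which \<open>h \<delta>\<close> restricts to \<open>B\<close>; such an \<open>h\<close> may have exponents outside
  \<open>S\<close>.
\<close>

definition admissible :: "('n, 'k) laurent \<Rightarrow> bool"
  where "admissible h \<longleftrightarrow> h \<in> KV0 \<and> (\<forall>b\<in>B. h * \<delta> b \<in> B)"

lemma admissible_uminus: "admissible h \<Longrightarrow> admissible (- h)"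
  unfolding admissible_def by (simp add: B_def semigroup_algebra_def)

lemma V0_power: "h \<in> KV0 \<Longrightarrow> h ^ i \<in> KV0"
  by (induction i)
     (auto intro!: semigroup_algebra_mult semigroup_algebra_one simp: pairing_left)

lemma multiple_iterate:
  assumes "h \<in> KV0"
  shows "((\<lambda>b. h * \<delta> b) ^^ i) f = h ^ i * (\<delta> ^^ i) f"
proof (induction i)
  case (Suc i)
  have "\<delta> (h ^ i) = 0" using V0_power[OF assms] by (simp add: \<delta>_eq_0_iff)
  then show ?case using Suc by (simp add: \<delta>_mult mult_ac)
qed simp

lemma \<delta>_iterate_chi:
  "(\<delta> ^^ i) (chi m) = single (m + int i *s e) (\<Prod>j<i. of_int (pairing m v) - of_nat j)"
proof -
  have \<delta>: "\<delta> = lin_ext (\<lambda>m. single (m + e) (of_int (pairing m v)))"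
    by (simp add: \<delta>_def demazure_der_def const_mult_chi del: mult_single)
  have "(\<Prod>j<i. of_int (pairing (m + int j *s e) v) :: 'k) = (\<Prod>j<i. of_int (pairing m v) - of_nat j)"
    by (rule prod.cong) (auto simp: pairing_left e_v)
  then show ?thesis unfolding \<delta> homogeneous_derivation_iterate by simp
qed

lemma multiple_nilpotent:
  assumes "h \<in> KV0" "pairing m v = int d"
  shows "((\<lambda>b. h * \<delta> b) ^^ Suc d) (chi m) = 0"
proof -
  have "(\<Prod>j<Suc d. of_int (pairing m v) - of_nat j :: 'k) = 0" using assms(2) by simp
  then have "(\<delta> ^^ Suc d) (chi m) = 0" unfolding \<delta>_iterate_chi by (simp only: single_zero)
  then show ?thesis unfolding multiple_iterate[OF assms(1)] by (simp only: mult_zero_right)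
qed

text \<open>
  Taylor's formula.  As \<open>\<delta> h = 0\<close>, the \<open>i\<close>-th iterate of \<open>h \<delta>\<close> is \<open>h\<^sup>i \<delta>\<^sup>i\<close>, and
  \<open>\<delta>\<^sup>i \<chi>\<^sup>m\<close> carries the falling factorial \<open>d (d - 1) \<dots> (d - i + 1)\<close>; dividing by
  \<open>i!\<close> leaves the binomial expansion of \<open>(x + h)\<^sup>d\<close>.
\<close>

lemma exponential_series_translate:
  assumes h: "h \<in> KV0" and m: "pairing m v = int d"
  shows "(\<Sum>i<Suc d. const (1 / fact i) * ((\<lambda>b. h * \<delta> b) ^^ i) (chi m)) = translate h m"
proof -
  have coeff: "(\<Prod>j<i. of_int (pairing m v) - of_nat j :: 'k) = fact i * of_nat (d choose i)" for i
    using gbinomial_mult_fact[of i "of_nat d :: 'k"] m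
    by (simp add: binomial_gbinomial atLeast0LessThan)
  have "(\<Sum>i<Suc d. const (1 / fact i) * ((\<lambda>b. h * \<delta> b) ^^ i) (chi m))
      = (\<Sum>i\<le>d. chi (base m) * (of_nat (d choose i) * h ^ i * chi (- e) ^ (d - i)))"
  proof (rule sum.cong)
    fix i assume "i \<in> {..d}"
    then have "base m + of_nat (d - i) *s - e = m + int i *s e"
      using m by (simp add: base_def vec_eq_iff algebra_simps of_nat_diff)
    then have x: "chi (base m) * chi (- e) ^ (d - i) = (chi (m + int i *s e) :: ('n, 'k) laurent)"
      by (simp only: chi_power chi_add[symmetric])
    have "const (1 / fact i) * single (m + int i *s e) (fact i * of_nat (d choose i) :: 'k)
       = const (of_nat (d choose i)) * chi (m + int i *s e)"
      by (simp add: mult_single field_simps)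
    then have "const (1 / fact i) * ((\<lambda>b. h * \<delta> b) ^^ i) (chi m)
       = h ^ i * (const (of_nat (d choose i)) * chi (m + int i *s e))"
      unfolding multiple_iterate[OF h] \<delta>_iterate_chi coeff
      by (simp only: mult.left_commute[of _ "h ^ i"])
    then show "const (1 / fact i) * ((\<lambda>b. h * \<delta> b) ^^ i) (chi m)
       = chi (base m) * (of_nat (d choose i) * h ^ i * chi (- e) ^ (d - i))"
      unfolding x[symmetric] single_of_nat by (simp only: mult_ac)
  qed auto
  also have "\<dots> = translate h m"
    unfolding translate_def sum_distrib_left[symmetric]
    using binomial_ring[of h "chi (- e)" d] m by (simp add: add.commute)
  finally show ?thesis .
qed

lemma translate_in_B:
  assumes h: "admissible h" and m: "m \<in> S"
  shows "translate h m \<in> B"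
proof -
  obtain d where d: "pairing m v = int d" using v_nonneg[OF m] by (metis nonneg_int_cases)
  have h0: "h \<in> KV0" using h by (simp add: admissible_def)
  have "((\<lambda>b. h * \<delta> b) ^^ i) (chi m) \<in> B" for i
    by (induction i) (use h m in \<open>auto simp: admissible_def\<close>)
  then show ?thesis
    unfolding exponential_series_translate[OF h0 d, symmetric] B_def
    by (intro semigroup_algebra_sum semigroup_algebra_const_mult) simp
qed

definition kernel_fixing :: "(('n, 'k) laurent \<Rightarrow> ('n, 'k) laurent) set"
  where "kernel_fixing = {\<phi> \<in> Aut_stab B \<delta>. \<forall>m\<in>S0. \<phi> (chi m) = chi m}"

lemma translation_kernel_fixing:
  assumes h: "admissible h"
  shows "restrict (lin_ext (translate h)) B \<in> kernel_fixing"
proof -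
  have h0: "h \<in> KV0" using h by (simp add: admissible_def)
  have h0': "- h \<in> KV0" using h0 by (simp add: semigroup_algebra_def)
  have "restrict (lin_ext (translate h)) B \<in> Aut B" unfolding B_def
  proof (rule Aut_of_multiplicative[where k = "translate (- h)"])
    fix m assume m: "m \<in> S"
    show "translate h m \<in> semigroup_algebra S" "translate (- h) m \<in> semigroup_algebra S"
      using translate_in_B[OF h m] translate_in_B[OF admissible_uminus[OF h] m] by (simp_all add: B_def)
    show "lin_ext (translate h) (translate (- h) m) = chi m"
      by (rule lin_ext_translate_translate[OF h0 v_nonneg[OF m]])
    show "lin_ext (translate (- h)) (translate h m) = chi m"
      using lin_ext_translate_translate[OF h0' v_nonneg[OF m]] by simp
  qed (use zero_mem add_mem v_nonneg translate_add in auto)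
  moreover have "lin_ext (translate h) (\<delta> b) = \<delta> (lin_ext (translate h) b)" if "b \<in> B" for b
  proof (rule lin_ext_commute_\<delta>[OF _ that])
    show "lin_ext (translate h) (\<delta> (chi m)) = \<delta> (lin_ext (translate h) (chi m))" if "m \<in> S" for m
      using \<delta>_translate[OF h0 v_nonneg[OF that]] by (simp add: \<delta>_chi)
  qed
  moreover have "lin_ext (translate h) (chi m) = chi m" if "m \<in> S0" for m
    using that by (simp add: S0_def translate_orthogonal)
  ultimately show ?thesis
    unfolding kernel_fixing_def Aut_stab_def commute_on_def
    by (simp add: \<delta>_in_B S0_subset)
qed

lemma multiple_lnd:
  assumes h: "admissible h"
  shows "lnd B (\<lambda>b. h * \<delta> b)"
proof -
  have h0: "h \<in> KV0" using h by (simp add: admissible_def)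
  have "derivation_on B (\<lambda>b. h * \<delta> b)"
    unfolding derivation_on_def
  proof (intro conjI ballI)
    show "(\<lambda>b. h * \<delta> b) ` B \<subseteq> B" using h by (auto simp: admissible_def)
    show "linear_on B (\<lambda>b. h * \<delta> b)" 
      by (simp only: linear_on_def \<delta>_linear distrib_left mult.left_commute) simp
  qed (simp add: \<delta>_mult distrib_left mult_ac)
  moreover have "\<exists>k. ((\<lambda>b. h * \<delta> b) ^^ k) (chi m) = 0" if "m \<in> S" for m
    using multiple_nilpotent[OF h0] v_nonneg[OF that] by (metis nonneg_int_cases)
  ultimately show ?thesis unfolding B_def by (intro lnd_if_nilpotent_on_characters)
qed

lemma multiple_kernel:
  assumes "h \<noteq> 0"
  shows "ker_on B (\<lambda>b. h * \<delta> b) = ker_on B \<delta>"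
proof -
  have "h * \<delta> b = 0 \<longleftrightarrow> \<delta> b = 0" for b
    by (cases "\<delta> b = 0") (simp_all add: laurent_mult_nonzero[OF assms])
  then show ?thesis unfolding ker_on_def by simp
qed

lemma exp_der_eq_sum:
  assumes "b \<in> B" "d 0 = 0" "(d ^^ n) b = 0"
  shows "exp_der B d b = (\<Sum>i<n. const (1 / fact i) * (d ^^ i) b)"
proof -
  have "{i. (d ^^ i) b \<noteq> 0} \<subseteq> {..<n}"
  proof
    fix i assume "i \<in> {i. (d ^^ i) b \<noteq> 0}"
    then have "\<not> n \<le> i" using funpow_zero_mono[where D = d, OF assms(3,2), of i] by blast
    then show "i \<in> {..<n}" by simp
  qed
  then show ?thesis using assms(1) unfolding exp_der_def
    by (simp, intro sum.mono_neutral_left) auto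
qed

lemma exp_der_linear:
  assumes d: "lnd B d"
  shows "linear_on B (exp_der B d)"
proof -
  have d0: "d 0 = 0" using d linear_on_zero B_closed(1) by (auto simp: lnd_def)
  have lin: "linear_on B (d ^^ i)" for i
    using d linear_on_funpow by (auto simp: lnd_def)
  have nil: "\<exists>n. (d ^^ n) b = 0" if "b \<in> B" for b using d that by (simp add: lnd_def)
  show ?thesis unfolding linear_on_def
  proof (intro conjI ballI allI)
    fix a b assume ab: "a \<in> B" "b \<in> B"
    obtain k l where "(d ^^ k) a = 0" "(d ^^ l) b = 0" using nil ab by blast
    then have z: "(d ^^ (max k l)) a = 0" "(d ^^ (max k l)) b = 0"
      using funpow_zero_mono[where D = d, OF _ d0] by auto
    have add: "(d ^^ i) (a + b) = (d ^^ i) a + (d ^^ i) b" for i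
      using lin[of i] ab by (simp add: linear_on_def)
    then have "(d ^^ (max k l)) (a + b) = 0" using z by simp
    then show "exp_der B d (a + b) = exp_der B d a + exp_der B d b"
      using exp_der_eq_sum[where d = d and n = "max k l", OF _ d0] ab z B_closed(3)[OF ab]
      by (simp add: add sum.distrib[symmetric] distrib_left)
  next
    fix c a assume a: "a \<in> B"
    obtain k where z: "(d ^^ k) a = 0" using nil a by blast
    have scale: "(d ^^ i) (const c * a) = const c * (d ^^ i) a" for i
      using lin[of i] a by (simp add: linear_on_def)
    then have "(d ^^ k) (const c * a) = 0" using z by simp
    then show "exp_der B d (const c * a) = const c * exp_der B d a"
      using exp_der_eq_sum[where d = d and n = k, OF _ d0] a z B_closed(4)[OF a]
      by (simp only: scale sum_distrib_left mult.left_commute)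
  qed
qed

lemma exp_der_multiple:
  assumes h: "h \<in> KV0" and d: "lnd B d" and eq: "\<And>b. b \<in> B \<Longrightarrow> d b = h * \<delta> b"
  shows "exp_der B d = restrict (lin_ext (translate h)) B"
proof (rule extensionalityI[where A = B])
  have d0: "d 0 = 0" using d linear_on_zero B_closed(1) by (auto simp: lnd_def)
  have dB: "(d ^^ i) b \<in> B" if "b \<in> B" for b i
    by (induction i) (use d that in \<open>auto simp: lnd_def\<close>)
  have iter: "(d ^^ i) b = ((\<lambda>b. h * \<delta> b) ^^ i) b" if "b \<in> B" for b i
  proof (induction i)
    case (Suc i)
    have "(d ^^ Suc i) b = h * \<delta> ((d ^^ i) b)" using eq[OF dB[OF that]] by simp
    also have "\<dots> = ((\<lambda>b. h * \<delta> b) ^^ Suc i) b" unfolding Suc by simp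
    finally show ?case .
  qed simp
  fix b assume b: "b \<in> B"
  have "exp_der B d b = lin_ext (translate h) b"
  proof (rule linear_on_eqI[OF _ linear_on_lin_ext])
    show "linear_on (semigroup_algebra S) (exp_der B d)"
      using exp_der_linear[OF d] by (simp add: B_def)
    show "b \<in> semigroup_algebra S" using b by (simp add: B_def)
    fix m assume m: "m \<in> S"
    obtain n where n: "pairing m v = int n" using v_nonneg[OF m] by (metis nonneg_int_cases)
    have cB: "chi m \<in> B" using m by simp
    have "(d ^^ Suc n) (chi m) = 0"
      unfolding iter[OF cB] by (rule multiple_nilpotent[OF h n])
    from exp_der_eq_sum[where d = d, OF cB d0 this]
    have "exp_der B d (chi m) = translate h m"
      unfolding iter[OF cB] exponential_series_translate[OF h n] .
    then show "exp_der B d (chi m) = lin_ext (translate h) (chi m)" by simp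
  qed
  then show "exp_der B d b = restrict (lin_ext (translate h)) B b" using b by simp
qed (auto simp: exp_der_def)

text \<open>
  A derivation that kills \<open>S0\<close> is proportional to \<open>\<delta>\<close>, say \<open>d = h \<delta>\<close> with a Laurent
  polynomial \<open>h\<close>, and only the height of \<open>h\<close> is in question.  It is not negative anywhere because
  \<open>h \<delta>\<close> maps a character of height 1 into \<open>B\<close>.  If \<open>h\<close> had a term of positive height, an
  extremal term of greatest height would give a component of \<open>d\<close> that never kills a character of
  height 1, since it does not lower the height; so \<open>d\<close> would not be locally nilpotent.
\<close>

lemma lnd_vanishing_on_kernel:
  assumes d: "lnd B d" and ker: "\<And>m. m \<in> S0 \<Longrightarrow> d (chi m) = 0"
  obtains h where "h \<in> KV0" "\<And>b. b \<in> B \<Longrightarrow> d b = h * \<delta> b"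
proof -
  have der: "derivation_on (semigroup_algebra S) d" using d by (simp add: lnd_iff B_def)
  have lin: "linear_on (semigroup_algebra S) d" using der by (simp add: derivation_on_def)
  obtain g where g_add: "\<And>x y. g (x + y) = g x + g y"
      and g: "\<And>m. m \<in> S \<Longrightarrow> d (chi m) = chi m * g m"
    using derivation_on_characters[OF differences add_mem der] by blast
  have g0: "g m = 0" if "m \<in> S0" for m
  proof -
    have "chi m * g m = chi m * 0" using g[OF S0_subset[OF that]] ker[OF that] by simp
    then show ?thesis unfolding chi_mult_cancel .
  qed
  have g_base: "g (base m) = 0" for m
  proof -
    obtain a b where "a \<in> S0" "b \<in> S0" "base m = a - b" using S0_differences pairing_base by blast
    then show ?thesis using g_add[of "base m" b] g0 by simp
  qed
  define \<kappa> where "\<kappa> = - g e"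
  have g_\<kappa>: "g m = const (of_int (pairing m v)) * \<kappa>" for m
    using g_base[of m] additive_smult[of g "pairing m v" e, OF g_add]
    by (simp add: base_def g_add \<kappa>_def single_of_int add_eq_0_iff2)
  obtain s where s: "s \<in> S" "pairing s v = 1" using ex_height_one by blast
  have lower: "- 1 \<le> pairing q v" if "q \<in> keys \<kappa>" for q
  proof -
    have "d (chi s) \<in> B" using d s by (auto simp: lnd_def)
    then have "chi s * \<kappa> \<in> B" by (simp add: g[OF s(1)] g_\<kappa> s(2))
    moreover have "lookup (chi s * \<kappa>) (s + q) \<noteq> 0" using that by (simp add: in_keys_iff)
    ultimately have "s + q \<in> S" unfolding B_def mem_semigroup_algebra_iff by blast
    then show ?thesis using v_nonneg[of "s + q"] s(2) by (simp add: pairing_left)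
  qed
  have upper: "pairing q v \<le> - 1" if q: "q \<in> keys \<kappa>" for q
  proof (rule ccontr)
    assume "\<not> pairing q v \<le> - 1"
    let ?K = "keys \<kappa>"
    let ?H = "\<lambda>q. pairing q v" and ?N = "\<lambda>q. pairing q q :: int"
    define p where "p = Max (?H ` ?K)"
    have p: "p \<in> ?H ` ?K" unfolding p_def using q by (intro Max_in) auto
    have p_max: "?H x \<le> p" if "x \<in> ?K" for x
      unfolding p_def using that by (intro Max_ge) auto
    have "0 \<le> p" using p_max[OF q] \<open>\<not> pairing q v \<le> - 1\<close> by simp
    let ?Kp = "{x \<in> ?K. ?H x = p}"
    have "Max (?N ` ?Kp) \<in> ?N ` ?Kp" using p by (intro Max_in) auto
    then obtain r where r: "r \<in> ?Kp" "?N r = Max (?N ` ?Kp)" by force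
    have r_max: "?N x \<le> ?N r" if "x \<in> ?Kp" for x
      unfolding r(2) using that by (intro Max_ge) auto
    \<comment> \<open>With weight \<open>N\<close> on the height, \<open>?l\<close> compares heights before it compares pairings with
      \<open>r\<close>, so \<open>r\<close> is its strict maximum.\<close>
    define N where "N = 1 + (\<Sum>x\<in>?K. \<bar>pairing x r\<bar>)"
    let ?l = "\<lambda>x. N * pairing x v + pairing x r"
    have top: "?l x < ?l r" if x: "x \<in> ?K" "x \<noteq> r" for x
    proof (cases "?H x = p")
      case True
      then have "pairing x r < pairing r r" using pairing_longest_strict[OF r_max] x by simp
      then show ?thesis using True r(1) by simp
    next
      case False
      then have "?H x \<le> p - 1" using p_max[OF x(1)] by simp
      have "\<bar>pairing x r\<bar> \<le> (\<Sum>x\<in>?K. \<bar>pairing x r\<bar>)"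
        using member_le_sum[of x ?K "\<lambda>x. \<bar>pairing x r\<bar>"] x by simp
      then have N: "pairing x r < N" "0 \<le> N" unfolding N_def by auto
      have "0 \<le> pairing r r" by (cases "r = 0") (use pairing_self_pos[of r] in auto)
      moreover have "N * ?H x \<le> N * (p - 1)"
        using \<open>?H x \<le> p - 1\<close> N(2) by (rule mult_left_mono)
      ultimately show ?thesis using N r(1) by (simp add: algebra_simps)
    qed
    have nz: "lookup ((d ^^ k) (chi s)) (s + int k *s r) \<noteq> 0" for k
    proof -
      have "lookup ((d ^^ k) (chi s)) (s + int k *s r)
         = (\<Prod>i<k. lookup (const (of_int (pairing (s + int i *s r) v)) * \<kappa>) r)"
      proof (rule leading_coefficient_iterate[where M = S and l = ?l])
        fix f :: "('n, 'k) laurent" assume f: "f \<in> semigroup_algebra S"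
        show "d f = lin_ext (\<lambda>m. chi m * (const (of_int (pairing m v)) * \<kappa>)) f"
          by (rule linear_on_eqI[OF lin linear_on_lin_ext _ f]) (simp add: g g_\<kappa>)
        show "d f \<in> semigroup_algebra S" using der f by (auto simp: derivation_on_def)
      next
        fix p q assume "q \<in> keys (const (of_int (pairing p v)) * \<kappa>)" "q \<noteq> r"
        then show "?l q < ?l r" using top[of q] by (auto simp: in_keys_iff)
      qed (auto simp: pairing_left algebra_simps s)
      moreover have "lookup (const (of_int (pairing (s + int i *s r) v)) * \<kappa>) r \<noteq> 0" for i
      proof -
        have "pairing (s + int i *s r) v = 1 + int i * p" using r(1) s(2) by (simp add: pairing_left)
        also have "\<dots> \<noteq> 0" using \<open>0 \<le> p\<close> by (smt (verit) mult_nonneg_nonneg of_nat_0_le_iff)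
        finally have "pairing (s + int i *s r) v \<noteq> 0" .
        then show ?thesis using r(1) by (simp add: in_keys_iff)
      qed
      ultimately show ?thesis by simp
    qed
    have "chi s \<in> B" using s by simp
    then obtain k where "(d ^^ k) (chi s) = 0" using d unfolding lnd_def by blast
    then show False using nz[of k] by simp
  qed
  define h where "h = chi (- e) * \<kappa>"
  have "h \<in> KV0" unfolding mem_semigroup_algebra_iff
  proof (intro allI impI)
    fix q assume "lookup h q \<noteq> 0"
    then have "q + e \<in> keys \<kappa>" by (simp add: h_def in_keys_iff)
    then have "pairing (q + e) v = - 1" using lower upper by (intro antisym)
    then show "q \<in> V0" by (simp add: pairing_left e_v)
  qed
  moreover have "d b = h * \<delta> b" if "b \<in> B" for b
  proof (rule linear_on_eqI[OF lin, where \<psi> = "\<lambda>b. h * \<delta> b"])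
    fix m assume m: "m \<in> S"
    have "h * \<delta> (chi m) = (chi (- e) * chi (m + e)) * (const (of_int (pairing m v)) * \<kappa>)"
      unfolding h_def \<delta>_chi const_mult_chi[of "of_int (pairing m v)" "m + e", symmetric]
      by (simp only: mult_ac)
    also have "chi (- e) * chi (m + e) = (chi m :: ('n, 'k) laurent)"
      by (simp add: mult_single)
    finally show "d (chi m) = h * \<delta> (chi m)" by (simp only: g[OF m] g_\<kappa>)
  next
    show "linear_on (semigroup_algebra S) (\<lambda>b. h * \<delta> b)"
      by (simp only: linear_on_def \<delta>_linear distrib_left mult.left_commute) simp
    show "b \<in> semigroup_algebra S" using that by (simp add: B_def)
  qed
  ultimately show ?thesis using that by blast
qed

end

section \<open>The unipotent part of the stabilizer\<close>

context demazure_lnd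
begin

lemma pairing_single_ker:
  assumes "single q c \<in> ker_on B \<delta>" "c \<noteq> 0"
  shows "q \<in> S0"
  using assms by (simp add: ker_\<delta> semigroup_algebra_def)

text \<open>
  Let \<open>s \<in> S\<close> have height 1.  Then \<open>\<phi> \<chi>\<^sup>s\<close> is an antiderivative of the monomial
  \<open>P = \<phi> (\<delta> \<chi>\<^sup>s)\<close>, hence of the form \<open>P (x + h)\<close> with \<open>\<delta> h = 0\<close>.  The relation
  \<open>\<chi>\<^sup>m (\<delta> \<chi>\<^sup>s)\<^sup>d = \<chi>\<^bsup>base m\<^esup> (\<chi>\<^sup>s)\<^sup>d\<close> in \<open>B\<close>, where
  \<open>d\<close> is the height of \<open>m\<close>, determines \<open>\<phi> \<chi>\<^sup>m\<close> because \<open>P\<close> is invertible as a Laurent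
  polynomial.
\<close>

lemma stabilizer_on_characters:
  assumes \<phi>: "\<phi> \<in> Aut_stab B \<delta>"
    and monomial: "\<And>m. m \<in> S0 \<Longrightarrow> \<exists>q c. c \<noteq> 0 \<and> \<phi> (chi m) = single q c"
  obtains h where "h \<in> KV0"
    "\<And>m. m \<in> S \<Longrightarrow> \<phi> (chi m) = \<phi> (chi (base m)) * (chi (- e) + h) ^ nat (pairing m v)"
proof -
  note A = Aut_stabD(1)[OF \<phi>]
  obtain s where s: "s \<in> S" "pairing s v = 1" using ex_height_one by blast
  have bs: "base s \<in> S0" "base s = s + e"
    using base_in_S0[OF s(1)] s(2) by (auto simp: base_def vec_eq_iff)
  obtain q c where qc: "c \<noteq> 0" "\<phi> (chi (base s)) = single q c"
    using monomial[OF bs(1)] by blast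
  have "single q c \<in> ker_on B \<delta>"
    using Aut_stab_ker[OF \<phi> chi_S0_in_ker[OF bs(1)]] qc(2) by simp
  then have q: "pairing q v = 0" using pairing_single_ker[OF _ qc(1)] by (simp add: S0_def)
  define P where "P = single q c"
  define w where "w = single (- q) (1 / c)"
  have wP: "w * P = 1" using qc(1) by (simp add: w_def P_def mult_single)
  have \<delta>w: "\<delta> w = 0" by (simp add: w_def \<delta>_single pairing_left q)
  define h where "h = w * \<phi> (chi s) - chi (- e)"
  have h_eq: "chi (- e) + h = w * \<phi> (chi s)" by (simp add: h_def)
  have "\<delta> (\<phi> (chi s)) = \<phi> (\<delta> (chi s))" using Aut_stabD(2)[OF \<phi>] s by simp
  also have "\<dots> = P" using qc(2) by (simp add: \<delta>_chi s(2) bs(2)[symmetric] P_def)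
  finally have "\<delta> (w * \<phi> (chi s)) = 1" by (simp add: \<delta>_mult \<delta>w wP)
  moreover have "\<delta> (chi (- e)) = 1" by (simp add: \<delta>_chi pairing_left e_v)
  moreover have "\<delta> (w * \<phi> (chi s)) = \<delta> (chi (- e)) + \<delta> h"
    using \<delta>_linear(1)[of "chi (- e)" h] unfolding h_eq .
  ultimately have h: "h \<in> KV0" by (simp add: \<delta>_eq_0_iff[symmetric])
  have \<phi>s: "\<phi> (chi s) = P * (chi (- e) + h)"
    unfolding h_eq using wP by (simp add: mult.assoc[symmetric] mult.commute[of P])
  have "\<phi> (chi m) = \<phi> (chi (base m)) * (chi (- e) + h) ^ nat (pairing m v)" if m: "m \<in> S" for m
  proof -
    let ?d = "nat (pairing m v)"
    have bm: "base m \<in> S" using base_in_S0[OF m] S0_subset by blast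
    have "m + of_nat ?d *s base s = base m + of_nat ?d *s s"
      using v_nonneg[OF m] s(2) by (simp add: base_def vec_eq_iff algebra_simps)
    then have "chi m * chi (base s) ^ ?d = (chi (base m) * chi s ^ ?d :: ('n, 'k) laurent)"
      by (simp only: chi_power chi_add[symmetric])
    then have "\<phi> (chi m * chi (base s) ^ ?d) = \<phi> (chi (base m) * chi s ^ ?d)" by simp
    moreover have "\<phi> (a * b ^ ?d) = \<phi> a * \<phi> b ^ ?d" if "a \<in> B" "b \<in> B" for a b
      using AutD(4)[OF A that(1) B_closed(6)[OF that(2)]] Aut_power[OF A that(2) B_closed(6)[OF that(2)]] by simp
    moreover have "chi m \<in> B" "chi (base s) \<in> B" "chi (base m) \<in> B" "chi s \<in> B"
      using m bm s bs(1) S0_subset by auto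
    ultimately have "\<phi> (chi m) * \<phi> (chi (base s)) ^ ?d = \<phi> (chi (base m)) * \<phi> (chi s) ^ ?d"
      by metis
    then have "\<phi> (chi m) * P ^ ?d = \<phi> (chi (base m)) * (P * (chi (- e) + h)) ^ ?d"
      unfolding \<phi>s qc(2) P_def .
    then have "w ^ ?d * (\<phi> (chi m) * P ^ ?d) = w ^ ?d * (\<phi> (chi (base m)) * (P * (chi (- e) + h)) ^ ?d)"
      by simp
    then have "(w * P) ^ ?d * \<phi> (chi m) = (w * P) ^ ?d * (\<phi> (chi (base m)) * (chi (- e) + h) ^ ?d)"
      by (simp only: power_mult_distrib mult_ac)
    then show ?thesis unfolding wP by simp
  qed
  then show ?thesis using that h by blast
qed

text \<open>
  The part of \<open>translate h m\<close> whose height is one less than that of \<open>m\<close> is \<open>h \<delta> \<chi>\<^sup>m\<close>, and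
  \<open>B\<close> contains every term of each of its elements.
\<close>

lemma admissible_if_translation:
  assumes h: "h \<in> KV0" and B: "\<And>m. m \<in> S \<Longrightarrow> translate h m \<in> B"
  shows "admissible h"
proof -
  have *: "h * \<delta> (chi m) \<in> semigroup_algebra S" if m: "m \<in> S" for m
    unfolding mem_semigroup_algebra_iff
  proof (intro allI impI)
    fix p assume p: "lookup (h * \<delta> (chi m)) p \<noteq> 0"
    obtain R where R: "R \<in> low (pairing m v - 2)" "translate h m = chi m + h * \<delta> (chi m) + R"
      using translate_expansion[OF h v_nonneg[OF m]] .
    have "p \<in> keys (h * \<delta> (chi m))" using p by (simp add: in_keys_iff)
    then obtain a b where ab: "p = a + b" "a \<in> keys h" "b \<in> keys (\<delta> (chi m))"
      using keys_mult[of h "\<delta> (chi m)"] by blast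
    then have "pairing a v = 0" "b = m + e"
      using h by (auto simp: semigroup_algebra_def \<delta>_chi split: if_splits)
    then have pv: "pairing p v = pairing m v - 1" using ab(1) by (simp add: pairing_left e_v)
    then have "lookup (chi m :: ('n, 'k) laurent) p = 0" by (auto simp: lookup_single when_def)
    moreover have "lookup R p = 0" using R(1) pv by (auto simp: mem_semigroup_algebra_iff)
    ultimately have "lookup (translate h m) p \<noteq> 0"
      unfolding R(2) lookup_add using p by simp
    then show "p \<in> S" using B[OF m] unfolding B_def mem_semigroup_algebra_iff by blast
  qed
  have lin: "linear_on (semigroup_algebra S) (\<lambda>b. h * \<delta> b)"
    by (simp only: linear_on_def \<delta>_linear distrib_left mult.left_commute) simp
  have "h * \<delta> b \<in> B" if "b \<in> B" for b
  proof -
    have b: "b \<in> semigroup_algebra S" using that by (simp add: B_def)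
    have eq: "h * \<delta> b = lin_ext (\<lambda>m. h * \<delta> (chi m)) b"
      by (rule linear_on_eq_lin_ext[OF lin b])
    show ?thesis unfolding eq unfolding B_def by (rule lin_ext_in_semigroup_algebra[OF b *])
  qed
  then show ?thesis using h by (simp add: admissible_def)
qed

text \<open>
  Both sides consist of the substitutions \<open>x \<mapsto> x + h\<close> with \<open>h\<close> admissible: the left one because
  the derivations equivalent to \<open>\<delta>\<close> are the multiples \<open>h \<delta>\<close>, the right one by
  \<open>stabilizer_on_characters\<close>.  That \<open>\<U>(\<delta>)\<close> is a normal subgroup of the stabilizer is then
  immediate, as the stabilizer maps the kernel of \<open>\<delta>\<close> to itself.
\<close>

lemma U_group_eq_kernel_fixing: "U_group B \<delta> = kernel_fixing"
proof
  show "U_group B \<delta> \<subseteq> kernel_fixing"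
  proof
    fix u assume "u \<in> U_group B \<delta>"
    then obtain d where u: "u = exp_der B d" and d: "lnd B d"
        and ker: "ker_on B d = ker_on B \<delta> \<or> \<not> nonzero_on B d"
      by (auto simp: U_group_def)
    have "d (chi m) = 0" if "m \<in> S0" for m
    proof -
      have "chi m \<in> ker_on B \<delta>" using that by (rule chi_S0_in_ker)
      then show ?thesis using ker unfolding ker_on_def nonzero_on_def by blast
    qed
    then obtain h where h: "h \<in> KV0" "\<And>b. b \<in> B \<Longrightarrow> d b = h * \<delta> b"
      using lnd_vanishing_on_kernel[OF d] by blast
    have "admissible h" using h d by (auto simp: admissible_def lnd_def)
    moreover have "u = restrict (lin_ext (translate h)) B"
      unfolding u by (rule exp_der_multiple[OF h(1) d]) (rule h(2))
    ultimately show "u \<in> kernel_fixing" using translation_kernel_fixing by simp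
  qed
  show "kernel_fixing \<subseteq> U_group B \<delta>"
  proof
    fix u assume u: "u \<in> kernel_fixing"
    then have stab: "u \<in> Aut_stab B \<delta>" and fixes0: "\<And>m. m \<in> S0 \<Longrightarrow> u (chi m) = chi m"
      by (auto simp: kernel_fixing_def)
    note A = Aut_stabD(1)[OF stab]
    have "\<exists>q c. c \<noteq> 0 \<and> u (chi m) = single q c" if "m \<in> S0" for m
      unfolding fixes0[OF that] by (intro exI[of _ m] exI[of _ 1]) simp
    then obtain h where h: "h \<in> KV0"
      and "\<And>m. m \<in> S \<Longrightarrow> u (chi m) = u (chi (base m)) * (chi (- e) + h) ^ nat (pairing m v)"
      using stabilizer_on_characters[OF stab] by blast
    then have uh: "u (chi m) = translate h m" if "m \<in> S" for m
      using that fixes0[OF base_in_S0[OF that]] by (simp add: translate_def)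
    have "translate h m \<in> B" if "m \<in> S" for m
      using uh[OF that] AutD(5)[OF A, of "chi m"] that by simp
    then have adm: "admissible h" by (rule admissible_if_translation[OF h])
    note lnd = multiple_lnd[OF adm]
    have "u = restrict (lin_ext (translate h)) B"
    proof (rule Aut_eqI[OF A])
      show "restrict (lin_ext (translate h)) B \<in> Aut B"
        using translation_kernel_fixing[OF adm] Aut_stabD(1) by (simp add: kernel_fixing_def)
      show "u (chi m) = restrict (lin_ext (translate h)) B (chi m)" if "m \<in> S" for m
        using that uh by simp
    qed
    also have "\<dots> = exp_der B (\<lambda>b. h * \<delta> b)"
      by (rule exp_der_multiple[OF h lnd, symmetric]) simp
    finally have "u = exp_der B (\<lambda>b. h * \<delta> b)" .
    moreover have "ker_on B (\<lambda>b. h * \<delta> b) = ker_on B \<delta> \<or> \<not> nonzero_on B (\<lambda>b. h * \<delta> b)"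
      by (cases "h = 0") (simp_all add: nonzero_on_def multiple_kernel)
    ultimately show "u \<in> U_group B \<delta>" using lnd unfolding U_group_def by blast
  qed
qed

lemma kernel_fixingD:
  assumes "u \<in> kernel_fixing" "a \<in> ker_on B \<delta>"
  shows "u a = a"
proof -
  have "u \<in> Aut B" using assms(1) Aut_stabD(1) by (simp add: kernel_fixing_def)
  then have lin: "linear_on B u" by (rule AutD(2))
  have sub: "semigroup_algebra S0 \<subseteq> B" using S0_subset by (auto simp: B_def semigroup_algebra_def)
  show ?thesis
  proof (rule linear_on_eqI[where S = S0 and \<phi> = u and \<psi> = "\<lambda>a. a"])
    show "linear_on (semigroup_algebra S0) u" using lin sub unfolding linear_on_def by blast
  qed (use assms in \<open>auto simp: kernel_fixing_def linear_on_def ker_\<delta>\<close>)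
qed

lemma kernel_fixing_subgroup: "subgroup kernel_fixing (BijGroup B)"
proof (rule Bij_subgroupI)
  show "kernel_fixing \<subseteq> Bij B"
    using AutD(1) Aut_stabD(1) by (auto simp: kernel_fixing_def)
  show "(\<lambda>x\<in>B. x) \<in> kernel_fixing"
    using subgroup.one_closed[OF Aut_stab_subgroup] S0_subset by (simp add: kernel_fixing_def BijGroup_one)
  show "compose B f g \<in> kernel_fixing" if fg: "f \<in> kernel_fixing" "g \<in> kernel_fixing" for f g
  proof -
    have st: "f \<in> Aut_stab B \<delta>" "g \<in> Aut_stab B \<delta>" using fg by (auto simp: kernel_fixing_def)
    then have "compose B f g \<in> Aut_stab B \<delta>"
      using Aut_stab_mult BijGroup_mult AutD(1) Aut_stabD(1) by metis
    then show ?thesis using fg S0_subset by (simp add: kernel_fixing_def compose_eq)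
  qed
  show "inv\<^bsub>BijGroup B\<^esub> f \<in> kernel_fixing" if f: "f \<in> kernel_fixing" for f
  proof -
    have st: "f \<in> Aut_stab B \<delta>" using f by (auto simp: kernel_fixing_def)
    have "(inv\<^bsub>BijGroup B\<^esub> f) (chi m) = chi m" if m: "m \<in> S0" for m
      using Bij_inverse(3)[OF AutD(1)[OF Aut_stabD(1)[OF st]], of "chi m"] f m S0_subset[OF m]
      by (simp add: kernel_fixing_def)
    then show ?thesis
      using Aut_stab_inv[OF st] by (simp add: kernel_fixing_def)
  qed
qed

lemma BijGroup_apply:
  assumes "f \<in> Aut B" "g \<in> Aut B" "b \<in> B"
  shows "(f \<otimes>\<^bsub>BijGroup B\<^esub> g) b = f (g b)"
  using BijGroup_mult[OF AutD(1)[OF assms(1)] AutD(1)[OF assms(2)]] assms(3) by (simp add: compose_eq)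

lemma kernel_fixing_conjugate:
  assumes k: "k \<in> Aut_stab B \<delta>" and n: "n \<in> kernel_fixing"
  shows "k \<otimes>\<^bsub>BijGroup B\<^esub> n \<otimes>\<^bsub>BijGroup B\<^esub> inv\<^bsub>BijGroup B\<^esub> k \<in> kernel_fixing"
proof -
  let ?G = "BijGroup B"
  have n': "n \<in> Aut_stab B \<delta>" using n by (simp add: kernel_fixing_def)
  have i: "inv\<^bsub>?G\<^esub> k \<in> Aut_stab B \<delta>" by (rule Aut_stab_inv[OF k])
  have kn: "k \<otimes>\<^bsub>?G\<^esub> n \<in> Aut_stab B \<delta>" by (rule Aut_stab_mult[OF k n'])
  note A = Aut_stabD(1)[OF k] Aut_stabD(1)[OF n'] Aut_stabD(1)[OF i] Aut_stabD(1)[OF kn]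
  have "(k \<otimes>\<^bsub>?G\<^esub> n \<otimes>\<^bsub>?G\<^esub> inv\<^bsub>?G\<^esub> k) (chi m) = chi m" if m: "m \<in> S0" for m
  proof -
    have mB: "chi m \<in> B" using S0_subset[OF m] by simp
    let ?a = "(inv\<^bsub>?G\<^esub> k) (chi m)"
    have a: "?a \<in> ker_on B \<delta>" by (rule Aut_stab_ker[OF i chi_S0_in_ker[OF m]])
    then have aB: "?a \<in> B" by (simp add: ker_on_def)
    have "(k \<otimes>\<^bsub>?G\<^esub> n \<otimes>\<^bsub>?G\<^esub> inv\<^bsub>?G\<^esub> k) (chi m) = k (n ?a)"
      by (simp only: BijGroup_apply[OF A(4,3) mB] BijGroup_apply[OF A(1,2) aB])
    also have "\<dots> = chi m"
      using kernel_fixingD[OF n a] Bij_inverse(2)[OF AutD(1)[OF A(1)] mB] by simp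
    finally show ?thesis .
  qed
  then show ?thesis
    using Aut_stab_mult[OF kn i] by (simp add: kernel_fixing_def)
qed

section \<open>The homogeneous part of the stabilizer\<close>

text \<open>
  For \<open>\<phi>\<close> in the stabilizer this is the part of \<open>\<phi> \<chi>\<^sup>m\<close> of greatest height.
\<close>

definition leading :: "(('n, 'k) laurent \<Rightarrow> ('n, 'k) laurent) \<Rightarrow> int ^ 'n \<Rightarrow> ('n, 'k) laurent"
  where "leading \<phi> m = \<phi> (chi (base m)) * chi (- (pairing m v *s e))"

definition monomial_on_kernel :: "(('n, 'k) laurent \<Rightarrow> ('n, 'k) laurent) \<Rightarrow> bool"
  where "monomial_on_kernel \<phi> \<longleftrightarrow>
    (\<forall>m\<in>S0. \<exists>q c. c \<noteq> 0 \<and> \<phi> (chi m) = single q c)"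

lemma leadingE:
  assumes \<phi>: "\<phi> \<in> Aut_stab B \<delta>" "monomial_on_kernel \<phi>" and m: "m \<in> S"
  obtains q c where "q \<in> S0" "c \<noteq> 0" "\<phi> (chi (base m)) = single q c"
    "leading \<phi> m = single (q - pairing m v *s e) c"
proof -
  obtain q c where qc: "c \<noteq> 0" "\<phi> (chi (base m)) = single q c"
    using \<phi>(2) base_in_S0[OF m] unfolding monomial_on_kernel_def by blast
  moreover have "q \<in> S0"
    using Aut_stab_ker[OF \<phi>(1) chi_S0_in_ker[OF base_in_S0[OF m]]] pairing_single_ker qc by metis
  moreover have "leading \<phi> m = single (q - pairing m v *s e) c"
    by (simp add: leading_def qc(2) mult_single)
  ultimately show ?thesis using that by blast
qed

text \<open>
  The monomial \<open>leading \<phi> m\<close> is a term of \<open>\<phi> \<chi>\<^sup>m \<in> B\<close>: all the other terms have smaller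
  height.
\<close>

lemma leading_in_B:
  assumes \<phi>: "\<phi> \<in> Aut_stab B \<delta>" "monomial_on_kernel \<phi>" and m: "m \<in> S"
  shows "leading \<phi> m \<in> B"
proof -
  obtain q c where qc: "q \<in> S0" "c \<noteq> 0" "\<phi> (chi (base m)) = single q c"
    "leading \<phi> m = single (q - pairing m v *s e) c"
    using leadingE[OF assms] .
  obtain h where h: "h \<in> KV0"
    and \<phi>h: "\<phi> (chi m) = \<phi> (chi (base m)) * (chi (- e) + h) ^ nat (pairing m v)"
    using stabilizer_on_characters[OF \<phi>(1)] \<phi>(2) m unfolding monomial_on_kernel_def by metis
  let ?d = "nat (pairing m v)" and ?P = "single q c"
  let ?p = "q - pairing m v *s e"
  have d: "int ?d = pairing m v" using v_nonneg[OF m] by simp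
  obtain R where R: "R \<in> low (int ?d - 2)" "(chi (- e) + h) ^ ?d
    = chi (- int ?d *s e) + const (of_nat ?d) * (h * chi ((1 - int ?d) *s e)) + R"
    using translated_power_expansion[OF h] by blast
  let ?Q = "const (of_nat ?d) * (h * chi ((1 - int ?d) *s e)) + R"
  have "R \<in> low (pairing m v - 1)" by (rule low_mono[OF R(1)]) (simp only: d)
  moreover have "h * chi ((1 - int ?d) *s e) \<in> low (0 + (pairing m v - 1))"
    by (intro low_mult V0_low[OF h]) (simp add: pairing_left e_v v_nonneg[OF m])
  ultimately have "?Q \<in> low (pairing m v - 1)"
    by (intro semigroup_algebra_add semigroup_algebra_const_mult) simp_all
  moreover have "?P \<in> low 0" using qc(1) by (simp add: semigroup_algebra_def S0_def)
  ultimately have "?P * ?Q \<in> low (0 + (pairing m v - 1))" by (intro low_mult)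
  moreover have pv: "pairing ?p v = pairing m v" using qc(1) by (simp add: pairing_left e_v S0_def)
  ultimately have "lookup (?P * ?Q) ?p = 0"
    by (auto simp: mem_semigroup_algebra_iff)
  moreover have "\<phi> (chi m) = leading \<phi> m + ?P * ?Q"
  proof -
    have "- int ?d *s e = - (pairing m v *s e)" unfolding d by (simp add: vec_eq_iff)
    then show ?thesis
      unfolding \<phi>h R(2) qc(3) leading_def by (simp only: distrib_left add.assoc)
  qed
  ultimately have "lookup (\<phi> (chi m)) ?p \<noteq> 0"
    using qc(2) by (simp add: qc(4) lookup_add)
  moreover have "\<phi> (chi m) \<in> B" using AutD(5)[OF Aut_stabD(1)[OF \<phi>(1)]] m by simp
  ultimately have "?p \<in> S" unfolding B_def mem_semigroup_algebra_iff by blast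
  then show ?thesis by (simp add: qc(4) B_closed)
qed

lemma leading_add:
  assumes "\<phi> \<in> Aut B" "a \<in> S" "b \<in> S"
  shows "leading \<phi> (a + b) = leading \<phi> a * leading \<phi> b"
proof -
  have "base a \<in> S" "base b \<in> S" using assms base_in_S0 S0_subset by blast+
  then have "\<phi> (chi (base (a + b))) = \<phi> (chi (base a)) * \<phi> (chi (base b))"
    unfolding base_add by (rule AutD_chi_add[OF assms(1)])
  moreover have "- (pairing (a + b) v *s e) = - (pairing a v *s e) + - (pairing b v *s e)"
    by (simp add: pairing_left vec_eq_iff algebra_simps)
  ultimately show ?thesis unfolding leading_def by (simp only: chi_add mult_ac)
qed

lemma leading_inverse:
  assumes \<phi>: "\<phi> \<in> Aut_stab B \<delta>" and \<psi>: "\<psi> \<in> Aut_stab B \<delta>" "monomial_on_kernel \<psi>"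
    and inv: "\<And>b. b \<in> B \<Longrightarrow> \<phi> (\<psi> b) = b" and m: "m \<in> S"
  shows "lin_ext (leading \<phi>) (leading \<psi> m) = chi m"
proof -
  obtain q c where qc: "q \<in> S0" "c \<noteq> 0" "\<psi> (chi (base m)) = single q c"
    "leading \<psi> m = single (q - pairing m v *s e) c"
    using leadingE[OF \<psi> m] .
  let ?p = "q - pairing m v *s e"
  have pv: "pairing ?p v = pairing m v" using qc(1) by (simp add: pairing_left e_v S0_def)
  then have bp: "base ?p = q" by (simp add: base_def vec_eq_iff)
  have "lin_ext (leading \<phi>) (leading \<psi> m) = const c * leading \<phi> ?p"
    by (simp only: qc(4) lin_ext_single)
  also have "\<dots> = const c * \<phi> (chi q) * chi (- (pairing m v *s e))"
    by (simp only: leading_def pv bp mult.assoc)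
  also have "const c * \<phi> (chi q) = chi (base m)"
    using AutD_single[OF Aut_stabD(1)[OF \<phi>] S0_subset[OF qc(1)], of c] inv[of "chi (base m)"]
      base_in_S0[OF m] S0_subset by (simp add: qc(3))
  also have "chi (base m) * chi (- (pairing m v *s e)) = (chi m :: ('n, 'k) laurent)"
    by (simp add: mult_single base_def)
  finally show ?thesis .
qed

lemma leading_homogeneous_stab:
  assumes \<phi>: "\<phi> \<in> Aut_stab B \<delta>" "monomial_on_kernel \<phi>"
    and \<psi>: "\<psi> \<in> Aut_stab B \<delta>" "monomial_on_kernel \<psi>"
    and inv: "\<And>b. b \<in> B \<Longrightarrow> \<phi> (\<psi> b) = b" "\<And>b. b \<in> B \<Longrightarrow> \<psi> (\<phi> b) = b"
  shows "restrict (lin_ext (leading \<phi>)) B \<in> homogeneous_stab"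
proof -
  note A = Aut_stabD(1)[OF \<phi>(1)]
  have Aut: "restrict (lin_ext (leading \<phi>)) B \<in> Aut B" unfolding B_def
  proof (rule Aut_of_multiplicative[where k = "leading \<psi>"])
    show "leading \<phi> 0 = 1" using AutD(3)[OF A] by (simp add: leading_def)
    fix m assume m: "m \<in> S"
    show "leading \<phi> m \<in> semigroup_algebra S" "leading \<psi> m \<in> semigroup_algebra S"
      using leading_in_B[OF \<phi> m] leading_in_B[OF \<psi> m] by (simp_all add: B_def)
    show "lin_ext (leading \<phi>) (leading \<psi> m) = chi m" "lin_ext (leading \<psi>) (leading \<phi> m) = chi m"
      using leading_inverse[OF \<phi>(1) \<psi> inv(1) m] leading_inverse[OF \<psi>(1) \<phi> inv(2) m] by auto
  qed (use zero_mem add_mem leading_add[OF A] in auto)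
  have "lin_ext (leading \<phi>) (\<delta> b) = \<delta> (lin_ext (leading \<phi>) b)" if "b \<in> B" for b
  proof (rule lin_ext_commute_\<delta>[OF _ that])
    fix m assume m: "m \<in> S"
    obtain q c where qc: "q \<in> S0" "c \<noteq> 0" "\<phi> (chi (base m)) = single q c"
      "leading \<phi> m = single (q - pairing m v *s e) c"
      using leadingE[OF \<phi> m] .
    have "- (pairing (m + e) v *s e) = e - pairing m v *s e"
      by (simp add: pairing_left e_v vec_eq_iff algebra_simps)
    then have "leading \<phi> (m + e) = single (q + (e - pairing m v *s e)) c"
      by (simp add: leading_def base_shift qc(3) mult_single)
    then show "lin_ext (leading \<phi>) (\<delta> (chi m)) = \<delta> (lin_ext (leading \<phi>) (chi m))"
      using qc(1) by (simp add: \<delta>_chi qc(4) \<delta>_single mult_single pairing_left e_v S0_def algebra_simps)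
  qed
  then have "restrict (lin_ext (leading \<phi>)) B \<in> Aut_stab B \<delta>"
    using Aut by (simp add: Aut_stab_def commute_on_def \<delta>_in_B)
  moreover have "homogeneous_map B (restrict (lin_ext (leading \<phi>)) B)"
  proof (rule homogeneous_mapI[OF Aut])
    fix m assume m: "m \<in> S"
    then show "homogeneous (restrict (lin_ext (leading \<phi>)) B (chi m))"
      using leadingE[OF \<phi> m] by (simp add: homogeneous_def) metis
  qed
  ultimately show ?thesis by (simp add: homogeneous_stab_def)
qed

text \<open>
  The vector field of the one-parameter subgroup \<open>u\<close> of the torus.
\<close>

definition euler :: "int ^ 'n \<Rightarrow> ('n, 'k) laurent \<Rightarrow> ('n, 'k) laurent"
  where "euler u = lin_ext (\<lambda>m. single m (of_int (pairing m u)))"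

lemma lookup_euler: "lookup (euler u f) p = of_int (pairing p u) * lookup f p"
  using mem_UNIV_algebra[of f]
  by (induction rule: semigroup_algebra_induct)
     (auto simp: euler_def mult_single lookup_single when_def lin_ext_add lookup_add algebra_simps)

lemma keys_euler: "keys ((euler u ^^ k) f) \<subseteq> keys f"
  by (induction k) (auto simp: in_keys_iff lookup_euler)

lemma euler_linear: "euler u (f + g) = euler u f + euler u g" "euler u (const c * f) = const c * euler u f"
  by (simp_all add: euler_def lin_ext_add lin_ext_const_mult)

lemma euler_mult: "euler u (f * g) = euler u f * g + f * euler u g"
  unfolding euler_def
  by (rule lin_ext_Leibniz[where S = UNIV])
     (auto simp: mem_UNIV_algebra mult_single single_add[symmetric] pairing_left algebra_simps)

lemma euler_in_B: "f \<in> B \<Longrightarrow> euler u f \<in> B"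
  by (auto simp: B_def mem_semigroup_algebra_iff lookup_euler)

lemma euler_\<delta>: "pairing e u = 0 \<Longrightarrow> euler u (\<delta> f) = \<delta> (euler u f)"
  by (rule poly_mapping_eqI) (simp add: lookup_euler lookup_\<delta> pairing_left)

end

context maximal_demazure_lnd
begin

text \<open>
  Let \<open>u\<close> be orthogonal to \<open>e\<close>, so that the vector field of \<open>u\<close> commutes with \<open>\<delta>\<close>.  Its
  conjugate by \<open>\<phi>\<close> is locally finite and commutes with \<open>\<delta>\<close>, so it acts on \<open>\<chi>\<^sup>m\<close> by a scalar;
  that is, \<open>\<phi> \<chi>\<^sup>m\<close> is an eigenvector of the vector field, and \<open>\<langle>p, u\<rangle>\<close> is the same for all of
  its exponents \<open>p\<close>.  As these are also orthogonal to \<open>v\<close>, and \<open>v\<close> is not orthogonal to \<open>e\<close>, there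
  is only one.
\<close>

lemma stabilizer_monomial_on_kernel:
  assumes \<phi>: "\<phi> \<in> Aut_stab B \<delta>"
  shows "monomial_on_kernel \<phi>"
  unfolding monomial_on_kernel_def
proof
  fix m assume m: "m \<in> S0"
  note A = Aut_stabD(1)[OF \<phi>]
  let ?i = "inv\<^bsub>BijGroup B\<^esub> \<phi>"
  have i: "?i \<in> Aut_stab B \<delta>" by (rule Aut_stab_inv[OF \<phi>])
  note iA = Aut_stabD(1)[OF i]
  note inv = Bij_inverse[OF AutD(1)[OF A]]
  have mB: "chi m \<in> B" using S0_subset[OF m] by simp
  let ?F = "\<phi> (chi m)"
  have FB: "?F \<in> B" by (rule AutD(5)[OF A mB])
  have eigen: "\<exists>c. \<forall>p\<in>keys ?F. of_int (pairing p u) = (c :: 'k)"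
    if u: "pairing e u = 0" for u
  proof -
    define D where "D b = ?i (euler u (\<phi> b))" for b
    have DB: "D b \<in> B" if "b \<in> B" for b
      unfolding D_def by (intro AutD(5)[OF iA] euler_in_B AutD(5)[OF A] that)
    have in_B: "euler u (\<phi> b) \<in> B" "\<phi> b \<in> B" if "b \<in> B" for b
      using euler_in_B AutD(5)[OF A] that by blast+
    have "derivation_on B D" unfolding derivation_on_def linear_on_def
    proof (intro conjI ballI allI)
      show "D ` B \<subseteq> B" using DB by blast
      fix a b c assume a: "a \<in> B" and b: "b \<in> B"
      show "D (a + b) = D a + D b"
        unfolding D_def by (simp add: AutD_add[OF A] AutD_add[OF iA] euler_linear in_B a b)
      show "D (a * b) = D a * b + a * D b"
        unfolding D_def
        by (simp add: AutD(4)[OF A] AutD(4)[OF iA] AutD_add[OF iA] euler_mult in_B a b B_closed(5) inv(3))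
    next
      fix a c assume a: "a \<in> B"
      show "D (const c * a) = const c * D a"
        unfolding D_def by (simp add: AutD_const[OF A] AutD_const[OF iA] euler_linear in_B a)
    qed
    moreover have "commute_on B D \<delta>" unfolding commute_on_def D_def
      by (simp add: Aut_stabD(2)[OF \<phi>] Aut_stabD(2)[OF i] euler_\<delta>[OF u] in_B)
    moreover have "\<exists>K. finite K \<and> (\<forall>k. keys ((D ^^ k) (chi m')) \<subseteq> K)" if m': "m' \<in> S" for m'
    proof -
      have cB: "chi m' \<in> B" using m' by simp
      have euler_B: "(euler u ^^ k) (\<phi> (chi m')) \<in> B" for k
        by (induction k) (simp_all add: in_B(2)[OF cB] euler_in_B)
      have iter: "(D ^^ k) (chi m') = ?i ((euler u ^^ k) (\<phi> (chi m')))" for k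
      proof (induction k)
        case 0
        show ?case using inv(3)[OF cB] by simp
      next
        case (Suc k)
        then show ?case using inv(2)[OF euler_B[of k]] by (simp add: D_def)
      qed
      have "linear_on (semigroup_algebra S) ?i" using AutD(2)[OF iA] by (simp add: B_def)
      then have "keys ((D ^^ k) (chi m'))
          \<subseteq> (\<Union>p\<in>keys (\<phi> (chi m')). keys (?i (chi p)))" for k
        unfolding iter by (rule keys_linear_image) (use euler_B keys_euler in \<open>auto simp: B_def\<close>)
      then show ?thesis
        by (intro exI[of _ "\<Union>p\<in>keys (\<phi> (chi m')). keys (?i (chi p))"]) auto
    qed
    ultimately obtain c where "D (chi m) = single m c"
      using locally_finite_commuting_diagonal m by blast
    then have "\<phi> (D (chi m)) = const c * ?F"
      using AutD_single[OF A S0_subset[OF m], of c] by simp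
    then have "euler u ?F = const c * ?F"
      unfolding D_def using inv(2)[OF in_B(1)[OF mB]] by simp
    then have "of_int (pairing p u) * lookup ?F p = c * lookup ?F p" for p
      by (metis lookup_euler lookup_const_mult)
    then show ?thesis by (intro exI[of _ c]) (auto simp: in_keys_iff)
  qed
  have uniq: "p = q" if p: "p \<in> keys ?F" and q: "q \<in> keys ?F" for p q
  proof (rule ccontr)
    assume "p \<noteq> q"
    define w where "w = p - q"
    have "?F \<in> semigroup_algebra S0"
      using Aut_stab_ker[OF \<phi> chi_S0_in_ker[OF m]] by (simp add: ker_\<delta>)
    then have "p \<in> S0" "q \<in> S0" using p q by (auto simp: semigroup_algebra_def)
    then have wv: "pairing w v = 0" by (simp add: w_def pairing_left S0_def)
    \<comment> \<open>The projection of \<open>w\<close> along \<open>v\<close> to the vectors orthogonal to \<open>e\<close>; it pairs with \<open>w\<close> to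
      the squared length of \<open>w\<close>.\<close>
    define u where "u = w + pairing e w *s v"
    have "pairing e u = 0" by (simp add: u_def pairing_add_right pairing_smult_right e_v)
    then have "(of_int (pairing p u) :: 'k) = of_int (pairing q u)" using eigen p q by metis
    then have "pairing w u = 0" by (simp add: w_def pairing_left)
    then have "pairing w w = 0" by (simp add: u_def pairing_add_right pairing_smult_right wv)
    then show False using pairing_self_pos[of w] \<open>p \<noteq> q\<close> by (simp add: w_def)
  qed
  have "?F \<noteq> 0" by (rule Aut_chi_neq_0[OF A S0_subset[OF m]])
  then obtain q where q: "q \<in> keys ?F" using keys_eq_empty by blast
  then have "?F = single q (lookup ?F q)"
    using uniq by (intro poly_mapping_eqI) (auto simp: lookup_single when_def in_keys_iff)
  then show "\<exists>q c. c \<noteq> 0 \<and> ?F = single q c"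
    using q by (auto simp: in_keys_iff)
qed

lemma stabilizer_decomposition:
  assumes \<phi>: "\<phi> \<in> Aut_stab B \<delta>"
  shows "\<exists>\<psi>\<in>homogeneous_stab. \<exists>u\<in>kernel_fixing. \<phi> = \<psi> \<otimes>\<^bsub>BijGroup B\<^esub> u"
proof -
  let ?G = "BijGroup B" and ?i = "inv\<^bsub>BijGroup B\<^esub> \<phi>"
  interpret G: group ?G by (rule group_BijGroup)
  note A = Aut_stabD(1)[OF \<phi>]
  have i: "?i \<in> Aut_stab B \<delta>" by (rule Aut_stab_inv[OF \<phi>])
  note inv = Bij_inverse[OF AutD(1)[OF A]]
  define \<psi> where "\<psi> = restrict (lin_ext (leading \<phi>)) B"
  have \<psi>: "\<psi> \<in> homogeneous_stab" unfolding \<psi>_def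
    by (rule leading_homogeneous_stab[OF \<phi> stabilizer_monomial_on_kernel[OF \<phi>] i
          stabilizer_monomial_on_kernel[OF i] inv(2,3)])
  note \<psi>s = homogeneous_stabD(1)[OF \<psi>]
  have \<psi>i: "inv\<^bsub>?G\<^esub> \<psi> \<in> Aut_stab B \<delta>" by (rule Aut_stab_inv[OF \<psi>s])
  let ?u = "inv\<^bsub>?G\<^esub> \<psi> \<otimes>\<^bsub>?G\<^esub> \<phi>"
  have "?u (chi m) = chi m" if m: "m \<in> S0" for m
  proof -
    have mB: "chi m \<in> B" using S0_subset[OF m] by simp
    have "leading \<phi> m = \<phi> (chi m)"
      using m base_S0[OF m] by (simp add: leading_def S0_def)
    then have "\<psi> (chi m) = \<phi> (chi m)" using mB by (simp add: \<psi>_def)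
    then show ?thesis
      using BijGroup_apply[OF Aut_stabD(1)[OF \<psi>i] A mB]
        Bij_inverse(3)[OF AutD(1)[OF Aut_stabD(1)[OF \<psi>s]] mB] by simp
  qed
  then have "?u \<in> kernel_fixing"
    using Aut_stab_mult[OF \<psi>i \<phi>] by (simp add: kernel_fixing_def)
  moreover have "\<phi> = \<psi> \<otimes>\<^bsub>?G\<^esub> ?u"
    using AutD(1)[OF A] AutD(1)[OF Aut_stabD(1)[OF \<psi>s]]
    by (simp add: carrier_BijGroup[symmetric] G.m_assoc[symmetric])
  ultimately show ?thesis using \<psi> by blast
qed

theorem stabilizer_semidirect:
  "semidirect (sub_aut B (Aut_stab B \<delta>)) homogeneous_stab (U_group B \<delta>)"
  unfolding sub_aut_def U_group_eq_kernel_fixing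
proof (rule semidirectI[OF group_BijGroup Aut_stab_subgroup homogeneous_stab_subgroup kernel_fixing_subgroup])
  show "homogeneous_stab \<inter> kernel_fixing \<subseteq> {\<one>\<^bsub>BijGroup B\<^esub>}"
    using homogeneous_stab_fixing_kernel by (auto simp: kernel_fixing_def BijGroup_one)
qed (use homogeneous_stabD(1) kernel_fixing_conjugate stabilizer_decomposition in
      \<open>auto simp: kernel_fixing_def\<close>)

end

section \<open>The torus as a group of diagonal automorphisms\<close>

lemma torus_pow_nonzero: "t \<in> torus \<Longrightarrow> torus_pow t m \<noteq> 0"
  by (simp add: torus_def torus_pow_def)

lemma torus_pow_add: "t \<in> torus \<Longrightarrow> torus_pow t (a + b) = torus_pow t a * torus_pow t b"
  by (simp add: torus_def torus_pow_def power_int_add prod.distrib)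

lemma torus_pow_zero [simp]: "torus_pow t 0 = 1"
  by (simp add: torus_pow_def)

text \<open>
  As in \<open>additive_extension\<close>, with values in the multiplicative group: \<open>c\<close> extends to a character of
  the lattice, whose values at the standard basis are the coordinates of \<open>t\<close>.
\<close>

lemma torus_point_of_character:
  fixes S :: "(int ^ 'n::finite) set" and c :: "int ^ 'n \<Rightarrow> 'k::field"
  assumes gen: "\<And>m. \<exists>a\<in>S. \<exists>b\<in>S. m = a - b"
    and closed: "\<And>a b. a \<in> S \<Longrightarrow> b \<in> S \<Longrightarrow> a + b \<in> S"
    and mult: "\<And>a b. a \<in> S \<Longrightarrow> b \<in> S \<Longrightarrow> c (a + b) = c a * c b"
    and nonzero: "\<And>a. a \<in> S \<Longrightarrow> c a \<noteq> 0"
  obtains t where "t \<in> torus" "\<And>m. m \<in> S \<Longrightarrow> torus_pow t m = c m"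
proof -
  obtain \<alpha> \<beta> where ab: "\<And>m. \<alpha> m \<in> S" "\<And>m. \<beta> m \<in> S" "\<And>m. m = \<alpha> m - \<beta> m"
    using gen by metis
  define C where "C m = c (\<alpha> m) / c (\<beta> m)" for m
  have C: "C (a - b) = c a / c b" if "a \<in> S" "b \<in> S" for a b
  proof -
    let ?m = "a - b"
    have "a + \<beta> ?m = \<alpha> ?m + b" using ab(3)[of ?m] by (simp add: algebra_simps)
    then have "c a * c (\<beta> ?m) = c (\<alpha> ?m) * c b"
      using mult[OF that(1) ab(2)] mult[OF ab(1) that(2)] by metis
    then show ?thesis unfolding C_def using nonzero[OF that(2)] nonzero[OF ab(2)[of ?m]]
      by (simp add: field_simps)
  qed
  have C_add: "C (x + y) = C x * C y" for x y
  proof -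
    have "x + y = (\<alpha> x + \<alpha> y) - (\<beta> x + \<beta> y)"
      using ab(3)[of x] ab(3)[of y] by (simp add: algebra_simps)
    then have "C (x + y) = c (\<alpha> x + \<alpha> y) / c (\<beta> x + \<beta> y)"
      using C[of "\<alpha> x + \<alpha> y" "\<beta> x + \<beta> y"] closed ab(1,2) by simp
    then show ?thesis unfolding C_def by (simp add: mult ab(1,2))
  qed
  have C_nonzero: "C m \<noteq> 0" for m
    unfolding C_def using nonzero ab(1,2) by simp
  have C_zero: "C 0 = 1" using C_add[of 0 0] C_nonzero[of 0] by simp
  have C_smult: "C (k *s x) = C x powi k" for k x
  proof (induction k rule: int_induct[where k = 0])
    case base
    have "(0 :: int) *s x = 0" by (simp add: vec_eq_iff)
    then show ?case using C_zero by simp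
  next
    case (step1 i)
    have "(i + 1) *s x = i *s x + x" by (simp add: vec_eq_iff algebra_simps)
    then show ?case using step1 C_add C_nonzero by (simp add: power_int_add)
  next
    case (step2 i)
    have "i *s x = (i - 1) *s x + x" by (simp add: vec_eq_iff algebra_simps)
    then have "C (i *s x) = C ((i - 1) *s x) * C x" using C_add by metis
    then show ?case using step2 C_nonzero[of x] by (simp add: power_int_diff field_simps)
  qed
  have C_sum: "C (sum f I) = (\<Prod>i\<in>I. C (f i))" for f :: "'n \<Rightarrow> int ^ 'n" and I
    by (induction I rule: infinite_finite_induct) (auto simp: C_add C_zero)
  define t where "t = (\<chi> i. C (axis i 1))"
  have "t \<in> torus" by (simp add: torus_def t_def C_nonzero)
  moreover have "torus_pow t m = c m" if m: "m \<in> S" for m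
  proof -
    have "torus_pow t m = C (\<Sum>i\<in>UNIV. m $ i *s axis i 1)"
      unfolding torus_pow_def C_sum C_smult t_def by simp
    also have "\<dots> = C m" using axis_expansion[of m] by simp
    also have "\<dots> = c m"
      using C[of "m + m" m] closed[OF m m] m mult[OF m m] nonzero[OF m] by simp
    finally show ?thesis .
  qed
  ultimately show ?thesis using that by blast
qed

context demazure_lnd
begin

text \<open>
  A description of \<open>\<T>\<^sub>\<delta>\<close> without a choice of torus points, from which the closure properties are
  evident.
\<close>

definition diagonal_stab :: "(('n, 'k) laurent \<Rightarrow> ('n, 'k) laurent) set"
  where "diagonal_stab = {\<phi> \<in> Aut_stab B \<delta>. \<forall>m\<in>S. \<exists>c. \<phi> (chi m) = single m c}"

lemma diagonal_stabE:
  assumes "\<phi> \<in> diagonal_stab" "m \<in> S"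
  obtains c where "c \<noteq> 0" "\<phi> (chi m) = single m c"
proof -
  obtain c where c: "\<phi> (chi m) = single m c"
    using assms by (auto simp: diagonal_stab_def)
  moreover have "\<phi> \<in> Aut B" using assms(1) Aut_stabD(1) by (simp add: diagonal_stab_def)
  ultimately have "c \<noteq> 0" using Aut_chi_neq_0[OF _ assms(2)] by auto
  then show ?thesis using that c by blast
qed

lemma diagonal_stab_homogeneous: "diagonal_stab \<subseteq> homogeneous_stab"
proof
  fix \<phi> assume \<phi>: "\<phi> \<in> diagonal_stab"
  then have st: "\<phi> \<in> Aut_stab B \<delta>" by (simp add: diagonal_stab_def)
  have "homogeneous_map B \<phi>"
  proof (rule homogeneous_mapI[OF Aut_stabD(1)[OF st]])
    show "homogeneous (\<phi> (chi m))" if "m \<in> S" for m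
      using \<phi> that unfolding diagonal_stab_def homogeneous_def by blast
  qed
  then show "\<phi> \<in> homogeneous_stab" using st by (simp add: homogeneous_stab_def)
qed

lemma diagonal_automorphism:
  assumes q: "q 0 = 1" "\<And>a b. a \<in> S \<Longrightarrow> b \<in> S \<Longrightarrow> q (a + b) = q a * q b"
    "\<And>a. a \<in> S \<Longrightarrow> q a \<noteq> 0"
    and shift: "\<And>m. m \<in> S \<Longrightarrow> 0 < pairing m v \<Longrightarrow> q (m + e) = q m"
  shows "restrict (lin_ext (\<lambda>m. single m (q m))) B \<in> diagonal_stab"
proof -
  let ?f = "lin_ext (\<lambda>m. single m (q m))"
  have "restrict ?f B \<in> Aut B" unfolding B_def
    by (rule Aut_of_multiplicative[where k = "\<lambda>m. single m (1 / q m)"])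
       (use zero_mem add_mem q in \<open>auto simp: mult_single single_in_semigroup_algebra\<close>)
  moreover have "?f (\<delta> b) = \<delta> (?f b)" if "b \<in> B" for b
  proof (rule lin_ext_commute_\<delta>[OF _ that])
    fix m assume m: "m \<in> S"
    show "?f (\<delta> (chi m)) = \<delta> (?f (chi m))"
      using shift[OF m] v_nonneg[OF m]
      by (cases "pairing m v = 0") (simp_all add: \<delta>_chi \<delta>_single mult_single mult.commute)
  qed
  ultimately show ?thesis
    unfolding diagonal_stab_def Aut_stab_def commute_on_def
    by (simp add: \<delta>_in_B mult_single) blast
qed

text \<open>
  The eigenvalues of a diagonal automorphism form a multiplicative function on \<open>S\<close>, hence come from
  a point \<open>t\<close> of the torus.  Commuting with \<open>\<delta>\<close> on a character of height 1 means \<open>t\<^sup>e = 1\<close>.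
\<close>

lemma T_group_eq_diagonal_stab: "T_group B e = diagonal_stab"
proof
  have act: "torus_act B t = restrict (lin_ext (\<lambda>m. single m (torus_pow t m))) B" for t
    by (simp add: torus_act_def mult_single)
  show "T_group B e \<subseteq> diagonal_stab"
  proof
    fix \<phi> assume "\<phi> \<in> T_group B e"
    then obtain t where t: "\<phi> = torus_act B t" "t \<in> torus" "torus_pow t e = 1"
      by (auto simp: T_group_def)
    show "\<phi> \<in> diagonal_stab" unfolding t(1) act
      by (rule diagonal_automorphism) (simp_all add: torus_pow_add torus_pow_nonzero t)
  qed
  show "diagonal_stab \<subseteq> T_group B e"
  proof
    fix \<phi> assume \<phi>: "\<phi> \<in> diagonal_stab"
    then have st: "\<phi> \<in> Aut_stab B \<delta>" by (simp add: diagonal_stab_def)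
    note A = Aut_stabD(1)[OF st]
    have "\<forall>m\<in>S. \<exists>c. c \<noteq> 0 \<and> \<phi> (chi m) = single m c"
      using diagonal_stabE[OF \<phi>] by blast
    then obtain c where c: "\<And>m. m \<in> S \<Longrightarrow> c m \<noteq> 0"
      "\<And>m. m \<in> S \<Longrightarrow> \<phi> (chi m) = single m (c m)"
      by metis
    have mult: "c (a + b) = c a * c b" if "a \<in> S" "b \<in> S" for a b
    proof -
      have "single (a + b) (c (a + b)) = single (a + b) (c a * c b)"
        using AutD_chi_add[OF A that] c(2) that add_mem by (simp add: mult_single)
      then show ?thesis by (metis lookup_single_eq)
    qed
    obtain t where t: "t \<in> torus" "\<And>m. m \<in> S \<Longrightarrow> torus_pow t m = c m"
      using torus_point_of_character[where c = c, OF differences add_mem mult c(1)] by blast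
    obtain s where s: "s \<in> S" "pairing s v = 1" using ex_height_one by blast
    have se: "s + e \<in> S" using shift_mem s by simp
    have "\<phi> (\<delta> (chi s)) = \<delta> (\<phi> (chi s))" using Aut_stabD(2)[OF st] s by simp
    then have "single (s + e) (c (s + e)) = single (s + e) (c s)"
      using c(2) s se by (simp add: \<delta>_chi \<delta>_single)
    then have "c (s + e) = c s" by (metis lookup_single_eq)
    then have "torus_pow t e = 1"
      using t(2)[OF s(1)] t(2)[OF se] torus_pow_add[OF t(1), of s e] c(1)[OF s(1)] by simp
    moreover have "\<phi> = torus_act B t"
    proof (rule Aut_eqI[OF A])
      have "torus_act B t \<in> diagonal_stab" unfolding act
        by (rule diagonal_automorphism)
           (simp_all add: torus_pow_add torus_pow_nonzero t(1) \<open>torus_pow t e = 1\<close>)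
      then show "torus_act B t \<in> Aut B" using Aut_stabD(1) by (simp add: diagonal_stab_def)
      show "\<phi> (chi m) = torus_act B t (chi m)" if "m \<in> S" for m
        using that c(2) t(2) by (simp add: act mult_single)
    qed
    ultimately show "\<phi> \<in> T_group B e" using t(1) unfolding T_group_def by blast
  qed
qed

lemma diagonal_stab_conjugate:
  assumes k: "k \<in> homogeneous_stab" and n: "n \<in> diagonal_stab"
  shows "k \<otimes>\<^bsub>BijGroup B\<^esub> n \<otimes>\<^bsub>BijGroup B\<^esub> inv\<^bsub>BijGroup B\<^esub> k \<in> diagonal_stab"
proof -
  let ?G = "BijGroup B"
  have n': "n \<in> Aut_stab B \<delta>" using n by (simp add: diagonal_stab_def)
  note k' = homogeneous_stabD(1)[OF k]
  have ih: "inv\<^bsub>?G\<^esub> k \<in> homogeneous_stab" by (rule homogeneous_stab_inv[OF k])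
  note i = homogeneous_stabD(1)[OF ih]
  have kn: "k \<otimes>\<^bsub>?G\<^esub> n \<in> Aut_stab B \<delta>" by (rule Aut_stab_mult[OF k' n'])
  note A = Aut_stabD(1)[OF k'] Aut_stabD(1)[OF n'] Aut_stabD(1)[OF i] Aut_stabD(1)[OF kn]
  have "\<exists>c. (k \<otimes>\<^bsub>?G\<^esub> n \<otimes>\<^bsub>?G\<^esub> inv\<^bsub>?G\<^esub> k) (chi m) = single m c" if m: "m \<in> S" for m
  proof -
    have mB: "chi m \<in> B" using m by simp
    obtain p c where pc: "p \<in> S" "(inv\<^bsub>?G\<^esub> k) (chi m) = single p c"
      using homogeneous_stabD(3)[OF ih m] by blast
    have pB: "single p c \<in> B" using pc(1) by (simp add: B_closed)
    obtain c' where c': "n (chi p) = single p c'" using diagonal_stabE[OF n pc(1)] by blast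
    have "n (single p c) = const c' * single p c"
      using AutD_single[OF A(2) pc(1), of c] by (simp add: c' mult_single mult.commute)
    then have "k (n (single p c)) = const c' * k (single p c)"
      using AutD_const[OF A(1) pB] by simp
    also have "k (single p c) = chi m"
      using Bij_inverse(2)[OF AutD(1)[OF A(1)] mB] pc(2) by simp
    also have "const c' * chi m = single m c'" by (simp add: mult_single)
    finally show ?thesis
      using BijGroup_apply[OF A(4,3) mB] BijGroup_apply[OF A(1,2) pB] pc(2) by auto
  qed
  then show ?thesis
    using Aut_stab_mult[OF kn i] by (simp add: diagonal_stab_def)
qed

lemma diagonal_stab_subgroup: "subgroup diagonal_stab (BijGroup B)"
proof (rule Bij_subgroupI)
  show "diagonal_stab \<subseteq> Bij B"
    using AutD(1) Aut_stabD(1) by (auto simp: diagonal_stab_def)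
  show "(\<lambda>x\<in>B. x) \<in> diagonal_stab"
    using subgroup.one_closed[OF Aut_stab_subgroup] by (auto simp: diagonal_stab_def BijGroup_one)
  show "compose B f g \<in> diagonal_stab" if fg: "f \<in> diagonal_stab" "g \<in> diagonal_stab" for f g
  proof -
    have st: "f \<in> Aut_stab B \<delta>" "g \<in> Aut_stab B \<delta>" using fg by (auto simp: diagonal_stab_def)
    note A = Aut_stabD(1)[OF st(1)] Aut_stabD(1)[OF st(2)]
    have "compose B f g \<in> Aut_stab B \<delta>"
      using Aut_stab_mult[OF st] BijGroup_mult AutD(1) A by metis
    moreover have "\<exists>c. compose B f g (chi m) = single m c" if m: "m \<in> S" for m
    proof -
      obtain a where a: "f (chi m) = single m a" using diagonal_stabE[OF fg(1) m] by blast
      obtain b where b: "g (chi m) = single m b" using diagonal_stabE[OF fg(2) m] by blast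
      have "compose B f g (chi m) = const b * f (chi m)"
        using AutD_single[OF A(1) m, of b] m by (simp add: compose_eq b)
      then have "compose B f g (chi m) = single m (b * a)" by (simp add: a mult_single)
      then show ?thesis by blast
    qed
    ultimately show ?thesis by (simp add: diagonal_stab_def)
  qed
  show "inv\<^bsub>BijGroup B\<^esub> f \<in> diagonal_stab" if f: "f \<in> diagonal_stab" for f
  proof -
    have st: "f \<in> Aut_stab B \<delta>" using f by (auto simp: diagonal_stab_def)
    note A = Aut_stabD(1)[OF st]
    note inv = Bij_inverse[OF AutD(1)[OF A]]
    have "\<exists>c. (inv\<^bsub>BijGroup B\<^esub> f) (chi m) = single m c" if m: "m \<in> S" for m
    proof -
      obtain c where c: "c \<noteq> 0" "f (chi m) = single m c" using diagonal_stabE[OF f m] by blast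
      have "f (single m (1 / c)) = chi m"
        using AutD_single[OF A m, of "1 / c"] c by (simp add: mult_single)
      moreover have "single m (1 / c) \<in> B" using m by (simp add: B_closed)
      ultimately show ?thesis using inv(3)[of "single m (1 / c)"] by auto
    qed
    then show ?thesis
      using Aut_stab_inv[OF st] by (simp add: diagonal_stab_def)
  qed
qed

text \<open>
  The height of a character is the number of times that \<open>\<delta>\<close> can be applied to it before it is killed
  by the next application; \<open>\<phi>\<close> respects this number, and therefore the scalars produced by
  \<open>\<delta>\<close> on both sides of \<open>\<phi> \<delta> = \<delta> \<phi>\<close> agree.
\<close>

lemma homogeneous_stab_height:
  assumes f: "\<phi> \<in> homogeneous_stab" and m: "m \<in> S"
    and pc: "\<phi> (chi m) = single p c"
  shows "pairing p v = pairing m v"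
    and "0 < pairing m v \<Longrightarrow> \<phi> (chi (m + e)) = single (p + e) c"
proof -
  note st = homogeneous_stabD(1)[OF f]
  note A = Aut_stabD(1)[OF st]
  have step: "single p' (of_int (pairing m v) * c') = single (p + e) (c * of_int (pairing p v))"
    if "m \<in> S" "m + e \<in> S" "\<phi> (chi m) = single p c" "\<phi> (chi (m + e)) = single p' c'"
    for m p c p' c'
  proof -
    have "\<phi> (\<delta> (chi m)) = \<delta> (\<phi> (chi m))" using Aut_stabD(2)[OF st] that(1) by simp
    moreover have "\<phi> (\<delta> (chi m)) = const (of_int (pairing m v)) * \<phi> (chi (m + e))"
      unfolding \<delta>_chi by (rule AutD_single[OF A that(2)])
    ultimately show ?thesis unfolding that(3,4) by (simp add: \<delta>_single mult_single)
  qed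
  have height: "m \<in> S \<Longrightarrow> pairing m v = int d \<Longrightarrow> \<phi> (chi m) = single p c \<Longrightarrow>
      pairing p v = int d" for d m p c
  proof (induction d arbitrary: m p c)
    case 0
    then have m0: "m \<in> S0" by (simp add: S0_def)
    have "c \<noteq> 0" using Aut_chi_neq_0[OF A 0(1)] 0(3) by auto
    then show ?case
      using pairing_single_ker[of p c] Aut_stab_ker[OF st chi_S0_in_ker[OF m0]] 0(3) by (simp add: S0_def)
  next
    case (Suc d)
    have me: "m + e \<in> S" "pairing (m + e) v = int d"
      using shift_mem Suc.prems by (auto simp: pairing_left e_v)
    obtain p' c' where p': "c' \<noteq> 0" "\<phi> (chi (m + e)) = single p' c'"
      using homogeneous_stabD(3)[OF f me(1)] by blast
    have "single p' (of_int (pairing m v) * c') = single (p + e) (c * of_int (pairing p v))"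
      by (rule step[OF Suc.prems(1) me(1) Suc.prems(3) p'(2)])
    moreover have "(of_int (pairing m v) * c' :: 'k) \<noteq> 0" using Suc.prems(2) p'(1) by (simp del: of_nat_Suc)
    ultimately have "p' = p + e" by (metis lookup_single_eq lookup_single_not_eq)
    then show ?case using Suc.IH[OF me p'(2)] by (simp add: pairing_left e_v)
  qed
  show pv: "pairing p v = pairing m v"
    using height[OF m _ pc] v_nonneg[OF m] by (metis nonneg_int_cases)
  show "\<phi> (chi (m + e)) = single (p + e) c" if pos: "0 < pairing m v"
  proof -
    have me: "m + e \<in> S" by (rule shift_mem[OF m pos])
    obtain p' c' where p': "c' \<noteq> 0" "\<phi> (chi (m + e)) = single p' c'"
      using homogeneous_stabD(3)[OF f me(1)] by blast
    have eq: "single p' (of_int (pairing m v) * c') = single (p + e) (c * of_int (pairing m v))"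
      using step[OF m me pc p'(2)] pv by simp
    have nz: "(of_int (pairing m v) :: 'k) \<noteq> 0" using pos by simp
    then have "of_int (pairing m v) * c' \<noteq> 0" using p'(1) by simp
    then have 1: "p' = p + e" using eq by (metis lookup_single_eq lookup_single_not_eq)
    then have "of_int (pairing m v) * c' = c * of_int (pairing m v)" using eq by (metis lookup_single_eq)
    then have "c' = c" using nz by simp
    then show ?thesis using p'(2) 1 by simp
  qed
qed

end

section \<open>Irreducible generators of the kernel\<close>

text \<open>
  The submonoid generated by \<open>E\<close>, in the form that an element is zero or splits off a generator.
\<close>

inductive_set monoid_span :: "('a::comm_monoid_add) set \<Rightarrow> 'a set" for E where
  zero: "0 \<in> monoid_span E"
| add: "a \<in> E \<Longrightarrow> b \<in> monoid_span E \<Longrightarrow> a + b \<in> monoid_span E"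

lemma monoid_span_add:
  "a \<in> monoid_span E \<Longrightarrow> b \<in> monoid_span E \<Longrightarrow> a + b \<in> monoid_span E"
  by (induction rule: monoid_span.induct) (auto simp: add.assoc intro: monoid_span.add)

lemma monoid_span_incl: "a \<in> E \<Longrightarrow> a \<in> monoid_span E"
  using monoid_span.add[OF _ monoid_span.zero, of a E] by simp

locale generated_kernel = maximal_demazure_lnd S v e B \<delta>
  for S :: "(int ^ 'n::finite) set" and v e :: "int ^ 'n"
    and B :: "('n, 'k::field_char_0) laurent set" and \<delta> :: "('n, 'k) laurent \<Rightarrow> ('n, 'k) laurent" +
  fixes Y :: "('n, 'k) laurent set"
  assumes finite_Y: "finite Y"
    and Y_homogeneous: "\<And>y. y \<in> Y \<Longrightarrow> homogeneous y"
    and Y_irreducible: "\<And>y. y \<in> Y \<Longrightarrow> ring_irreducible\<^bsub>ring_of B\<^esub> y"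
    and Y_not_proportional: "\<And>y y'. y \<in> Y \<Longrightarrow> y' \<in> Y \<Longrightarrow> proportional y y' \<Longrightarrow> y = y'"
    and Y_generates: "alg_gen Y = ker_on B \<delta>"
begin

lemma Y_in_ker: "y \<in> Y \<Longrightarrow> y \<in> ker_on B \<delta>"
  unfolding Y_generates[symmetric] alg_gen_def by (rule hull_inc)

lemma Y_in_B: "y \<in> Y \<Longrightarrow> y \<in> B"
  using Y_in_ker by (auto simp: ker_on_def)

lemma ring_of_simps:
  "carrier (ring_of X) = X" "x \<otimes>\<^bsub>ring_of X\<^esub> y = x * y" "x \<oplus>\<^bsub>ring_of X\<^esub> y = x + y"
  "\<one>\<^bsub>ring_of X\<^esub> = 1" "\<zero>\<^bsub>ring_of X\<^esub> = 0"
  by (simp_all add: ring_of_def)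

lemma domain_B: "domain (ring_of B)"
proof -
  have "cring (ring_of B)"
  proof (intro cringI abelian_groupI comm_monoidI)
    fix x assume "x \<in> carrier (ring_of B)"
    then have x: "x \<in> B" by (simp add: ring_of_def)
    have "const (- 1) * x \<in> B" by (rule B_closed(4)[OF x])
    moreover have "const (- 1) * x + x = 0" by (simp add: single_uminus)
    ultimately show "\<exists>y\<in>carrier (ring_of B). y \<oplus>\<^bsub>ring_of B\<^esub> x = \<zero>\<^bsub>ring_of B\<^esub>"
      by (auto simp: ring_of_def)
  qed (auto simp: ring_of_def B_closed algebra_simps)
  then show ?thesis
  proof (rule domain.intro)
    show "domain_axioms (ring_of B)"
    proof
      show "\<one>\<^bsub>ring_of B\<^esub> \<noteq> \<zero>\<^bsub>ring_of B\<^esub>" by (simp add: ring_of_def)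
      show "a = \<zero>\<^bsub>ring_of B\<^esub> \<or> b = \<zero>\<^bsub>ring_of B\<^esub>"
        if "a \<otimes>\<^bsub>ring_of B\<^esub> b = \<zero>\<^bsub>ring_of B\<^esub>" for a b
        using that laurent_mult_nonzero[of a b] by (auto simp: ring_of_def)
    qed
  qed
qed

definition unit :: "('n, 'k) laurent \<Rightarrow> bool"
  where "unit f \<longleftrightarrow> f \<in> B \<and> (\<exists>g\<in>B. f * g = 1)"

lemma unit_iff: "unit f \<longleftrightarrow> f \<in> Units (ring_of B)"
  by (auto simp: unit_def Units_def ring_of_def mult.commute)

lemma unit_left_factor: "f \<in> B \<Longrightarrow> g \<in> B \<Longrightarrow> unit (f * g) \<Longrightarrow> unit f"
  unfolding unit_def by (metis B_closed(5) mult.assoc)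

lemma unit_right_factor: "f \<in> B \<Longrightarrow> g \<in> B \<Longrightarrow> unit (f * g) \<Longrightarrow> unit g"
  using unit_left_factor[of g f] by (simp add: mult.commute)

lemma unit_const: "c \<noteq> 0 \<Longrightarrow> unit (const c)"
  unfolding unit_def using zero_mem
  by (auto simp: B_closed intro!: bexI[of _ "const (1 / c)"] simp: mult_single)

lemma unit_image: "\<phi> \<in> Aut B \<Longrightarrow> unit f \<Longrightarrow> unit (\<phi> f)"
  unfolding unit_def using AutD(3,4,5) by metis

lemma Y_factor:
  assumes "y \<in> Y" "f \<in> B" "g \<in> B" "y = f * g"
  shows "unit f \<or> unit g"
  using domain.ring_irreducibleE(5)[OF domain_B _ Y_irreducible[OF assms(1)], of f g, unfolded ring_of_simps]
    assms(2-4) Y_in_B[OF assms(1)]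
  unfolding unit_iff by blast

lemma Y_not_unit: "y \<in> Y \<Longrightarrow> \<not> unit y" and Y_nonzero: "y \<in> Y \<Longrightarrow> y \<noteq> 0"
  using domain.ring_irreducibleE(1,4)[OF domain_B _ Y_irreducible, of y, unfolded ring_of_simps] Y_in_B
  unfolding unit_iff by blast+

text \<open>
  The exponents of the generators.  By \<open>S0_monoid_span\<close> and irreducibility they are the indecomposable
  elements of \<open>S0\<close>.
\<close>

definition E :: "(int ^ 'n) set"
  where "E = {m. \<exists>c. c \<noteq> 0 \<and> single m c \<in> Y}"

lemma YE:
  assumes "y \<in> Y"
  obtains m c where "m \<in> E" "c \<noteq> 0" "y = single m c"
proof -
  obtain m c where mc: "y = single m c"
    using Y_homogeneous[OF assms] by (auto simp: homogeneous_def)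
  moreover have "c \<noteq> 0" using Y_nonzero[OF assms] mc by auto
  ultimately show ?thesis using that assms by (auto simp: E_def)
qed

lemma E_S0: "a \<in> E \<Longrightarrow> a \<in> S0"
  using Y_in_ker pairing_single_ker unfolding E_def by blast

lemma chi_E_not_unit:
  assumes a: "a \<in> E"
  shows "\<not> unit (chi a)"
proof
  assume u: "unit (chi a)"
  obtain c where c: "c \<noteq> 0" "single a c \<in> Y" using a by (auto simp: E_def)
  obtain g where g: "g \<in> B" "chi a * g = 1" using u by (auto simp: unit_def)
  have "single a c * (const (1 / c) * g) = (single a c * const (1 / c)) * g"
    by (simp only: mult.assoc)
  also have "\<dots> = 1" using c(1) g(2) by (simp add: mult_single)
  finally have "unit (single a c)"
    using Y_in_B[OF c(2)] B_closed(4)[OF g(1)] by (auto simp: unit_def)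
  then show False using Y_not_unit[OF c(2)] by simp
qed

lemma monoid_span_E_S: "b \<in> monoid_span E \<Longrightarrow> b \<in> S"
  by (induction rule: monoid_span.induct) (auto simp: zero_mem intro: add_mem E_S0 S0_subset)

text \<open>
  A generator in a decomposition of \<open>b\<close> would divide a unit.
\<close>

lemma unit_monoid_span_E:
  assumes "b \<in> monoid_span E" "unit (chi b)"
  shows "b = 0"
  using assms(1)
proof cases
  case (add a b')
  then have "unit (chi a * chi b')" using assms(2) by (simp add: chi_add)
  moreover have "chi a \<in> B" "chi b' \<in> B"
    using add E_S0 S0_subset monoid_span_E_S by auto
  ultimately have "unit (chi a)" using unit_left_factor by blast
  then show ?thesis using chi_E_not_unit add(2) by blast
qed

text \<open>
  The span of the characters with exponents in \<open>monoid_span E\<close> is an algebra containing \<open>Y\<close>, hence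
  contains the kernel of \<open>\<delta>\<close>.
\<close>

lemma S0_monoid_span: "S0 \<subseteq> monoid_span E"
proof
  fix p assume p: "p \<in> S0"
  have "alg_gen Y \<subseteq> semigroup_algebra (monoid_span E)"
    unfolding alg_gen_def
  proof (rule hull_minimal)
    show "Y \<subseteq> semigroup_algebra (monoid_span E)"
    proof
      fix y assume "y \<in> Y"
      then obtain m c where "m \<in> E" "y = single m c" using YE by metis
      then show "y \<in> semigroup_algebra (monoid_span E)"
        by (simp add: single_in_semigroup_algebra monoid_span_incl)
    qed
    show "range const \<subseteq> (semigroup_algebra (monoid_span E) :: ('n, 'k) laurent set) \<and>
      (\<forall>a\<in>semigroup_algebra (monoid_span E) :: ('n, 'k) laurent set.
        \<forall>b\<in>semigroup_algebra (monoid_span E).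
          a + b \<in> semigroup_algebra (monoid_span E) \<and> a * b \<in> semigroup_algebra (monoid_span E))"
      by (auto simp: single_in_semigroup_algebra monoid_span.zero monoid_span_add
          semigroup_algebra_add semigroup_algebra_mult)
  qed
  then have "chi p \<in> (semigroup_algebra (monoid_span E) :: ('n, 'k) laurent set)"
    using chi_S0_in_ker[OF p] unfolding Y_generates by blast
  then show "p \<in> monoid_span E" by simp
qed

text \<open>
  If \<open>p\<close> decomposed into a generator and a nonzero remainder, applying the inverse of \<open>\<psi>\<close> would
  decompose the irreducible generator of exponent \<open>a\<close> into two nonunits.
\<close>

lemma E_preserved:
  assumes \<psi>: "\<psi> \<in> homogeneous_stab" and a: "a \<in> E" and pc: "\<psi> (chi a) = single p c"
  shows "p \<in> E"
proof -
  note st = homogeneous_stabD(1)[OF \<psi>]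
  note A = Aut_stabD(1)[OF st]
  let ?i = "inv\<^bsub>BijGroup B\<^esub> \<psi>"
  have iA: "?i \<in> Aut B" by (rule Aut_inv[OF A])
  note inv = Bij_inverse[OF AutD(1)[OF A]]
  note aS = S0_subset[OF E_S0[OF a]]
  have aB: "chi a \<in> B" using aS by simp
  have c: "c \<noteq> 0" using Aut_chi_neq_0[OF A aS] pc by auto
  have "p \<in> S0"
    using Aut_stab_ker[OF st chi_S0_in_ker[OF E_S0[OF a]]] pairing_single_ker[OF _ c] pc by simp
  then have "p \<in> monoid_span E" using S0_monoid_span by blast
  then show ?thesis
  proof cases
    case zero
    then have "unit (\<psi> (chi a))" using pc unit_const[OF c] by simp
    from unit_image[OF iA this] have "unit (chi a)" using inv(3)[OF aB] by simp
    then show ?thesis using chi_E_not_unit[OF a] by blast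
  next
    case (add a' b)
    have a'B: "chi a' \<in> B" and bB: "chi b \<in> B"
      using add E_S0 S0_subset monoid_span_E_S by auto
    obtain c0 where c0: "c0 \<noteq> 0" "single a c0 \<in> Y" using a by (auto simp: E_def)
    let ?f = "const (c0 * c) * chi a'"
    have fB: "?f \<in> B" by (rule B_closed(4)[OF a'B])
    have "\<psi> (single a c0) = ?f * chi b"
      using AutD_single[OF A aS, of c0] by (simp add: pc add(1) mult_single)
    then have "single a c0 = ?i (?f * chi b)"
      using inv(3)[OF Y_in_B[OF c0(2)]] by simp
    also have "\<dots> = ?i ?f * ?i (chi b)" by (rule AutD(4)[OF iA fB bB])
    finally have "unit (?i ?f) \<or> unit (?i (chi b))"
      using Y_factor[OF c0(2)] AutD(5)[OF iA] fB bB by blast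
    then have "unit ?f \<or> unit (chi b)"
      using unit_image[OF A, of "?i ?f"] unit_image[OF A, of "?i (chi b)"] inv(2)[OF fB] inv(2)[OF bB] by auto
    moreover have "\<not> unit ?f"
    proof
      assume u: "unit ?f"
      have "const (c0 * c) \<in> B" using zero_mem by (simp add: B_closed)
      then have "unit (chi a')" using unit_right_factor[OF _ a'B u] by blast
      then show False using chi_E_not_unit[OF add(2)] by blast
    qed
    ultimately have "unit (chi b)" by blast
    then have "b = 0" using unit_monoid_span_E add(3) by blast
    then show ?thesis using add by simp
  qed
qed

lemma S_group_iff: "\<phi> \<in> S_group B \<delta> Y \<longleftrightarrow> \<phi> \<in> homogeneous_stab \<and> \<phi> ` Y = Y"
  by (auto simp: S_group_def homogeneous_stab_def)

lemma S_group_subgroup: "subgroup (S_group B \<delta> Y) (BijGroup B)"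
proof (rule Bij_subgroupI)
  show "S_group B \<delta> Y \<subseteq> Bij B"
    using AutD(1) homogeneous_stabD(2) S_group_iff by blast
  have "(\<lambda>x\<in>B. x) ` Y = Y" using Y_in_B by force
  then show "(\<lambda>x\<in>B. x) \<in> S_group B \<delta> Y"
    using subgroup.one_closed[OF homogeneous_stab_subgroup] by (simp add: S_group_iff BijGroup_one)
  show "compose B f g \<in> S_group B \<delta> Y" if fg: "f \<in> S_group B \<delta> Y" "g \<in> S_group B \<delta> Y" for f g
  proof -
    have "f \<in> homogeneous_stab" "g \<in> homogeneous_stab" using fg by (auto simp: S_group_iff)
    then have "compose B f g \<in> homogeneous_stab"
      using homogeneous_stab_mult BijGroup_mult AutD(1) homogeneous_stabD(2) by metis
    moreover have "compose B f g ` Y = f ` g ` Y"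
      unfolding image_image by (rule image_cong) (auto simp: compose_eq Y_in_B)
    ultimately show ?thesis using fg by (simp add: S_group_iff)
  qed
  show "inv\<^bsub>BijGroup B\<^esub> f \<in> S_group B \<delta> Y" if f: "f \<in> S_group B \<delta> Y" for f
  proof -
    have h: "f \<in> homogeneous_stab" and im: "f ` Y = Y" using f by (auto simp: S_group_iff)
    have "(inv\<^bsub>BijGroup B\<^esub> f) ` Y = (inv\<^bsub>BijGroup B\<^esub> f) ` f ` Y" using im by simp
    also have "\<dots> = (\<lambda>y. y) ` Y" unfolding image_image
      by (rule image_cong) (auto simp: Bij_inverse(3)[OF AutD(1)[OF homogeneous_stabD(2)[OF h]]] Y_in_B)
    finally show ?thesis using homogeneous_stab_inv[OF h] by (simp add: S_group_iff)
  qed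
qed

lemma homogeneous_stab_fixing_generators:
  assumes \<phi>: "\<phi> \<in> homogeneous_stab" and fixes_Y: "\<And>y. y \<in> Y \<Longrightarrow> \<phi> y = y"
  shows "\<phi> = (\<lambda>b\<in>B. b)"
proof (rule homogeneous_stab_fixing_kernel[OF \<phi>])
  note A = homogeneous_stabD(2)[OF \<phi>]
  let ?H = "{b \<in> B. \<phi> b = b}"
  have "alg_gen Y \<subseteq> ?H" unfolding alg_gen_def
  proof (rule hull_minimal)
    show "Y \<subseteq> ?H" using Y_in_B fixes_Y by blast
    have "\<phi> (const c) = const c" for c
      using AutD_const[OF A B_closed(2), of c] AutD(3)[OF A] by simp
    then show "range const \<subseteq> ?H \<and> (\<forall>a\<in>?H. \<forall>b\<in>?H. a + b \<in> ?H \<and> a * b \<in> ?H)"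
      using zero_mem by (auto simp: B_closed AutD_add[OF A] AutD(4)[OF A])
  qed
  then show "\<phi> (chi m) = chi m" if "m \<in> S0" for m
    using chi_S0_in_ker[OF that] unfolding Y_generates by blast
qed

text \<open>
  A diagonal map sends a generator to a multiple of itself, and the only such multiple in \<open>Y\<close> is the
  generator.
\<close>

lemma S_group_inter_diagonal: "S_group B \<delta> Y \<inter> diagonal_stab \<subseteq> {\<one>\<^bsub>BijGroup B\<^esub>}"
proof
  fix \<phi> assume \<phi>: "\<phi> \<in> S_group B \<delta> Y \<inter> diagonal_stab"
  then have h: "\<phi> \<in> homogeneous_stab" and im: "\<phi> ` Y = Y" by (auto simp: S_group_iff)
  have "\<phi> y = y" if y: "y \<in> Y" for y
  proof -
    obtain m c where mc: "m \<in> E" "c \<noteq> 0" "y = single m c" using YE[OF y] .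
    have m: "m \<in> S" using E_S0 S0_subset mc(1) by blast
    obtain c' where c': "c' \<noteq> 0" "\<phi> (chi m) = single m c'"
      using diagonal_stabE[OF _ m] \<phi> by blast
    have "\<phi> y = const c' * y"
      using AutD_single[OF homogeneous_stabD(2)[OF h] m, of c]
      by (simp add: mc(3) c'(2) mult_single mult.commute)
    then have "proportional (\<phi> y) y" using c'(1) by (auto simp: proportional_def)
    then show ?thesis using Y_not_proportional y im by blast
  qed
  then show "\<phi> \<in> {\<one>\<^bsub>BijGroup B\<^esub>}"
    using homogeneous_stab_fixing_generators[OF h] by (simp add: BijGroup_one)
qed

text \<open>
  Let \<open>\<psi> \<chi>\<^sup>m = c m \<chi>\<^bsup>\<tau> m\<^esup>\<close>, and let the generator of exponent \<open>m\<close> be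
  \<open>t\<^sub>0\<^sup>m \<chi>\<^sup>m\<close>.  Then \<open>\<psi>\<close> multiplies it by \<open>q m\<close> relative to the generator of
  exponent \<open>\<tau> m\<close>, where \<open>q m = c m t\<^sub>0\<^sup>m / t\<^sub>0\<^bsup>\<tau> m\<^esup>\<close>.  This function is
  multiplicative on all of \<open>S\<close> and unchanged under \<open>m \<mapsto> m + e\<close>, so it defines a diagonal element
  \<open>t\<close> of the stabilizer, and \<open>\<psi> t\<^bsup>-1\<^esup>\<close> permutes the generators.
\<close>

lemma homogeneous_stab_decomposition:
  assumes base: "characters_at_base_point Y" and \<psi>: "\<psi> \<in> homogeneous_stab"
  shows "\<exists>s\<in>S_group B \<delta> Y. \<exists>t\<in>diagonal_stab. \<psi> = s \<otimes>\<^bsub>BijGroup B\<^esub> t"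
proof -
  let ?G = "BijGroup B"
  interpret G: group ?G by (rule group_BijGroup)
  note A = homogeneous_stabD(2)[OF \<psi>]
  obtain t0 where t0: "t0 \<in> torus"
    and Y_base: "\<And>y. y \<in> Y \<Longrightarrow> \<exists>m. y = single m (torus_pow t0 m)"
    using base unfolding characters_at_base_point_def by (auto simp: mult_single)
  obtain \<tau> c where \<tau>: "\<And>m. m \<in> S \<Longrightarrow> \<tau> m \<in> S" "\<And>m. m \<in> S \<Longrightarrow> c m \<noteq> 0"
      "\<And>m. m \<in> S \<Longrightarrow> \<psi> (chi m) = single (\<tau> m) (c m)"
    using homogeneous_stabD(3)[OF \<psi>] by metis
  have eqI: "\<tau> m = p \<and> c m = k" if "m \<in> S" "\<psi> (chi m) = single p k" for m p k
  proof -
    have eq: "single (\<tau> m) (c m) = single p k" using that \<tau>(3) by simp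
    then have "\<tau> m = p" using \<tau>(2)[OF that(1)] by (metis lookup_single_eq lookup_single_not_eq)
    then show ?thesis using eq by (metis lookup_single_eq)
  qed
  have add: "\<tau> (a + b) = \<tau> a + \<tau> b \<and> c (a + b) = c a * c b" if "a \<in> S" "b \<in> S" for a b
    by (rule eqI[OF add_mem[OF that]]) (simp add: AutD_chi_add[OF A that] \<tau>(3) that mult_single)
  have zero: "\<tau> 0 = 0 \<and> c 0 = 1"
    by (rule eqI[OF zero_mem]) (use AutD(3)[OF A] in simp)
  have shift: "\<tau> (m + e) = \<tau> m + e \<and> c (m + e) = c m" if "m \<in> S" "0 < pairing m v" for m
    by (rule eqI[OF shift_mem[OF that]]) (rule homogeneous_stab_height(2)[OF \<psi> that(1) \<tau>(3)[OF that(1)] that(2)])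
  define q where "q m = c m * torus_pow t0 m / torus_pow t0 (\<tau> m)" for m
  define t where "t = restrict (lin_ext (\<lambda>m. single m (q m))) B"
  have q_nz: "q m \<noteq> 0" if "m \<in> S" for m
    using \<tau>(2)[OF that] torus_pow_nonzero[OF t0] by (simp add: q_def)
  have t: "t \<in> diagonal_stab" unfolding t_def
  proof (rule diagonal_automorphism)
    show "q 0 = 1" by (simp add: q_def zero)
    show "q (a + b) = q a * q b" if "a \<in> S" "b \<in> S" for a b
      using add[OF that] by (simp add: q_def torus_pow_add[OF t0])
    show "q (m + e) = q m" if "m \<in> S" "0 < pairing m v" for m
      using shift[OF that] torus_pow_nonzero[OF t0, of e] by (simp add: q_def torus_pow_add[OF t0])
  qed (rule q_nz)
  have th: "t \<in> homogeneous_stab" using t diagonal_stab_homogeneous by blast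
  note tA = homogeneous_stabD(2)[OF th]
  have ti: "inv\<^bsub>?G\<^esub> t \<in> homogeneous_stab" by (rule homogeneous_stab_inv[OF th])
  let ?s = "\<psi> \<otimes>\<^bsub>?G\<^esub> inv\<^bsub>?G\<^esub> t"
  have sh: "?s \<in> homogeneous_stab" by (rule homogeneous_stab_mult[OF \<psi> ti])
  have sY: "?s y \<in> Y" if y: "y \<in> Y" for y
  proof -
    obtain m where m: "y = single m (torus_pow t0 m)" using Y_base[OF y] by blast
    have mE: "m \<in> E" using y m torus_pow_nonzero[OF t0] by (auto simp: E_def)
    then have mS: "m \<in> S" using E_S0 S0_subset by blast
    have yB: "y \<in> B" by (rule Y_in_B[OF y])
    let ?y' = "single m (torus_pow t0 m / q m)"
    have y'B: "?y' \<in> B" using mS by (simp add: B_closed)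
    have "t ?y' = y"
      unfolding t_def using y'B q_nz[OF mS] by (simp add: m mult_single)
    then have "(inv\<^bsub>?G\<^esub> t) y = ?y'"
      using Bij_inverse(3)[OF AutD(1)[OF tA] y'B] by simp
    then have "?s y = \<psi> ?y'" using BijGroup_apply[OF A homogeneous_stabD(2)[OF ti] yB] by simp
    also have "\<dots> = const (torus_pow t0 m / q m) * \<psi> (chi m)" by (rule AutD_single[OF A mS])
    also have "\<dots> = single (\<tau> m) (torus_pow t0 (\<tau> m))"
      using \<tau>(2)[OF mS] torus_pow_nonzero[OF t0] by (simp add: \<tau>(3)[OF mS] mult_single q_def)
    finally have sy: "?s y = single (\<tau> m) (torus_pow t0 (\<tau> m))" .
    have "\<tau> m \<in> E" by (rule E_preserved[OF \<psi> mE \<tau>(3)[OF mS]])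
    then obtain k where k: "k \<noteq> 0" "single (\<tau> m) k \<in> Y" by (auto simp: E_def)
    obtain m' where "single (\<tau> m) k = single m' (torus_pow t0 m')"
      using Y_base[OF k(2)] by blast
    then have "k = torus_pow t0 (\<tau> m)" using k(1) by (metis lookup_single_eq lookup_single_not_eq)
    then show ?thesis using k(2) sy by simp
  qed
  have "inj_on ?s Y"
    using Aut_inject[OF homogeneous_stabD(2)[OF sh]] Y_in_B by (meson inj_onI)
  then have "?s ` Y = Y" using endo_inj_surj[OF finite_Y] sY by blast
  then have "?s \<in> S_group B \<delta> Y" using sh by (simp add: S_group_iff)
  moreover have "\<psi> = ?s \<otimes>\<^bsub>?G\<^esub> t"
    using AutD(1)[OF A] AutD(1)[OF tA] by (simp add: carrier_BijGroup[symmetric] G.m_assoc)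
  ultimately show ?thesis using t by blast
qed

theorem homogeneous_stab_semidirect:
  assumes base: "characters_at_base_point Y"
  shows "S_group B \<delta> Y <#>\<^bsub>BijGroup B\<^esub> T_group B e = homogeneous_stab"
    and "semidirect (sub_aut B homogeneous_stab) (S_group B \<delta> Y) (T_group B e)"
proof -
  have sub: "S_group B \<delta> Y \<subseteq> homogeneous_stab" by (auto simp: S_group_iff)
  show "S_group B \<delta> Y <#>\<^bsub>BijGroup B\<^esub> T_group B e = homogeneous_stab"
    unfolding T_group_eq_diagonal_stab
  proof
    show "S_group B \<delta> Y <#>\<^bsub>BijGroup B\<^esub> diagonal_stab \<subseteq> homogeneous_stab"
      using sub diagonal_stab_homogeneous homogeneous_stab_mult
      unfolding set_mult_def by blast
    show "homogeneous_stab \<subseteq> S_group B \<delta> Y <#>\<^bsub>BijGroup B\<^esub> diagonal_stab"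
      using homogeneous_stab_decomposition[OF base] unfolding set_mult_def by blast
  qed
  show "semidirect (sub_aut B homogeneous_stab) (S_group B \<delta> Y) (T_group B e)"
    unfolding sub_aut_def T_group_eq_diagonal_stab
    by (rule semidirectI[OF group_BijGroup homogeneous_stab_subgroup S_group_subgroup diagonal_stab_subgroup
          sub diagonal_stab_homogeneous diagonal_stab_conjugate S_group_inter_diagonal
          homogeneous_stab_decomposition[OF base]])
qed

theorem S_group_permutations:
  shows "\<exists>H. subgroup H (BijGroup Y) \<and>
      sub_aut B (S_group B \<delta> Y) \<cong> (BijGroup Y)\<lparr>carrier := H\<rparr>"
    and "finite (S_group B \<delta> Y)"
proof -
  let ?S = "S_group B \<delta> Y" and ?r = "\<lambda>\<phi>. restrict \<phi> Y"
  have h: "\<phi> \<in> homogeneous_stab" "\<phi> \<in> Aut B" "\<phi> ` Y = Y" if "\<phi> \<in> ?S" for \<phi>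
    using that homogeneous_stabD(2) by (auto simp: S_group_iff)
  have r_Bij: "?r \<phi> \<in> Bij Y" if "\<phi> \<in> ?S" for \<phi>
  proof -
    have "inj_on \<phi> Y" using Aut_inject[OF h(2)[OF that]] Y_in_B by (meson inj_onI)
    then have "bij_betw \<phi> Y Y" using h(3)[OF that] by (simp add: bij_betw_def)
    then show ?thesis by (simp add: Bij_def)
  qed
  have r_inj: "inj_on ?r ?S"
  proof (rule inj_onI)
    fix \<phi> \<psi> assume \<phi>: "\<phi> \<in> ?S" and \<psi>: "\<psi> \<in> ?S" and eq: "?r \<phi> = ?r \<psi>"
    interpret G: group "BijGroup B" by (rule group_BijGroup)
    have i: "inv\<^bsub>BijGroup B\<^esub> \<psi> \<in> ?S" by (rule subgroup.m_inv_closed[OF S_group_subgroup \<psi>])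
    let ?u = "inv\<^bsub>BijGroup B\<^esub> \<psi> \<otimes>\<^bsub>BijGroup B\<^esub> \<phi>"
    have u: "?u \<in> homogeneous_stab"
      using subgroup.m_closed[OF S_group_subgroup i \<phi>] h(1) by blast
    have "?u y = y" if "y \<in> Y" for y
    proof -
      have "\<phi> y = \<psi> y" using eq that by (metis restrict_apply')
      then show ?thesis
        using BijGroup_apply[OF h(2)[OF i] h(2)[OF \<phi>] Y_in_B[OF that]]
          Bij_inverse(3)[OF AutD(1)[OF h(2)[OF \<psi>]] Y_in_B[OF that]] by simp
    qed
    then have "?u = \<one>\<^bsub>BijGroup B\<^esub>"
      using homogeneous_stab_fixing_generators[OF u] by (simp add: BijGroup_one)
    moreover have carr: "\<phi> \<in> carrier (BijGroup B)" "\<psi> \<in> carrier (BijGroup B)"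
      using AutD(1)[OF h(2)[OF \<phi>]] AutD(1)[OF h(2)[OF \<psi>]] by (simp_all add: carrier_BijGroup)
    moreover have "\<psi> \<otimes>\<^bsub>BijGroup B\<^esub> ?u = \<phi>"
      using carr by (simp add: G.m_assoc[symmetric])
    ultimately show "\<phi> = \<psi>" by simp
  qed
  have "finite (Bij Y)"
  proof (rule finite_subset)
    show "Bij Y \<subseteq> Y \<rightarrow>\<^sub>E Y"
    proof
      fix f assume "f \<in> Bij Y"
      then show "f \<in> Y \<rightarrow>\<^sub>E Y"
        unfolding PiE_def using Bij_imp_extensional[of f Y] Bij_imp_funcset[of f Y] by simp
    qed
  qed (use finite_Y in \<open>auto intro: finite_PiE\<close>)
  then show "finite ?S"
    using finite_imageD[OF finite_subset r_inj] r_Bij by blast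
  let ?G = "sub_aut B ?S"
  have gG: "group ?G"
    unfolding sub_aut_def by (rule subgroup.subgroup_is_group[OF S_group_subgroup group_BijGroup])
  have r_mult: "?r (\<phi> \<otimes>\<^bsub>?G\<^esub> \<psi>) = ?r \<phi> \<otimes>\<^bsub>BijGroup Y\<^esub> ?r \<psi>" if \<phi>: "\<phi> \<in> ?S" and \<psi>: "\<psi> \<in> ?S" for \<phi> \<psi>
  proof
    fix y
    have "\<phi> \<otimes>\<^bsub>?G\<^esub> \<psi> = \<phi> \<otimes>\<^bsub>BijGroup B\<^esub> \<psi>" by (simp add: sub_aut_def)
    then show "?r (\<phi> \<otimes>\<^bsub>?G\<^esub> \<psi>) y = (?r \<phi> \<otimes>\<^bsub>BijGroup Y\<^esub> ?r \<psi>) y"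
      using BijGroup_apply[OF h(2)[OF \<phi>] h(2)[OF \<psi>] Y_in_B[of y]] h(3)[OF \<psi>]
      unfolding BijGroup_mult[OF r_Bij[OF \<phi>] r_Bij[OF \<psi>]] by (auto simp: compose_def)
  qed
  have carr: "carrier ?G = ?S" by (simp add: sub_aut_def)
  have hom: "?r \<in> hom ?G (BijGroup Y)"
    by (rule homI) (simp_all add: carr r_Bij carrier_BijGroup r_mult)
  interpret gh: group_hom ?G "BijGroup Y" ?r
    by (intro group_hom.intro group_hom_axioms.intro gG group_BijGroup hom)
  have "subgroup (?r ` ?S) (BijGroup Y)" using gh.img_is_subgroup by (simp add: carr)
  moreover have "?r \<in> iso ?G ((BijGroup Y)\<lparr>carrier := ?r ` ?S\<rparr>)"
    using r_inj r_mult by (auto simp: iso_def hom_def carr bij_betw_def)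
  ultimately show "\<exists>H. subgroup H (BijGroup Y) \<and> ?G \<cong> (BijGroup Y)\<lparr>carrier := H\<rparr>"
    unfolding is_iso_def by blast
qed

end

section \<open>The stabilizer of a maximal homogeneous derivation\<close>

lemma affine_semigroup_closed:
  assumes "affine_semigroup S"
  shows "0 \<in> S" "\<And>a b. a \<in> S \<Longrightarrow> b \<in> S \<Longrightarrow> a + b \<in> S"
  using assms unfolding affine_semigroup_def hull_def by auto

lemma generates_lattice_differences:
  assumes "generates_lattice S" "0 \<in> S" "\<And>a b. a \<in> S \<Longrightarrow> b \<in> S \<Longrightarrow> a + b \<in> S"
  shows "\<exists>a\<in>S. \<exists>b\<in>S. m = a - b"
proof -
  let ?D = "{m. \<exists>a\<in>S. \<exists>b\<in>S. m = a - b}"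
  have "(\<lambda>H. 0 \<in> H \<and> (\<forall>a\<in>H. \<forall>b\<in>H. a - b \<in> H)) hull S \<subseteq> ?D"
  proof (rule hull_minimal)
    show "S \<subseteq> ?D" using assms(2) by force
    have "(a - b) - (a' - b') = (a + b') - (b + a')" for a b a' b' :: "int ^ 'a"
      by simp
    then show "0 \<in> ?D \<and> (\<forall>a\<in>?D. \<forall>b\<in>?D. a - b \<in> ?D)"
      using assms(2,3) by (smt (verit, ccfv_threshold) diff_0_right mem_Collect_eq)
  qed
  then show ?thesis using assms(1) unfolding generates_lattice_def by auto
qed

lemma ray_generator_nonneg:
  assumes "associated_cone S \<sigma>" "ray_generator \<sigma> v" "m \<in> S"
  shows "0 \<le> pairing m v"
proof -
  have gen: "x \<in> cone_gen X" if "x \<in> X" for x :: "rat ^ 'n::finite" and X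
    unfolding cone_gen_def using that
    by (intro CollectI exI[of _ "{x}"] exI[of _ "\<lambda>_. 1"]) simp
  have "rat_vec v \<in> \<sigma>"
    using assms(2) gen[of "rat_vec v" "{rat_vec v}"] unfolding ray_generator_def extremal_ray_def by auto
  moreover have "rat_vec m \<in> dual_cone \<sigma>"
    using assms(1,3) gen[of "rat_vec m"] unfolding associated_cone_def by auto
  ultimately have "0 \<le> pairing (rat_vec m) (rat_vec v)" by (simp add: dual_cone_def)
  also have "pairing (rat_vec m) (rat_vec v) = of_int (pairing m v)"
    by (simp add: pairing_def rat_vec_def)
  finally show ?thesis by simp
qed

theorem theorem7p3:
  fixes S :: "(int ^ 'n::finite) set"
    and \<sigma> :: "(rat ^ 'n) set"
    and v e :: "int ^ 'n"
    and B A :: "('n, 'k::{alg_closed_field, field_char_0}) laurent set"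
    and \<delta> :: "('n, 'k) laurent \<Rightarrow> ('n, 'k) laurent"
    and ys zs :: "('n, 'k) laurent list"
  assumes "affine_semigroup S" and "generates_lattice S"
    and "B = semigroup_algebra S"
    and "associated_cone S \<sigma>"
    and "demazure_root \<sigma> v e"
    and "\<delta> = demazure_der v e"
    and "homogeneous_map B \<delta>" and "maximal_lnd B \<delta>"
    and "A = ker_on B \<delta>"
    and "\<forall>g \<in> set (ys @ zs). g \<in> B \<and> homogeneous g \<and> ring_irreducible\<^bsub>ring_of B\<^esub> g"
    and "\<forall>i j. i < j \<and> j < length (ys @ zs) \<longrightarrow> \<not> proportional ((ys @ zs) ! i) ((ys @ zs) ! j)"
    and "alg_gen (set (ys @ zs)) = B"
    and "alg_gen (set ys) = A"
  shows "((\<exists>H. subgroup H (BijGroup (set ys)) \<and>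
             sub_aut B (S_group B \<delta> (set ys)) \<cong> (BijGroup (set ys))\<lparr>carrier := H\<rparr>) \<and>
          finite (S_group B \<delta> (set ys))) \<and>
         (characters_at_base_point (set ys) \<longrightarrow>
           (let ST = S_group B \<delta> (set ys) <#>\<^bsub>BijGroup B\<^esub> T_group B e in
             semidirect (sub_aut B ST) (S_group B \<delta> (set ys)) (T_group B e) \<and>
             semidirect (sub_aut B (Aut_stab B \<delta>)) ST (U_group B \<delta>)))"
proof -
  note S = affine_semigroup_closed[OF assms(1)]
  have v_nonneg: "0 \<le> pairing m v" if "m \<in> S" for m
    using ray_generator_nonneg[OF assms(4) _ that] assms(5) by (simp add: demazure_root_def)
  have shift: "m + e \<in> S" if "m \<in> S" "0 < pairing m v" for m
  proof -
    have "chi m \<in> B" using that(1) assms(3) by simp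
    then have "\<delta> (chi m) \<in> B" using assms(8) by (auto simp: maximal_lnd_def lnd_def)
    moreover have "lookup (\<delta> (chi m)) (m + e) \<noteq> 0"
      using that(2) by (simp add: assms(6) demazure_der_def mult_single)
    ultimately show ?thesis unfolding assms(3) mem_semigroup_algebra_iff by blast
  qed
  have not_proportional: "y = y'" 
    if y: "y \<in> set ys" "y' \<in> set ys" and pp: "proportional y y'" for y y'
  proof (rule ccontr)
    assume "y \<noteq> y'"
    obtain c where c: "c \<noteq> 0" "y = const c * y'" using pp by (auto simp: proportional_def)
    have "const (1 / c) * y = (const (1 / c) * const c) * y'" using c(2) by (simp only: mult.assoc)
    also have "const (1 / c) * const c = (1 :: ('n, 'k) laurent)" using c(1) by (simp add: mult_single)
    finally have "y' = const (1 / c) * y" by simp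
    then have sym: "proportional y' y" using c(1) unfolding proportional_def by (intro exI[of _ "1 / c"]) simp
    obtain i j where ij: "i < length ys" "j < length ys" "ys ! i = y" "ys ! j = y'"
      using y by (auto simp: in_set_conv_nth)
    have "i \<noteq> j" using ij \<open>y \<noteq> y'\<close> by auto
    moreover have "(ys @ zs) ! i = y" "(ys @ zs) ! j = y'" using ij by (auto simp: nth_append)
    ultimately show False
      using assms(11) pp sym ij by (metis linorder_neqE_nat length_append trans_less_add1)
  qed
  interpret generated_kernel S v e B \<delta> "set ys"
  proof unfold_locales
    show "pairing e v = - 1" using assms(5) by (simp add: demazure_root_def)
    show "\<exists>a\<in>S. \<exists>b\<in>S. m = a - b" for m by (rule generates_lattice_differences[OF assms(2) S])
  qed (use assms S v_nonneg shift not_proportional in auto)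
  show ?thesis
    using S_group_permutations homogeneous_stab_semidirect stabilizer_semidirect
    unfolding Let_def by auto
qed

end
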